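(* Let $X$ be a separable Banach function space over the unit circle $\mathbb{T}$ and let the Riesz projection $P$ be bounded on $X$. If $A\in\mathcal{B}(H[X])$ and there is a sequence $\{a_n\}_{n\in\mathbb{Z}}$ of complex numbers satisfying \[ \langle A\chi_j,\chi_k\rangle=a_{k-j}\quad\text{for all integers } j,k\ge 0, \] then there exists a function $a\in L^\infty$ such that $A=T_a$ and $\widehat a(n)=a_n$ for all $n\in\mathbb{Z}$. Moreover, \[ \|a\|_{L^\infty}\le\|T_a\|_{\mathcal{B}(H[X])}\le\|P\|_{\mathcal{B}(X)}\|a\|_{L^\infty}. \]
   Context: $\mathbb{T}$ is the unit circle in $\mathbb{C}$ with normalized Lebesgue measure $dm(t)=|dt|/(2\pi)$; $L^p=L^p(\mathbb{T})$ with respect to $m$; $L^0$ is the space of measurable complex-valued functions on $\mathbb{T}$, and $L^0_+$ is the set of measurable functions on $\mathbb{T}$ with values in $[0,\infty]$. $\mathbb{I}_E$ is the indicator function of $E$. A Banach function norm is a mapping $\rho:L^0_+\to[0,\infty]$ such that for all $f,g,f_n\in L^0_+$ ($n\in\mathbb{N}$), all constants $c\ge 0$ and all measurable $E\subset\mathbb{T}$: (A1) $\rho(f)=0\Leftrightarrow f=0$ a.e., $\rho(cf)=c\rho(f)$, $\rho(f+g)\le\rho(f)+\rho(g)$; (A2) $0\le g\le f$ a.e. implies $\rho(g)\le\rho(f)$; (A3) $0\le f_n\uparrow f$ a.e. implies $\rho(f_n)\uparrow\rho(f)$; (A4) $\rho(\mathbb{I}_E)<\infty$; (A5) $\int_E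 f\,dm\le C_E\,\rho(f)$ with a constant $C_E\in(0,\infty)$ independent of $f$. The Banach function space determined by $\rho$ is $X=\{f\in L^0:\rho(|f|)<\infty\}$ (functions equal a.e. are identified) with norm $\|f\|_X=\rho(|f|)$. One has $L^\infty\subset X\subset L^1$ continuously. For $f\in L^1$, $\widehat f(n)=\int_{\mathbb{T}}f(t)t^{-n}\,dm(t)$, $n\in\mathbb{Z}$. The abstract Hardy space is $H[X]=\{f\in X:\widehat f(n)=0\text{ for all }n<0\}$, with the norm of $X$. Put $\chi_n(t)=t^n$ and $\langle f,g\rangle=\int_{\mathbb{T}}f\overline{g}\,dm$ whenever the integral makes sense. The Riesz projection is defined for $f\in L^1$ and a.e. $t\in\mathbb{T}$ by $(Pf)(t)=\frac12\big(f(t)+(Sf)(t)\big)$, where $(Sf)(t)=\frac1{\pi i}\,\mathrm{p.v.}\int_{\mathbb{T}}\frac{f(\tau)}{\tau-t}\,d\tau$. "$P$ is bounded on $X$" means that $P$ maps $X$ to $X$ and is a bounded operator there. In that case $P(X)=H[X]$. $\mathcal{B}(E)$ is the space of bounded linear operators on a Banach space $E$. For $a\in L^\infty$, the Toeplitz operator $T_a:H[X]\to H[X]$ is $T_af=P(af)$. *)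

theory Defs
  imports "HOL-Probability.Probability"
begin

section \<open>The unit circle\<close>

text \<open>
  The completed pushforward of the uniform distribution on \<open>[0, 2\<pi>]\<close> under \<open>\<theta> \<mapsto> e\<^sup>i\<^sup>\<theta>\<close>; its
  \<open>\<sigma>\<close>-algebra consists of the Lebesgue measurable subsets of the circle. Functions on the
  circle are HOL functions on \<^typ>\<open>complex\<close>; their values off the circle are irrelevant, since
  the underlying space of the measure is the circle.
\<close>

definition circle :: "complex measure" where
  "circle = completion
     (distr (uniform_measure lborel {0..2 * pi}) (restrict_space borel (sphere 0 1)) cis)"

definition chi :: "int \<Rightarrow> complex \<Rightarrow> complex" where
  "chi n = (\<lambda>t. t powi n)"

definition fourier_coeff :: "(complex \<Rightarrow> complex) \<Rightarrow> int \<Rightarrow> complex" where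
  "fourier_coeff f n = (\<integral>t. f t * t powi (- n) \<partial>circle)"

definition pairing :: "(complex \<Rightarrow> complex) \<Rightarrow> (complex \<Rightarrow> complex) \<Rightarrow> complex" where
  "pairing f g = (\<integral>t. f t * cnj (g t) \<partial>circle)"

definition Linf_norm :: "(complex \<Rightarrow> complex) \<Rightarrow> real" where
  "Linf_norm a = enn2real (esssup circle (\<lambda>t. ennreal (cmod (a t))))"

definition Linf :: "(complex \<Rightarrow> complex) set" where
  "Linf = {a \<in> borel_measurable circle. esssup circle (\<lambda>t. ennreal (cmod (a t))) < \<infinity>}"

section \<open>Banach function spaces\<close>

text \<open>In \<^typ>\<open>ennreal\<close> one has \<open>0 * \<infinity> = 0\<close>, as is customary for the homogeneity axiom.\<close>

definition banach_function_norm :: "((complex \<Rightarrow> ennreal) \<Rightarrow> ennreal) \<Rightarrow> bool" where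
  "banach_function_norm \<rho> \<longleftrightarrow>
     (\<forall>f \<in> borel_measurable circle. \<rho> f = 0 \<longleftrightarrow> (AE t in circle. f t = 0)) \<and>
     (\<forall>f \<in> borel_measurable circle. \<forall>c::real. 0 \<le> c \<longrightarrow>
        \<rho> (\<lambda>t. ennreal c * f t) = ennreal c * \<rho> f) \<and>
     (\<forall>f \<in> borel_measurable circle. \<forall>g \<in> borel_measurable circle.
        \<rho> (\<lambda>t. f t + g t) \<le> \<rho> f + \<rho> g) \<and>
     (\<forall>f \<in> borel_measurable circle. \<forall>g \<in> borel_measurable circle.
        (AE t in circle. g t \<le> f t) \<longrightarrow> \<rho> g \<le> \<rho> f) \<and>
     (\<forall>F f. (\<forall>n::nat. F n \<in> borel_measurable circle) \<longrightarrow> f \<in> borel_measurable circle \<longrightarrow>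
        (AE t in circle. incseq (\<lambda>n. F n t) \<and> (\<lambda>n. F n t) \<longlonglongrightarrow> f t) \<longrightarrow>
        incseq (\<lambda>n. \<rho> (F n)) \<and> (\<lambda>n. \<rho> (F n)) \<longlonglongrightarrow> \<rho> f) \<and>
     (\<forall>E \<in> sets circle. \<rho> (indicator E) < \<infinity>) \<and>
     (\<forall>E \<in> sets circle. \<exists>C::real. 0 < C \<and>
        (\<forall>f \<in> borel_measurable circle. (\<integral>\<^sup>+t\<in>E. f t \<partial>circle) \<le> ennreal C * \<rho> f))"

text \<open>
  The spaces below consist of functions rather than classes of functions: identification of
  functions equal almost everywhere is expressed by stating equalities almost everywhere.
\<close>

definition bfs :: "((complex \<Rightarrow> ennreal) \<Rightarrow> ennreal) \<Rightarrow> (complex \<Rightarrow> complex) set" where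
  "bfs \<rho> = {f \<in> borel_measurable circle. \<rho> (\<lambda>t. ennreal (cmod (f t))) < \<infinity>}"

definition bfs_norm :: "((complex \<Rightarrow> ennreal) \<Rightarrow> ennreal) \<Rightarrow> (complex \<Rightarrow> complex) \<Rightarrow> real" where
  "bfs_norm \<rho> f = enn2real (\<rho> (\<lambda>t. ennreal (cmod (f t))))"

definition bfs_separable :: "((complex \<Rightarrow> ennreal) \<Rightarrow> ennreal) \<Rightarrow> bool" where
  "bfs_separable \<rho> \<longleftrightarrow>
     (\<exists>D. countable D \<and> D \<subseteq> bfs \<rho> \<and>
        (\<forall>f \<in> bfs \<rho>. \<forall>\<epsilon>>0. \<exists>d \<in> D. bfs_norm \<rho> (\<lambda>t. f t - d t) < \<epsilon>))"

definition hardy_space :: "((complex \<Rightarrow> ennreal) \<Rightarrow> ennreal) \<Rightarrow> (complex \<Rightarrow> complex) set" where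
  "hardy_space \<rho> = {f \<in> bfs \<rho>. \<forall>n<0. fourier_coeff f n = 0}"

section \<open>Bounded linear operators on spaces of functions\<close>

text \<open>
  \<open>E\<close> is a linear space of functions and \<open>N\<close> its norm. Linearity and boundedness together
  imply that the operator respects equality almost everywhere.
\<close>

definition bounded_operator ::
  "(complex \<Rightarrow> complex) set \<Rightarrow> ((complex \<Rightarrow> complex) \<Rightarrow> real) \<Rightarrow>
    ((complex \<Rightarrow> complex) \<Rightarrow> (complex \<Rightarrow> complex)) \<Rightarrow> bool" where
  "bounded_operator E N T \<longleftrightarrow>
     (\<forall>f \<in> E. T f \<in> E) \<and>
     (\<forall>f \<in> E. \<forall>g \<in> E. AE t in circle. T (\<lambda>s. f s + g s) t = T f t + T g t) \<and>
     (\<forall>f \<in> E. \<forall>c. AE t in circle. T (\<lambda>s. c * f s) t = c * T f t) \<and>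
     (\<exists>C. \<forall>f \<in> E. N (T f) \<le> C * N f)"

definition operator_norm ::
  "(complex \<Rightarrow> complex) set \<Rightarrow> ((complex \<Rightarrow> complex) \<Rightarrow> real) \<Rightarrow>
    ((complex \<Rightarrow> complex) \<Rightarrow> (complex \<Rightarrow> complex)) \<Rightarrow> real" where
  "operator_norm E N T = (SUP f \<in> {f \<in> E. N f \<le> 1}. N (T f))"

section \<open>Riesz projection and Toeplitz operators\<close>

text \<open>
  The principal value of the line integral of \<open>g\<close> along the positively oriented circle, with
  symmetric truncation at \<open>t\<close>. With \<open>\<tau> = e\<^sup>i\<^sup>\<theta>\<close> one has \<open>d\<tau> = i\<tau> d\<theta> = 2\<pi>i\<tau> dm(\<tau>)\<close>. Where the
  limit does not exist, the value of \<^const>\<open>Lim\<close> is unspecified; for \<open>g(\<tau>) = f(\<tau>) / (\<tau> - t)\<close>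
  with integrable \<open>f\<close> this concerns only a null set of points \<open>t\<close>.
\<close>

definition pv_integral :: "(complex \<Rightarrow> complex) \<Rightarrow> complex \<Rightarrow> complex" where
  "pv_integral g t =
     Lim (at_right 0)
       (\<lambda>\<epsilon>::real. (LINT \<tau>:{\<tau>. \<epsilon> < cmod (\<tau> - t)}|circle. g \<tau> * (2 * of_real pi * \<i> * \<tau>)))"

definition singular_integral :: "(complex \<Rightarrow> complex) \<Rightarrow> complex \<Rightarrow> complex" where
  "singular_integral f t = 1 / (of_real pi * \<i>) * pv_integral (\<lambda>\<tau>. f \<tau> / (\<tau> - t)) t"

definition riesz :: "(complex \<Rightarrow> complex) \<Rightarrow> complex \<Rightarrow> complex" where
  "riesz f t = (f t + singular_integral f t) / 2"

definition toeplitz :: "(complex \<Rightarrow> complex) \<Rightarrow> (complex \<Rightarrow> complex) \<Rightarrow> complex \<Rightarrow> complex" where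
  "toeplitz a f = riesz (\<lambda>t. a t * f t)"

end

theory Submission
  imports Defs "HOL-Complex_Analysis.Complex_Analysis"
begin

text \<open>
  For a trigonometric polynomial \<open>p\<close> the functions \<open>h\<^sub>n = \<chi>\<^sub>-\<^sub>n A (\<chi>\<^sub>n p)\<close> have norm at most \<open>\<parallel>A\<parallel> \<parallel>p\<parallel>\<close>, and the
  Fourier coefficients of \<open>h\<^sub>n\<close> of index at least \<open>- n\<close> are those of the formal product \<open>a p\<close>. A limit of
  the \<open>h\<^sub>n\<close> is obtained without duality. The differences \<open>h\<^sub>m - h\<^sub>n\<close> are trigonometric polynomials \<open>c\<close> bounded
  in \<open>X\<close>. As \<open>P\<close> is bounded on \<open>X\<close>, the analytic completion \<open>F\<close> of a trigonometric polynomial \<open>g\<close> close to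
  \<open>\<bar>c\<bar> + 2\<close> is bounded in \<open>X\<close>, hence in \<open>L\<^sup>1\<close>, and the mean value property of \<open>F Ln F\<close> bounds the integral of
  \<open>g ln g\<close> (M. Riesz's converse to Zygmund's theorem). Near-minimizers of a strictly convex \<open>L log L\<close>-type
  functional over the decreasing convex sets of admissible \<open>c\<close> then converge in \<open>L\<^sup>1\<close>, and the Fatou property
  puts the limit into \<open>X\<close>. With \<open>p = 1\<close> this produces \<open>a\<close>; for general \<open>p\<close> it shows that multiplication by \<open>a\<close>
  has norm at most \<open>\<parallel>A\<parallel>\<close>, so \<open>\<bar>a\<bar> \<le> \<parallel>A\<parallel>\<close> almost everywhere. Separability makes trigonometric polynomials
  dense in \<open>X\<close>, so that \<open>P\<close> acts on all of \<open>X\<close> by truncation of Fourier series and \<open>A = T\<^sub>a\<close> follows by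
  comparing Fourier coefficients.
\<close>

section \<open>Integration and trigonometric polynomials on the circle\<close>

text \<open>The obstacle is compactness. A bounded sequence in \<open>X\<close> is bounded in L^1,
  but weak limits of such sequences may be singular measures, and \<open>X\<close> need not be
  reflexive. What excludes concentration is the boundedness of \<open>riesz\<close>: on norm-bounded
  sets of trigonometric polynomials it yields uniform integrability, in the form of an L log L
  bound. Minimization over nested convex sets then plays the part of weak compactness: a
  quantitative strict convexity gives norm convergence in L^1, hence convergence almost everywhere
  along a subsequence, and this is what the Fatou property of \<open>\<rho>\<close> can use. The
  analytic argument needs functions holomorphic across the circle. It is therefore applied to
  differences of the shifted functions: these have finitely many nonzero Fourier coefficients,
  although the functions themselves may be rough. The operator \<open>riesz\<close> is a principal
  value at each point; it is computed explicitly for characters, and its action on other functions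
  is deduced from linearity, boundedness and density.\<close>

definition circle_borel :: "complex measure" where
  "circle_borel =
     distr (uniform_measure lborel {0..2 * pi}) (restrict_space borel (sphere 0 1)) cis"

lemma circle_eq: "circle = completion circle_borel"
  by (simp add: circle_def circle_borel_def)

lemma space_circle_borel [simp]: "space circle_borel = sphere 0 1"
  by (simp add: circle_borel_def space_restrict_space)

lemma sets_circle_borel [simp, measurable_cong]:
  "sets circle_borel = sets (restrict_space borel (sphere 0 1))"
  by (simp add: circle_borel_def)

lemma space_circle [simp]: "space circle = sphere 0 1"
  by (simp add: circle_eq)

lemma measurable_cis_circle [measurable]:
  "cis \<in> measurable lborel (restrict_space borel (sphere 0 1))"
  by (rule measurable_restrict_space2)
     (auto intro!: borel_measurable_continuous_onI continuous_intros)

lemma prob_space_circle_borel: "prob_space circle_borel"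
  unfolding circle_borel_def
  by (intro prob_space.prob_space_distr prob_space_uniform_measure)
     (auto intro!: measurable_restrict_space2 borel_measurable_continuous_onI continuous_intros)

lemma prob_space_circle: "prob_space circle"
proof (rule prob_spaceI)
  have "emeasure circle (space circle) = emeasure circle_borel (space circle_borel)"
    unfolding circle_eq space_completion
    by (metis emeasure_completion main_part sets.top sets_completionI_sets)
  then show "emeasure circle (space circle) = 1"
    using prob_space.emeasure_space_1[OF prob_space_circle_borel] by simp
qed

interpretation circle: prob_space circle
  by (rule prob_space_circle)

interpretation circle_borel: prob_space circle_borel
  by (rule prob_space_circle_borel)

lemma measurable_circle:
  "f \<in> borel_measurable borel \<Longrightarrow> f \<in> borel_measurable circle"
  unfolding circle_eq
  by (intro measurable_completion) (simp add: measurable_restrict_space1 cong: measurable_cong_sets)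

lemma sphere_sets_circle [simp]: "sphere 0 1 \<in> sets circle"
  using sets.top[of circle] by simp

lemma indicator_measurable_circle:
  "A \<in> sets borel \<Longrightarrow> (indicator A :: complex \<Rightarrow> complex) \<in> borel_measurable circle"
  by (intro measurable_circle borel_measurable_indicator)

lemma measurable_circle_continuous:
  fixes f :: "complex \<Rightarrow> 'a::topological_space"
  assumes "continuous_on (sphere 0 1) f"
  shows "f \<in> borel_measurable circle"
  unfolding circle_eq using borel_measurable_continuous_on_restrict[OF assms]
  by (intro measurable_completion) (simp cong: measurable_cong_sets)

lemma integral_circle_borel:
  fixes f :: "complex \<Rightarrow> 'a::{banach, second_countable_topology}"
  assumes "f \<in> borel_measurable circle_borel"
  shows "(\<integral>t. f t \<partial>circle) = (\<integral>t. f t \<partial>circle_borel)"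
  unfolding circle_eq by (rule integral_completion[OF assms])

text \<open>The gauge integral over [0, 2 pi] is the form in which contour integrals become
  available; the factor 1 / (2 pi) is the density of the uniform measure.\<close>

lemma integral_circle_cis:
  fixes f :: "complex \<Rightarrow> complex"
  assumes "continuous_on (sphere 0 1) f"
  shows "(\<integral>t. f t \<partial>circle) = integral {0..2 * pi} (\<lambda>x. f (cis x)) / (2 * pi)"
proof -
  have f: "f \<in> borel_measurable (restrict_space borel (sphere 0 1))"
    by (rule borel_measurable_continuous_on_restrict[OF assms])
  have c: "continuous_on {0..2 * pi} (\<lambda>x. f (cis x))"
    by (intro continuous_on_compose2[OF assms] continuous_intros) auto
  have ig: "set_integrable lborel {0..2*pi} (\<lambda>x. f (cis x))"
    using borel_integrable_atLeastAtMost'[OF c] .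
  have "(\<integral>t. f t \<partial>circle) = (\<integral>t. f t \<partial>circle_borel)"
    by (rule integral_circle_borel) (use f in \<open>simp cong: measurable_cong_sets\<close>)
  also have "\<dots> = (\<integral>x. f (cis x) \<partial>uniform_measure lborel {0..2*pi})"
    unfolding circle_borel_def
    by (subst integral_distr) (use f in \<open>simp_all add: cong: measurable_cong_sets\<close>)
  also have "\<dots> = (LINT x:{0..2*pi}|lborel. f (cis x)) / (2 * pi)"
  proof -
    have [measurable]: "(\<lambda>x. f (cis x)) \<in> borel_measurable lborel"
      using measurable_compose[OF measurable_cis_circle f] .
    have [measurable]: "(\<lambda>x. indicator {0..2*pi} x / (2*pi) :: real) \<in> borel_measurable lborel"
      by measurable
    have "uniform_measure lborel {0..2*pi} = density lborel (\<lambda>x. ennreal (indicator {0..2*pi} x / (2*pi)))"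
      unfolding uniform_measure_def
      by (intro density_cong) (auto split: split_indicator simp: divide_ennreal ennreal_1[symmetric] simp del: ennreal_1)
    then have "(\<integral>x. f (cis x) \<partial>uniform_measure lborel {0..2*pi})
       = (\<integral>x. (indicator {0..2*pi} x / (2*pi)) *\<^sub>R f (cis x) \<partial>lborel)"
      by (simp only:) (subst integral_density, auto)
    also have "\<dots> = (\<integral>x. (1/(2*pi)) *\<^sub>R (indicator {0..2*pi} x *\<^sub>R f (cis x)) \<partial>lborel)"
      by (intro Bochner_Integration.integral_cong) auto
    finally show ?thesis
      by (simp add: set_lebesgue_integral_def scaleR_conv_of_real)
  qed
  also have "(LINT x:{0..2*pi}|lborel. f (cis x)) = integral {0..2*pi} (\<lambda>x. f (cis x))"
    by (rule set_borel_integral_eq_integral(2)[OF ig])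
  finally show ?thesis .
qed

section \<open>Characters and the mean value property\<close>

lemma continuous_on_chi [continuous_intros]: "continuous_on (sphere 0 1) (chi n)"
  unfolding chi_def by (intro continuous_intros) auto

lemma norm_chi [simp]: "t \<in> sphere 0 1 \<Longrightarrow> cmod (chi n t) = 1"
  by (simp add: chi_def norm_power_int)

lemma chi_0 [simp]: "chi 0 t = 1"
  by (simp add: chi_def)

lemma chi_mult: "t \<in> sphere 0 1 \<Longrightarrow> chi m t * chi n t = chi (m + n) t"
  by (subst (1 2 3) chi_def, subst power_int_add) auto

lemma cnj_chi: "t \<in> sphere 0 1 \<Longrightarrow> cnj (chi n t) = chi (- n) t"
proof -
  assume t: "t \<in> sphere 0 1"
  have "t * cnj t = 1" using t by (simp add: complex_norm_square[symmetric])
  then have "cnj t = inverse t" by (simp add: inverse_unique)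
  then show ?thesis by (simp add: chi_def power_int_minus power_int_inverse)
qed

text \<open>Cauchy's integral formula at the centre: with u = \<open>cis x\<close> the kernel 1 / u
  cancels against du = i u dx.\<close>

lemma mean_value_circle:
  assumes "continuous_on (cball 0 1) f" "f holomorphic_on ball 0 1"
  shows "(\<integral>t. f t \<partial>circle) = f 0"
proof -
  have "((\<lambda>u. f u / (u - 0)) has_contour_integral (2 * of_real pi * \<i> * f 0)) (circlepath 0 1)"
    by (rule Cauchy_integral_circlepath) (use assms in auto)
  then have "((\<lambda>x. f (cis x) / cis x * \<i> * cis x) has_integral (2 * of_real pi * \<i> * f 0)) {0..2*pi}"
    unfolding circlepath_def
    by (subst (asm) has_contour_integral_part_circlepath_iff) (auto simp: cis_conv_exp mult_ac)
  then have "((\<lambda>x. \<i> * f (cis x)) has_integral (2 * of_real pi * \<i> * f 0)) {0..2*pi}"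
    by (rule has_integral_eq[rotated]) (auto simp: field_simps)
  then have "((\<lambda>x. (-\<i>) * (\<i> * f (cis x))) has_integral (-\<i>) * (2 * of_real pi * \<i> * f 0)) {0..2*pi}"
    by (rule has_integral_mult_right)
  then have "integral {0..2*pi} (\<lambda>x. f (cis x)) = 2 * of_real pi * f 0"
    by (intro integral_unique) (simp add: algebra_simps)
  moreover have "continuous_on (sphere 0 1) f"
    by (rule continuous_on_subset[OF assms(1)]) auto
  ultimately show ?thesis
    by (simp add: integral_circle_cis)
qed

text \<open>For n >= 0 the character is a polynomial, to which the mean value property applies; for
  n < 0 it has a pole at 0 and is handled through its conjugate.\<close>

lemma integral_chi: "(\<integral>t. chi n t \<partial>circle) = of_bool (n = 0)"
proof -
  have *: "(\<integral>t. chi (int n) t \<partial>circle) = of_bool (n = 0)" for n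
    by (subst mean_value_circle) (auto simp: chi_def intro!: continuous_intros holomorphic_intros)
  show ?thesis
  proof (cases "n \<ge> 0")
    case True
    then show ?thesis using *[of "nat n"] by auto
  next
    case False
    have "(\<integral>t. chi n t \<partial>circle) = (\<integral>t. cnj (chi (-n) t) \<partial>circle)"
      by (intro Bochner_Integration.integral_cong) (simp_all add: cnj_chi)
    also have "\<dots> = cnj (\<integral>t. chi (-n) t \<partial>circle)" by simp
    also have "\<dots> = 0" using *[of "nat (-n)"] False by auto
    finally show ?thesis using False by simp
  qed
qed

lemma integrable_circle_bounded:
  fixes f :: "complex \<Rightarrow> 'a::{banach, second_countable_topology}"
  assumes "f \<in> borel_measurable circle" "\<And>t. t \<in> sphere 0 1 \<Longrightarrow> norm (f t) \<le> B"
  shows "integrable circle f"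
  using assms by (intro circle.integrable_const_bound[of _ B]) auto

lemma integrable_circle_continuous:
  fixes f :: "complex \<Rightarrow> 'a::{banach, second_countable_topology}"
  assumes "continuous_on (sphere 0 1) f"
  shows "integrable circle f"
proof -
  have "bounded (f ` sphere 0 1)"
    by (intro compact_imp_bounded compact_continuous_image assms) auto
  then obtain B where "\<forall>t \<in> sphere 0 1. norm (f t) \<le> B"
    by (auto simp: bounded_iff)
  then show ?thesis
    by (intro integrable_circle_bounded[of _ B] measurable_circle_continuous assms) blast
qed

text \<open>The rule \<open>cong\<close> frees the values off the circle. Identities such as
  \<open>chi m t * chi n t = chi (m + n) t\<close> and \<open>cnj (chi n t) = chi (- n) t\<close>
  hold on the circle but not in the whole plane (the first fails at 0), so closure under products
  and conjugates relies on it.\<close>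

inductive trig_poly :: "(complex \<Rightarrow> complex) \<Rightarrow> bool" where
  monom: "trig_poly (\<lambda>t. c * chi n t)"
| add: "trig_poly f \<Longrightarrow> trig_poly g \<Longrightarrow> trig_poly (\<lambda>t. f t + g t)"
| cong: "trig_poly f \<Longrightarrow> (\<And>t. t \<in> sphere 0 1 \<Longrightarrow> g t = f t) \<Longrightarrow> trig_poly g"

lemma trig_poly_chi: "trig_poly (chi n)"
  using trig_poly.monom[of 1 n] by simp

lemma trig_poly_const: "trig_poly (\<lambda>t. c)"
  using trig_poly.monom[of c 0] by simp

lemma trig_poly_mult:
  assumes "trig_poly f" "trig_poly g"
  shows "trig_poly (\<lambda>t. f t * g t)"
  using assms
proof (induction f rule: trig_poly.induct)
  case (monom c n)
  from monom.prems show ?case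
  proof (induction g rule: trig_poly.induct)
    case (monom d m)
    show ?case
      by (rule trig_poly.cong[OF trig_poly.monom[of "c * d" "n + m"]])
         (auto simp flip: chi_mult)
  next
    case (add f g)
    then show ?case using trig_poly.add[OF add.IH] by (simp add: algebra_simps)
  next
    case (cong f g)
    then show ?case using trig_poly.cong[OF cong.IH] by simp
  qed
next
  case (add f1 f2)
  then show ?case using trig_poly.add[OF add.IH] by (simp add: algebra_simps)
next
  case (cong f1 f2)
  show ?case by (rule trig_poly.cong[OF cong.IH[OF cong.prems]]) (simp add: cong.hyps)
qed

lemma trig_poly_cmult: "trig_poly f \<Longrightarrow> trig_poly (\<lambda>t. c * f t)"
  by (rule trig_poly_mult[OF trig_poly_const])

lemma trig_poly_diff: "trig_poly f \<Longrightarrow> trig_poly g \<Longrightarrow> trig_poly (\<lambda>t. f t - g t)"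
  using trig_poly.add[of f "\<lambda>t. (-1) * g t"] trig_poly_cmult[of g "-1"] by simp

lemma trig_poly_sum: "(\<And>i. i \<in> I \<Longrightarrow> trig_poly (f i)) \<Longrightarrow> trig_poly (\<lambda>t. \<Sum>i\<in>I. f i t)"
  by (induction I rule: infinite_finite_induct) (auto intro: trig_poly_const trig_poly.add)

lemma trig_poly_continuous: "trig_poly f \<Longrightarrow> continuous_on (sphere 0 1) f"
proof (induction rule: trig_poly.induct)
  case (cong f g)
  show ?case by (rule continuous_on_eq[OF cong.IH]) (simp add: cong.hyps)
qed (intro continuous_intros; simp)+

lemma trig_poly_cnj: "trig_poly f \<Longrightarrow> trig_poly (\<lambda>t. cnj (f t))"
proof (induction rule: trig_poly.induct)
  case (monom c n)
  show ?case by (rule trig_poly.cong[OF trig_poly.monom[of "cnj c" "-n"]]) (simp add: cnj_chi)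
next
  case (cong f g)
  show ?case by (rule trig_poly.cong[OF cong.IH]) (simp add: cong.hyps)
qed (auto intro: trig_poly.add)

text \<open>Stone-Weierstrass for the algebra of real-valued trigonometric polynomials; Re and Im
  separate points. Real approximants matter because the modulus of a polynomial is later majorized
  by a real polynomial.\<close>

lemma trig_poly_approx_real:
  fixes f :: "complex \<Rightarrow> real"
  assumes "continuous_on (sphere 0 1) f" "0 < e"
  obtains g where "trig_poly (\<lambda>t. of_real (g t))" "\<And>t. t \<in> sphere 0 1 \<Longrightarrow> \<bar>f t - g t\<bar> < e"
proof -
  have "\<exists>g. trig_poly (\<lambda>t. of_real (g t)) \<and> (\<forall>t\<in>sphere 0 1. \<bar>f t - g t\<bar> < e)"
  proof (rule Stone_Weierstrass_HOL[where P = "\<lambda>g. trig_poly (\<lambda>t. of_real (g t))"])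
    show "continuous_on (sphere 0 1) f" if "trig_poly (\<lambda>t. of_real (f t))" for f :: "complex \<Rightarrow> real"
      using continuous_on_Re[OF trig_poly_continuous[OF that]] by simp
    have "trig_poly (\<lambda>t. of_real (Re t))" "trig_poly (\<lambda>t. of_real (Im t))"
    proof -
      have id: "trig_poly (\<lambda>t. t)" using trig_poly_chi[of 1] by (simp add: chi_def)
      note cnj = trig_poly_cnj[OF id]
      show "trig_poly (\<lambda>t. of_real (Re t))"
        by (rule trig_poly.cong[OF trig_poly_cmult[OF trig_poly.add[OF id cnj], of "1/2"]])
           (simp add: complex_add_cnj)
      show "trig_poly (\<lambda>t. of_real (Im t))"
        by (rule trig_poly.cong[OF trig_poly_cmult[OF trig_poly_diff[OF id cnj], of "1/(2*\<i>)"]])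
           (simp add: complex_diff_cnj field_simps)
    qed
    then show "\<exists>f. trig_poly (\<lambda>t. of_real (f t)) \<and> f x \<noteq> f y"
      if "x \<in> sphere 0 1 \<and> y \<in> sphere 0 1 \<and> x \<noteq> y" for x y
      proof (cases "Re x = Re y")
      case True
      then have "Im x \<noteq> Im y" using that complex_eqI by blast
      then show ?thesis using \<open>trig_poly (\<lambda>t. of_real (Im t))\<close> by blast
    next
      case False
      then show ?thesis using \<open>trig_poly (\<lambda>t. of_real (Re t))\<close> by blast
    qed
  qed (use assms in \<open>auto intro: trig_poly_const trig_poly_mult trig_poly.add\<close>)
  then show ?thesis using that by blast
qed

text \<open>The functions \<open>h n\<close> are 1 on C and vanish at t as soon as n times the
  distance from t to C reaches 1; closedness makes this distance positive off C. Approximating them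
  within 1 / (n + 1) explains the bound 2. The empty set is separate because \<open>infdist\<close>
  to it is 0 by convention, which would make every \<open>h n\<close> equal to 1.\<close>

lemma trig_poly_approx_indicator:
  assumes "closed C"
  obtains q where "\<And>n. trig_poly (q n)" "\<And>n t. t \<in> sphere 0 1 \<Longrightarrow> cmod (q n t) \<le> 2"
    "\<And>t. t \<in> sphere 0 1 \<Longrightarrow> (\<lambda>n. q n t) \<longlonglongrightarrow> indicator C t"
proof (cases "C = {}")
  case True
  show ?thesis by (rule that[of "\<lambda>n t. 0"]) (auto simp: True trig_poly_const)
next
  case False
  define h where "h n t = max 0 (1 - real n * infdist t C)" for n t
  have "\<exists>g. trig_poly (\<lambda>t. of_real (g t)) \<and> (\<forall>t\<in>sphere 0 1. \<bar>h n t - g t\<bar> < 1 / Suc n)" for n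
  proof -
    have "continuous_on (sphere 0 1) (h n)" unfolding h_def by (intro continuous_intros)
    then show ?thesis
      by (rule trig_poly_approx_real[of _"1 / Suc n"]) auto

  qed
  then obtain g where g: "\<And>n. trig_poly (\<lambda>t. of_real (g n t))"
    "\<And>n t. t \<in> sphere 0 1 \<Longrightarrow> \<bar>h n t - g n t\<bar> < 1 / Suc n"
    by metis
  have h: "0 \<le> h n t" "h n t \<le> 1" for n t
    using infdist_nonneg[of t C] by (auto simp: h_def)
  have lim: "(\<lambda>n. h n t) \<longlonglongrightarrow> indicator C t" for t
  proof (cases "t \<in> C")
    case True
    then show ?thesis by (simp add: h_def)
  next
    case F: False
    then have pos: "infdist t C > 0"
      using assms False by (simp add: infdist_pos_not_in_closed)
    obtain N where N: "1 < real N * infdist t C" using ex_less_of_nat_mult[OF pos] by blast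
    have "h n t = 0" if "n \<ge> N" for n
    proof -
      have "real N * infdist t C \<le> real n * infdist t C" using that pos by (intro mult_right_mono) auto
      then show ?thesis using N by (simp add: h_def)
    qed
    then have "eventually (\<lambda>n. h n t = 0) sequentially" by (auto simp: eventually_sequentially)
    then show ?thesis using F by (simp add: tendsto_eventually)
  qed
  show ?thesis
  proof (rule that[of "\<lambda>n t. of_real (g n t)"])
    show "trig_poly (\<lambda>t. of_real (g n t))" for n by (rule g)
    show "cmod (of_real (g n t)) \<le> 2" if "t \<in> sphere 0 1" for n t
    proof -
      have "1 / real (Suc n) \<le> 1" by simp
      then show ?thesis using g(2)[OF that, of n] h[of n t] unfolding norm_of_real by linarith
    qed
    show "(\<lambda>n. complex_of_real (g n t)) \<longlonglongrightarrow> indicator C t" if "t \<in> sphere 0 1" for t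
    proof -
      have "(\<lambda>n. g n t - h n t) \<longlonglongrightarrow> 0"
      proof (rule Lim_null_comparison)
        show "\<forall>\<^sub>F n in sequentially. norm (g n t - h n t) \<le> 1 / Suc n"
          using g(2)[OF that] by (intro always_eventually allI) (simp add: abs_minus_commute less_imp_le del: of_nat_Suc)
        show "(\<lambda>n. 1 / real (Suc n)) \<longlonglongrightarrow> 0" by (rule lim_1_over_real_power[of 1, simplified, THEN LIMSEQ_Suc] | (rule LIMSEQ_Suc, rule lim_const_over_n))
      qed
      from tendsto_add[OF this lim[of t]] have "(\<lambda>n. g n t) \<longlonglongrightarrow> indicator C t" by simp
      then have "(\<lambda>n. complex_of_real (g n t)) \<longlonglongrightarrow> of_real (indicator C t)" by (rule tendsto_of_real)
      then show ?thesis by (cases "t \<in> C") auto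
    qed
  qed
qed

section \<open>Fourier coefficients\<close>

lemma sets_circle_borel_eq:
  "sets circle_borel = sigma_sets (sphere 0 1) ((\<inter>) (sphere 0 1) ` Collect closed)"
  by (simp add: sets_restrict_space borel_eq_closed sigma_sets_Int)

lemma Int_stable_closed_circle: "Int_stable ((\<inter>) (sphere 0 1) ` Collect closed :: complex set set)"
proof (rule Int_stableI_image)
  fix A B :: "complex set" assume "A \<in> Collect closed" "B \<in> Collect closed"
  then show "\<exists>C\<in>Collect closed. sphere 0 1 \<inter> A \<inter> (sphere 0 1 \<inter> B) = sphere 0 1 \<inter> C"
    by (intro bexI[of _ "A \<inter> B"]) auto
qed

lemma closed_circle_Pow: "(\<inter>) (sphere 0 1) ` Collect closed \<subseteq> Pow (sphere 0 1 :: complex set)"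
  by auto

lemma integral_indicator_complex:
  assumes "X \<in> sets M"
  shows "(\<integral>x. indicator X x \<partial>M) = (of_real (measure M X) :: complex)"
proof -
  have "(\<integral>x. indicator X x \<partial>M) = (\<integral>x. complex_of_real (indicator X x) \<partial>M)"
    by (intro Bochner_Integration.integral_cong) (auto split: split_indicator)
  also have "\<dots> = of_real (measure M (X \<inter> space M))" by simp
  finally show ?thesis using sets.sets_into_space[OF assms] by (simp add: Int_absorb2)
qed

text \<open>Dynkin's theorem for the intersection-stable system of closed subsets covers the Borel
  sets. The case \<open>cong\<close> then passes to the completion, where every set agrees with a
  Borel set off a null set.\<close>

lemma sets_circle_induct [consumes 1, case_names closed compl union cong]:
  assumes "E \<in> sets circle"
    and closed: "\<And>C. closed C \<Longrightarrow> C \<subseteq> sphere 0 1 \<Longrightarrow> P C"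
    and compl: "\<And>E. E \<in> sets circle \<Longrightarrow> P E \<Longrightarrow> P (sphere 0 1 - E)"
    and union: "\<And>A :: nat \<Rightarrow> complex set. disjoint_family A \<Longrightarrow> (\<And>i. A i \<in> sets circle) \<Longrightarrow> (\<And>i. P (A i)) \<Longrightarrow> P (\<Union>i. A i)"
    and cong: "\<And>E F. E \<in> sets circle \<Longrightarrow> F \<in> sets circle \<Longrightarrow> P E \<Longrightarrow> (AE t in circle. t \<in> E \<longleftrightarrow> t \<in> F) \<Longrightarrow> P F"
  shows "P E"
proof -
  have *: "P E" if "E \<in> sets circle_borel" for E
    using that[unfolded sets_circle_borel_eq]
  proof (induction rule: sigma_sets_induct_disjoint[OF Int_stable_closed_circle closed_circle_Pow, consumes 1,
      case_names basic empty compl union])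
    case (basic A)
    then show ?case by (auto intro!: closed)
  next
    case empty
    show ?case by (rule closed) auto
  next
    case (compl A)
    then show ?case using assms(3)[of A] sets_completionI_sets[of A circle_borel]
      unfolding circle_eq sets_circle_borel_eq by blast
  next
    case (union A)
    then show ?case using assms(4)[of A] sets_completionI_sets[of _ circle_borel]
      unfolding circle_eq sets_circle_borel_eq by blast
  qed
  from assms(1) obtain S N N' where SN: "E = S \<union> N" "N \<subseteq> N'" "N' \<in> null_sets circle_borel" "S \<in> sets circle_borel"
    unfolding circle_eq by (rule sets_completionE)
  show ?thesis
  proof (rule cong[OF _ assms(1) *[OF SN(4)]])
    show "S \<in> sets circle" using SN(4) unfolding circle_eq by blast
    have "AE t in circle. t \<notin> N'"
      unfolding circle_eq by (intro AE_not_in null_sets_completionI SN)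
    then show "AE t in circle. (t \<in> S) = (t \<in> E)"
      by eventually_elim (use SN in auto)
  qed
qed

lemma integrable_mult_bounded:
  fixes f g :: "complex \<Rightarrow> complex"
  assumes "integrable circle f" "g \<in> borel_measurable circle" "\<And>t. t \<in> sphere 0 1 \<Longrightarrow> cmod (g t) \<le> B"
  shows "integrable circle (\<lambda>t. f t * g t)"
proof (rule Bochner_Integration.integrable_bound[where f = "\<lambda>t. B * norm (f t)"])
  show "AE t in circle. norm (f t * g t) \<le> norm (B * norm (f t))"
  proof (rule AE_I2)
    fix t assume "t \<in> space circle"
    then have "cmod (g t) \<le> B" using assms(3) by simp
    then have "norm (f t) * cmod (g t) \<le> norm (f t) * \<bar>B\<bar>" by (intro mult_left_mono) auto
    then show "norm (f t * g t) \<le> norm (B * norm (f t))" by (simp add: norm_mult mult_ac abs_mult)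
  qed
qed (use assms in \<open>auto intro!: borel_measurable_times\<close>)

lemma measurable_chi [measurable]: "chi n \<in> borel_measurable circle"
  by (intro measurable_circle_continuous continuous_intros)

lemma integrable_mult_chi [simp]:
  "integrable circle f \<Longrightarrow> integrable circle (\<lambda>t. f t * chi n t)"
  by (rule integrable_mult_bounded[of _ _ 1]) auto

lemma integrable_chi_mult [simp]:
  "integrable circle f \<Longrightarrow> integrable circle (\<lambda>t. chi n t * f t)"
  using integrable_mult_chi[of f n] by (simp add: mult.commute)

section \<open>Rules for Fourier coefficients and their uniqueness\<close>

lemma fourier_coeff_eq: "fourier_coeff f n = (\<integral>t. f t * chi (- n) t \<partial>circle)"
  by (simp add: fourier_coeff_def chi_def)

lemma fourier_coeff_add:
  "integrable circle f \<Longrightarrow> integrable circle g \<Longrightarrow>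
     fourier_coeff (\<lambda>t. f t + g t) n = fourier_coeff f n + fourier_coeff g n"
  by (simp add: fourier_coeff_eq distrib_right)

lemma fourier_coeff_diff:
  "integrable circle f \<Longrightarrow> integrable circle g \<Longrightarrow>
     fourier_coeff (\<lambda>t. f t - g t) n = fourier_coeff f n - fourier_coeff g n"
  by (simp add: fourier_coeff_eq left_diff_distrib)

lemma fourier_coeff_cmult: "fourier_coeff (\<lambda>t. c * f t) n = c * fourier_coeff f n"
  by (simp add: fourier_coeff_eq mult.assoc)

lemma fourier_coeff_zero: "fourier_coeff (\<lambda>t. 0) n = 0"
  by (simp add: fourier_coeff_eq)

lemma fourier_coeff_sum:
  "(\<And>i. i \<in> I \<Longrightarrow> integrable circle (f i)) \<Longrightarrow>
     fourier_coeff (\<lambda>t. \<Sum>i\<in>I. f i t) n = (\<Sum>i\<in>I. fourier_coeff (f i) n)"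
  by (simp add: fourier_coeff_eq sum_distrib_right)

lemma fourier_coeff_cong_AE:
  assumes "AE t in circle. f t = g t" "f \<in> borel_measurable circle" "g \<in> borel_measurable circle"
  shows "fourier_coeff f n = fourier_coeff g n"
  unfolding fourier_coeff_eq using assms by (intro integral_cong_AE) auto

lemma fourier_coeff_cong:
  "(\<And>t. t \<in> sphere 0 1 \<Longrightarrow> f t = g t) \<Longrightarrow> fourier_coeff f n = fourier_coeff g n"
  unfolding fourier_coeff_eq by (intro Bochner_Integration.integral_cong) auto

lemma fourier_coeff_shift: "fourier_coeff (\<lambda>t. chi m t * f t) n = fourier_coeff f (n - m)"
  unfolding fourier_coeff_eq
proof (intro Bochner_Integration.integral_cong refl)
  fix t assume "t \<in> space circle"
  then have "chi m t * chi (-n) t = chi (- (n - m)) t" by (simp add: chi_mult)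
  then show "chi m t * f t * chi (- n) t = f t * chi (- (n - m)) t"
    by (metis mult.assoc mult.commute)
qed

lemma fourier_coeff_chi: "fourier_coeff (chi m) n = of_bool (n = m)"
proof -
  have "fourier_coeff (chi m) n = (\<integral>t. chi (m - n) t \<partial>circle)"
    unfolding fourier_coeff_eq
    by (intro Bochner_Integration.integral_cong) (simp_all add: chi_mult)
  then show ?thesis by (auto simp: integral_chi)
qed

lemma norm_fourier_coeff_le:
  assumes "integrable circle f"
  shows "cmod (fourier_coeff f n) \<le> (\<integral>t. cmod (f t) \<partial>circle)"
proof -
  have "cmod (fourier_coeff f n) \<le> (\<integral>t. cmod (f t * chi (-n) t) \<partial>circle)"
    unfolding fourier_coeff_eq by (rule integral_norm_bound)
  also have "\<dots> = (\<integral>t. cmod (f t) \<partial>circle)"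
    by (intro Bochner_Integration.integral_cong) (auto simp: norm_mult)
  finally show ?thesis .
qed

lemma integrable_chi [simp]: "integrable circle (chi n)"
  by (intro integrable_circle_continuous continuous_intros)

lemma integrable_trig_poly: "trig_poly f \<Longrightarrow> integrable circle f"
  by (intro integrable_circle_continuous trig_poly_continuous)

lemma measurable_trig_poly: "trig_poly f \<Longrightarrow> f \<in> borel_measurable circle"
  by (intro measurable_circle_continuous trig_poly_continuous)

text \<open>Some finite expansion is obtained by induction; orthogonality of the characters
  afterwards identifies its coefficients with the Fourier coefficients.\<close>

lemma trig_poly_expand:
  assumes "trig_poly f"
  obtains N :: nat where
    "\<And>t. t \<in> sphere 0 1 \<Longrightarrow> f t = (\<Sum>k\<in>{-int N..int N}. fourier_coeff f k * chi k t)"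
    "\<And>k. \<bar>k\<bar> > int N \<Longrightarrow> fourier_coeff f k = 0"
proof -
  have "\<exists>N c. (\<forall>t\<in>sphere 0 1. f t = (\<Sum>k\<in>{-int N..int N}. c k * chi k t)) \<and> (\<forall>k. \<bar>k\<bar> > int N \<longrightarrow> c k = 0)"
    using assms
  proof induction
    case (monom c n)
    have "(\<Sum>k\<in>{-\<bar>n\<bar>..\<bar>n\<bar>}. (if k = n then c else 0) * chi k t) = c * chi n t" for t
    proof -
      have "(\<Sum>k\<in>{-\<bar>n\<bar>..\<bar>n\<bar>}. (if k = n then c else 0) * chi k t) = (\<Sum>k\<in>{-\<bar>n\<bar>..\<bar>n\<bar>}. if k = n then c * chi n t else 0)"
        by (intro sum.cong) auto
      also have "\<dots> = c * chi n t" by (subst sum.delta) auto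
      finally show ?thesis .
    qed
    then show ?case
      by (intro exI[of _ "nat \<bar>n\<bar>"] exI[of _ "\<lambda>k. if k = n then c else 0"]) simp
  next
    case (add f g)
    from add.IH obtain N M c d where
      f: "\<And>t. t\<in>sphere 0 1 \<Longrightarrow> f t = (\<Sum>k\<in>{-int N..int N}. c k * chi k t)" "\<And>k. \<bar>k\<bar> > int N \<Longrightarrow> c k = 0" and
      g: "\<And>t. t\<in>sphere 0 1 \<Longrightarrow> g t = (\<Sum>k\<in>{-int M..int M}. d k * chi k t)" "\<And>k. \<bar>k\<bar> > int M \<Longrightarrow> d k = 0"
      by blast
    define K where "K = max N M"
    have "f t = (\<Sum>k\<in>{-int K..int K}. c k * chi k t)" if "t \<in> sphere 0 1" for t
      unfolding f(1)[OF that] using f(2) by (intro sum.mono_neutral_left) (auto simp: K_def)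
    moreover have "g t = (\<Sum>k\<in>{-int K..int K}. d k * chi k t)" if "t \<in> sphere 0 1" for t
      unfolding g(1)[OF that] using g(2) by (intro sum.mono_neutral_left) (auto simp: K_def)
    ultimately have "\<forall>t\<in>sphere 0 1. f t + g t = (\<Sum>k\<in>{-int K..int K}. (c k + d k) * chi k t)"
      by (simp add: sum.distrib distrib_right)
    moreover have "\<forall>k. \<bar>k\<bar> > int K \<longrightarrow> c k + d k = 0"
      using f(2) g(2) by (auto simp: K_def)
    ultimately show ?case by (intro exI[of _ K] exI[of _ "\<lambda>k. c k + d k"] conjI)
  next
    case (cong f g)
    then obtain N c where "\<And>t. t\<in>sphere 0 1 \<Longrightarrow> f t = (\<Sum>k\<in>{-int N..int N}. c k * chi k t)" "\<And>k. \<bar>k\<bar> > int N \<Longrightarrow> c k = 0"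
      by blast
    with cong.hyps show ?case by (intro exI[of _ N] exI[of _ c]) simp
  qed
  then obtain N c where c: "\<And>t. t\<in>sphere 0 1 \<Longrightarrow> f t = (\<Sum>k\<in>{-int N..int N}. c k * chi k t)"
    "\<And>k. \<bar>k\<bar> > int N \<Longrightarrow> c k = 0" by blast
  have "fourier_coeff f n = c n" for n
  proof -
    have "fourier_coeff f n = fourier_coeff (\<lambda>t. \<Sum>k\<in>{-int N..int N}. c k * chi k t) n"
      by (rule fourier_coeff_cong[OF c(1)])
    also have "\<dots> = (\<Sum>k\<in>{-int N..int N}. if k = n then c k else 0)"
      by (subst fourier_coeff_sum) (auto simp: fourier_coeff_cmult fourier_coeff_chi intro!: sum.cong)
    also have "\<dots> = c n" using c(2)[of n] by (auto simp: abs_le_iff)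
    finally show ?thesis .
  qed
  with c that show ?thesis by simp
qed

lemma integral_mult_trig_poly_eq_0:
  assumes "integrable circle f" "trig_poly q" "\<And>n. fourier_coeff f n = 0"
  shows "(\<integral>t. f t * q t \<partial>circle) = 0"
proof -
  have "integrable circle (\<lambda>t. f t * q t) \<and> (\<integral>t. f t * q t \<partial>circle) = 0"
    using assms(2)
  proof induction
    case (monom c n)
    have "(\<integral>t. f t * (c * chi n t) \<partial>circle) = c * fourier_coeff f (-n)"
      by (simp add: fourier_coeff_eq mult.left_commute)
    moreover have "integrable circle (\<lambda>t. c * (f t * chi n t))" using assms(1) by simp
    ultimately show ?case by (simp add: assms(3) mult.left_commute)
  next
    case (add p q)
    then show ?case by (simp add: distrib_left)
  next
    case (cong p q)
    then have "(\<integral>t. f t * p t \<partial>circle) = (\<integral>t. f t * q t \<partial>circle)"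
      "integrable circle (\<lambda>t. f t * p t) = integrable circle (\<lambda>t. f t * q t)"
      by (intro Bochner_Integration.integral_cong Bochner_Integration.integrable_cong; simp)+
    with cong.IH show ?case by simp
  qed
  then show ?thesis by simp
qed

text \<open>Vanishing coefficients make f orthogonal to trigonometric polynomials, then to
  indicators of closed sets by dominated convergence, then to all indicators by
  \<open>sets_circle_induct\<close>; a function with zero integral over every measurable set
  vanishes almost everywhere.\<close>

lemma fourier_unique_zero:
  assumes f: "integrable circle f" and "\<And>n. fourier_coeff f n = 0"
  shows "AE t in circle. f t = 0"
proof (rule circle.density_zero[OF f])
  fix E assume "E \<in> sets circle"
  then have "(\<integral>t. f t * indicator E t \<partial>circle) = 0"
  proof (induction rule: sets_circle_induct)
    case (closed C)
    from trig_poly_approx_indicator[OF closed(1)] obtain q where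
      q: "\<And>n. trig_poly (q n)" "\<And>n t. t \<in> sphere 0 1 \<Longrightarrow> cmod (q n t) \<le> 2"
         "\<And>t. t \<in> sphere 0 1 \<Longrightarrow> (\<lambda>n. q n t) \<longlonglongrightarrow> indicator C t" by blast
    have "(\<lambda>n. \<integral>t. f t * q n t \<partial>circle) \<longlonglongrightarrow> (\<integral>t. f t * indicator C t \<partial>circle)"
    proof (rule integral_dominated_convergence[where w = "\<lambda>t. 2 * norm (f t)"])
      show "AE t in circle. norm (f t * q n t) \<le> 2 * norm (f t)" for n
        using q(2) by (intro AE_I2) (auto simp: norm_mult mult.commute[of 2] intro!: mult_left_mono)
      show "AE t in circle. (\<lambda>n. f t * q n t) \<longlonglongrightarrow> f t * indicator C t"
        using q(3) by (intro AE_I2 tendsto_mult tendsto_const) auto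
      show "(\<lambda>t. f t * indicator C t) \<in> borel_measurable circle"
        using f closed(1) by (intro borel_measurable_times measurable_circle[of "indicator C"]) auto
      show "(\<lambda>t. f t * q n t) \<in> borel_measurable circle" for n
        using borel_measurable_integrable[OF f] measurable_trig_poly[OF q(1)] by (rule borel_measurable_times)
    qed (use f in auto)
    moreover have "(\<integral>t. f t * q n t \<partial>circle) = 0" for n
      by (rule integral_mult_trig_poly_eq_0[OF f q(1) assms(2)])
    ultimately show ?case by (simp add: LIMSEQ_const_iff)
  next
    case (compl E)
    have "(\<integral>t. f t * indicator (sphere 0 1 - E) t \<partial>circle) = (\<integral>t. f t - f t * indicator E t \<partial>circle)"
      by (intro Bochner_Integration.integral_cong) (auto split: split_indicator)
    also have "\<dots> = (\<integral>t. f t \<partial>circle) - (\<integral>t. f t * indicator E t \<partial>circle)"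
      using f compl by (intro Bochner_Integration.integral_diff integrable_mult_bounded[of _ _ 1]) (auto split: split_indicator)
    also have "(\<integral>t. f t \<partial>circle) = fourier_coeff f 0" by (simp add: fourier_coeff_eq)
    finally show ?case using compl assms(2) by simp
  next
    case (union A)
    have "(\<lambda>n. \<integral>t. f t * indicator (\<Union>i<n. A i) t \<partial>circle) \<longlonglongrightarrow> (\<integral>t. f t * indicator (\<Union>i. A i) t \<partial>circle)"
    proof (rule integral_dominated_convergence[where w = "\<lambda>t. norm (f t)"])
      show "AE t in circle. (\<lambda>n. f t * indicator (\<Union>i<n. A i) t) \<longlonglongrightarrow> f t * indicator (\<Union>i. A i) t"
        by (intro AE_I2 tendsto_mult tendsto_const LIMSEQ_indicator_UN)
    qed (use f union in \<open>auto intro!: borel_measurable_times simp: norm_mult split: split_indicator\<close>)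
    moreover have "(\<integral>t. f t * indicator (\<Union>i<n. A i) t \<partial>circle) = 0" for n :: nat
    proof -
      have "(\<integral>t. f t * indicator (\<Union>i<n. A i) t \<partial>circle) = (\<integral>t. (\<Sum>i<n. f t * indicator (A i) t) \<partial>circle)"
        using union(1)
        by (intro Bochner_Integration.integral_cong)
           (auto simp: indicator_UN_disjoint[OF _ disjoint_family_on_mono[of _ UNIV]] sum_distrib_left)
      also have "\<dots> = (\<Sum>i<n. \<integral>t. f t * indicator (A i) t \<partial>circle)"
        using f union by (intro Bochner_Integration.integral_sum integrable_mult_bounded[of _ _ 1]) (auto split: split_indicator)
      finally show ?thesis using union by simp
    qed
    ultimately show ?case by (simp add: LIMSEQ_const_iff)
  next
    case (cong E F)
    have "(\<integral>t. f t * indicator E t \<partial>circle) = (\<integral>t. f t * indicator F t \<partial>circle)"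
      using f cong(1,2,3)
    proof (intro integral_cong_AE)
      show "AE t in circle. f t * indicator E t = f t * indicator F t"
        using cong(3) by eventually_elim (simp add: indicator_def)
    qed (auto intro!: borel_measurable_times)
    then show ?case using cong by simp
  qed
  moreover have "indicat_real E t *\<^sub>R f t = f t * indicator E t" for t
    by (auto split: split_indicator)
  ultimately show "set_lebesgue_integral circle E f = 0"
    by (simp add: set_lebesgue_integral_def)
qed

lemma fourier_unique:
  assumes "integrable circle f" "integrable circle g" "\<And>n. fourier_coeff f n = fourier_coeff g n"
  shows "AE t in circle. f t = g t"
proof -
  have "AE t in circle. f t - g t = 0"
    using assms by (intro fourier_unique_zero) (auto simp: fourier_coeff_diff)
  then show ?thesis by simp
qed

section \<open>Reflection of the circle in the line through 0 and t\<close>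

lemma measurable_reflect:
  assumes "t \<in> sphere 0 1"
  shows "(\<lambda>s. t\<^sup>2 * cnj s) \<in> measurable circle_borel circle_borel"
  using assms
  unfolding measurable_cong_sets[OF sets_circle_borel sets_circle_borel]
  by (intro measurable_restrict_space2 borel_measurable_continuous_on_restrict continuous_intros)
     (auto simp: norm_mult norm_power space_restrict_space)

lemma chi_reflect:
  "t \<in> sphere 0 1 \<Longrightarrow> s \<in> sphere 0 1 \<Longrightarrow> chi n (t\<^sup>2 * cnj s) = chi (2 * n) t * chi (- n) s"
proof -
  assume ts: "t \<in> sphere 0 1" "s \<in> sphere 0 1"
  have "chi n (t\<^sup>2 * cnj s) = (t powi 2) powi n * cnj (chi n s)"
    by (simp add: chi_def power_int_mult_distrib)
  also have "\<dots> = chi (2 * n) t * chi (- n) s"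
    unfolding cnj_chi[OF ts(2)] by (simp only: chi_def power_int_mult)
  finally show ?thesis .
qed

text \<open>The reflection turns \<open>chi n\<close> into a multiple of \<open>chi (- n)\<close>,
  with factor 1 for n = 0, so the constant term and hence the integral is unchanged. The first
  conjunct of the induction secures integrability in the case of sums.\<close>

lemma integral_trig_poly_reflect:
  assumes "t \<in> sphere 0 1" "trig_poly q"
  shows "(\<integral>s. q (t\<^sup>2 * cnj s) \<partial>circle) = (\<integral>s. q s \<partial>circle)"
proof -
  have r: "t\<^sup>2 * cnj s \<in> sphere 0 1" if "s \<in> sphere 0 1" for s
    using that assms(1) by (simp add: norm_mult norm_power)
  have "trig_poly (\<lambda>s. q (t\<^sup>2 * cnj s)) \<and> ?thesis"
    using assms(2)
  proof induction
    case (monom c n)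
    have tp: "trig_poly (\<lambda>s. c * chi n (t\<^sup>2 * cnj s))"
      by (rule trig_poly.cong[OF trig_poly.monom[of "c * chi (2*n) t" "-n"]]) (simp add: chi_reflect[OF assms(1)])
    have "(\<integral>s. c * chi n (t\<^sup>2 * cnj s) \<partial>circle) = (\<integral>s. c * chi (2*n) t * chi (-n) s \<partial>circle)"
      by (intro Bochner_Integration.integral_cong) (simp_all add: chi_reflect[OF assms(1)])
    also have "\<dots> = c * of_bool (n = 0)" by (auto simp: integral_chi)
    finally show ?case using tp by (simp add: integral_chi)
  next
    case (add f g)
    then show ?case by (auto simp: integrable_trig_poly intro: trig_poly.add)
  next
    case (cong f g)
    have "(\<integral>s. g s \<partial>circle) = (\<integral>s. f s \<partial>circle)" "(\<integral>s. g (t\<^sup>2 * cnj s) \<partial>circle) = (\<integral>s. f (t\<^sup>2 * cnj s) \<partial>circle)"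
      by (intro Bochner_Integration.integral_cong; use cong r in simp)+
    then show ?case using cong r by (auto intro: trig_poly.cong[of "\<lambda>s. f (t\<^sup>2 * cnj s)"])
  qed
  then show ?thesis by simp
qed

text \<open>Two probability measures that integrate trigonometric polynomials alike agree on closed
  sets, by approximation of indicators, and therefore on all Borel sets. Working with moments spares
  the wrap-around of the angle modulo 2 pi.\<close>

lemma distr_reflect:
  assumes t: "t \<in> sphere 0 1"
  shows "distr circle_borel circle_borel (\<lambda>s. t\<^sup>2 * cnj s) = circle_borel" (is "?D = _")
proof -
  note [measurable] = measurable_reflect[OF t]
  let ?G = "(\<inter>) (sphere 0 1) ` Collect closed :: complex set set"
  have r: "t\<^sup>2 * cnj s \<in> sphere 0 1" if "s \<in> sphere 0 1" for s
    using that t by (simp add: norm_mult norm_power)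
  interpret D: prob_space ?D by (rule circle_borel.prob_space_distr) simp
  show ?thesis
  proof (rule measure_eqI_generator_eq[where E = ?G and \<Omega> = "sphere 0 1" and A = "\<lambda>_. sphere 0 1"])
    show "Int_stable ?G" by (rule Int_stable_closed_circle)
    show "sets ?D = sigma_sets (sphere 0 1) ?G" "sets circle_borel = sigma_sets (sphere 0 1) ?G"
      using sets_circle_borel_eq by simp_all
    show "range (\<lambda>_::nat. sphere 0 1) \<subseteq> ?G"
      by (auto intro!: image_eqI[of _ _ UNIV])
    fix X assume "X \<in> ?G"
    then have X: "closed X" "X \<subseteq> sphere 0 1" by auto
    have Xm: "X \<in> sets circle_borel" using \<open>X \<in> ?G\<close> unfolding sets_circle_borel_eq by blast
    from trig_poly_approx_indicator[OF X(1)] obtain q where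
      q: "\<And>n. trig_poly (q n)" "\<And>n t. t \<in> sphere 0 1 \<Longrightarrow> cmod (q n t) \<le> 2"
         "\<And>t. t \<in> sphere 0 1 \<Longrightarrow> (\<lambda>n. q n t) \<longlonglongrightarrow> indicator X t" by blast
    have 1: "(\<lambda>n. \<integral>s. q n s \<partial>circle) \<longlonglongrightarrow> (\<integral>s. indicator X s \<partial>circle)"
      by (rule integral_dominated_convergence[where w = "\<lambda>_. 2"])
         (use q X in \<open>auto intro: measurable_trig_poly indicator_measurable_circle\<close>)
    have rm: "(\<lambda>s. t\<^sup>2 * cnj s) \<in> measurable circle borel"
      by (intro measurable_circle_continuous continuous_intros)
    have "(\<lambda>n. \<integral>s. q n (t\<^sup>2 * cnj s) \<partial>circle) \<longlonglongrightarrow> (\<integral>s. indicator X (t\<^sup>2 * cnj s) \<partial>circle)"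
    proof (rule integral_dominated_convergence[where w = "\<lambda>_. 2"])
      show "(\<lambda>s. q n (t\<^sup>2 * cnj s)) \<in> borel_measurable circle" for n
        by (intro measurable_circle_continuous continuous_on_compose2[OF trig_poly_continuous[OF q(1)]] continuous_intros)
           (use r in auto)
      show "(\<lambda>s. indicator X (t\<^sup>2 * cnj s) :: complex) \<in> borel_measurable circle"
        by (rule measurable_compose[OF rm]) (use X in auto)
    qed (use q r in auto)
    then have "(\<integral>s. indicator X (t\<^sup>2 * cnj s) \<partial>circle) = (\<integral>s. indicator X s \<partial>circle :: complex)"
      using 1 LIMSEQ_unique unfolding integral_trig_poly_reflect[OF t q(1)] by blast
    moreover have "(\<integral>s. indicator X (t\<^sup>2 * cnj s) \<partial>circle) = (of_real (measure ?D X) :: complex)"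
    proof -
      have "(\<integral>s. indicator X (t\<^sup>2 * cnj s) \<partial>circle) = (\<integral>s. indicator X (t\<^sup>2 * cnj s) \<partial>circle_borel :: complex)"
        by (rule integral_circle_borel, rule measurable_compose[OF measurable_reflect[OF t]]) (use Xm in auto)
      also have "\<dots> = (\<integral>s. indicator X s \<partial>?D)"
        by (subst integral_distr) (use Xm in auto)
      also have "\<dots> = of_real (measure ?D X)"
        using Xm by (intro integral_indicator_complex) simp
      finally show ?thesis .
    qed
    moreover have "(\<integral>s. indicator X s \<partial>circle) = (of_real (measure circle_borel X) :: complex)"
    proof -
      have "(\<integral>s. indicator X s \<partial>circle) = (\<integral>s. indicator X s \<partial>circle_borel :: complex)"
        by (rule integral_circle_borel) (use Xm in auto)
      also have "\<dots> = of_real (measure circle_borel X)"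
        using Xm by (rule integral_indicator_complex)
      finally show ?thesis .
    qed
    ultimately show "emeasure ?D X = emeasure circle_borel X"
      by (simp add: D.emeasure_eq_measure circle_borel.emeasure_eq_measure)
  qed (auto simp: D.emeasure_eq_measure)
qed

lemma integral_circle_reflect:
  fixes f :: "complex \<Rightarrow> complex"
  assumes "t \<in> sphere 0 1" and f: "f \<in> borel_measurable borel"
  shows "(\<integral>s. f (t\<^sup>2 * cnj s) \<partial>circle) = (\<integral>s. f s \<partial>circle)"
proof -
  have fb: "f \<in> borel_measurable circle_borel"
    using f by (simp add: measurable_restrict_space1 cong: measurable_cong_sets)
  note r = measurable_reflect[OF assms(1)]
  have "(\<integral>s. f (t\<^sup>2 * cnj s) \<partial>circle) = (\<integral>s. f (t\<^sup>2 * cnj s) \<partial>circle_borel)"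
    by (rule integral_circle_borel[OF measurable_compose[OF r fb]])
  also have "\<dots> = (\<integral>s. f s \<partial>distr circle_borel circle_borel (\<lambda>s. t\<^sup>2 * cnj s))"
    by (rule integral_distr[OF r fb, symmetric])
  finally show ?thesis unfolding distr_reflect[OF assms(1)] integral_circle_borel[OF fb] .
qed

section \<open>The Riesz projection of the characters\<close>

text \<open>The preimage of t under \<open>cis\<close> is contained in a translate of 2 pi times the
  integers, which is countable.\<close>

lemma null_singleton_circle:
  assumes "t \<in> sphere 0 1"
  shows "AE s in circle. s \<noteq> t"
proof -
  have sub: "{x. cis x = t} \<subseteq> range (\<lambda>k::int. Arg t + 2 * pi * of_int k)"
  proof
    fix x assume "x \<in> {x. cis x = t}"
    moreover have "cis (Arg t) = t" using assms cis_Arg[of t] by (cases "t = 0") (auto simp: sgn_eq)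
    ultimately have "cis x = cis (Arg t)" by simp
    then obtain k :: int where "\<i> * of_real x = \<i> * of_real (Arg t) + of_real (real_of_int (2 * k) * pi) * \<i>"
      unfolding cis_conv_exp exp_eq by blast
    then have "\<i> * of_real x = \<i> * complex_of_real (Arg t + 2 * pi * of_int k)"
      by (simp add: algebra_simps)
    then have "x = Arg t + 2 * pi * of_int k"
      by (metis complex_i_not_zero mult_cancel_left of_real_eq_iff)
    then show "x \<in> range (\<lambda>k::int. Arg t + 2 * pi * of_int k)" by blast
  qed
  have "countable {x. cis x = t}"
    by (rule countable_subset[OF sub]) auto
  then have "{x. cis x = t} \<in> null_sets lborel"
    by (rule countable_imp_null_set_lborel)
  then have "AE x in lborel. x \<notin> {x. cis x = t}" by (rule AE_not_in)
  then have "AE x in lborel. cis x \<noteq> t" by simp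
  then have "AE x in uniform_measure lborel {0..2*pi}. cis x \<noteq> t"
    by (intro AE_uniform_measureI) auto
  then have "AE s in circle_borel. s \<noteq> t"
  proof -
    assume *: "AE x in uniform_measure lborel {0..2*pi}. cis x \<noteq> t"
    have "{s \<in> space (restrict_space borel (sphere 0 1)). s \<noteq> t} = sphere 0 1 \<inter> - {t}"
      by (auto simp: space_restrict_space)
    moreover have "sphere 0 1 \<inter> - {t} \<in> sets (restrict_space borel (sphere 0 1))"
      by (simp add: sets_restrict_space)
    ultimately show ?thesis
      unfolding circle_borel_def
      using * measurable_cis_circle by (subst AE_distr_iff) (auto cong: measurable_cong_sets)
  qed
  then show ?thesis unfolding circle_eq by (rule AE_completion)
qed

text \<open>Dominated convergence: the removed arc shrinks to a single point, a null set.\<close>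

lemma truncated_integral_chi_tendsto:
  assumes t: "t \<in> sphere 0 1"
  shows "((\<lambda>\<epsilon>. \<integral>s. indicator {s. \<epsilon> < cmod (s - t)} s * chi n s \<partial>circle) \<longlongrightarrow> of_bool (n = 0)) (at_right 0)"
proof (rule tendsto_at_right_sequentially[where b = 1])
  fix e :: "nat \<Rightarrow> real" assume e: "\<And>n. 0 < e n" "e \<longlonglongrightarrow> 0"
  have "(\<lambda>k. \<integral>s. indicator {s. e k < cmod (s - t)} s * chi n s \<partial>circle) \<longlonglongrightarrow> (\<integral>s. chi n s \<partial>circle)"
  proof (rule integral_dominated_convergence[where w = "\<lambda>_. 1"])
    show "AE s in circle. (\<lambda>k. indicator {s. e k < cmod (s - t)} s * chi n s) \<longlonglongrightarrow> chi n s"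
      using null_singleton_circle[OF t]
    proof eventually_elim
      case (elim s)
      then have "eventually (\<lambda>k. e k < cmod (s - t)) sequentially"
        using e(2) by (intro order_tendstoD(2)) auto
      then have "eventually (\<lambda>k. indicator {s. e k < cmod (s - t)} s * chi n s = chi n s) sequentially"
        by eventually_elim auto
      then show ?case by (rule tendsto_eventually)
    qed
  qed (auto simp: norm_mult split: split_indicator intro!: borel_measurable_times indicator_measurable_circle)
  then show "(\<lambda>k. \<integral>s. indicator {s. e k < cmod (s - t)} s * chi n s \<partial>circle) \<longlonglongrightarrow> of_bool (n = 0)"
    by (simp add: integral_chi)
qed auto

text \<open>The truncated Cauchy integral against dm instead of the line element. Since d tau = 2 pi
  i tau dm, the principal value belonging to \<open>chi n\<close> is 2 pi i times the limit of this
  quantity at index n + 1.\<close>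

definition truncated_cauchy :: "complex \<Rightarrow> int \<Rightarrow> real \<Rightarrow> complex" where
  "truncated_cauchy t n \<epsilon> = (\<integral>s. indicator {s. \<epsilon> < cmod (s - t)} s * (chi n s / (s - t)) \<partial>circle)"

lemma integrable_truncated:
  fixes g :: "complex \<Rightarrow> complex"
  assumes "0 < \<epsilon>" "g \<in> borel_measurable circle" "\<And>s. s \<in> sphere 0 1 \<Longrightarrow> cmod (g s) \<le> 1"
  shows "integrable circle (\<lambda>s. indicator {s. \<epsilon> < cmod (s - t)} s * (g s / (s - t)))"
proof (rule integrable_circle_bounded[of _ "1 / \<epsilon>"])
  show "(\<lambda>s. indicator {s. \<epsilon> < cmod (s - t)} s * (g s / (s - t))) \<in> borel_measurable circle"
    using assms(2)
    by (intro borel_measurable_times borel_measurable_divide measurable_circle[of "indicator _"]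
         measurable_circle[of "\<lambda>s. s - t"]) auto
  fix s :: complex assume "s \<in> sphere 0 1"
  then show "cmod (indicator {s. \<epsilon> < cmod (s - t)} s * (g s / (s - t))) \<le> 1 / \<epsilon>"
    using assms(1) assms(3)[of s] by (auto simp: norm_divide split: split_indicator intro!: frac_le)
qed

text \<open>From s / (s - t) = 1 + t / (s - t). In the limit the added integral is 1 for n = 0 and 0
  otherwise, so it contributes a single jump, and this jump is what tells nonnegative from negative
  frequencies.\<close>

lemma truncated_cauchy_step:
  assumes "0 < \<epsilon>" "t \<in> sphere 0 1"
  shows "truncated_cauchy t (n + 1) \<epsilon> =
    t * truncated_cauchy t n \<epsilon> + (\<integral>s. indicator {s. \<epsilon> < cmod (s - t)} s * chi n s \<partial>circle)"
proof -
  have i: "integrable circle (\<lambda>s. indicator {s. \<epsilon> < cmod (s - t)} s * (chi n s / (s - t)))"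
    by (rule integrable_truncated[OF assms(1)]) auto
  have i2: "integrable circle (\<lambda>s. indicator {s. \<epsilon> < cmod (s - t)} s * chi n s)"
    by (rule integrable_circle_bounded[of _ 1])
       (auto simp: norm_mult split: split_indicator intro!: borel_measurable_times indicator_measurable_circle)
  have "truncated_cauchy t (n + 1) \<epsilon> = (\<integral>s. t * (indicator {s. \<epsilon> < cmod (s - t)} s * (chi n s / (s - t)))
     + indicator {s. \<epsilon> < cmod (s - t)} s * chi n s \<partial>circle)"
    unfolding truncated_cauchy_def
  proof (intro Bochner_Integration.integral_cong refl)
    fix s assume s: "s \<in> space circle"
    then have "chi (n + 1) s = s * chi n s"
      using chi_mult[of s 1 n] by (simp add: chi_def add.commute)
    moreover have "s * chi n s / (s - t) = t * (chi n s / (s - t)) + chi n s" if "s \<noteq> t"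
      using that by (simp add: field_simps)
    ultimately show "indicator {s. \<epsilon> < cmod (s - t)} s * (chi (n + 1) s / (s - t)) =
      t * (indicator {s. \<epsilon> < cmod (s - t)} s * (chi n s / (s - t))) + indicator {s. \<epsilon> < cmod (s - t)} s * chi n s"
      using assms(1) by (cases "s = t") (auto split: split_indicator)
  qed
  also have "\<dots> = t * truncated_cauchy t n \<epsilon> + (\<integral>s. indicator {s. \<epsilon> < cmod (s - t)} s * chi n s \<partial>circle)"
    unfolding truncated_cauchy_def
    by (subst Bochner_Integration.integral_add[OF integrable_mult_right[OF i] i2])
       (simp only: integral_mult_right_zero)
  finally show ?thesis .
qed

text \<open>
  The reflection \<open>s \<mapsto> t\<^sup>2 / s\<close> of the circle fixes \<open>t\<close> and the truncated circle, and the Cauchy kernel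
  and its reflection add up to the constant \<open>- 1 / t\<close>.
\<close>

lemma truncated_cauchy_0:
  assumes "0 < \<epsilon>" "t \<in> sphere 0 1"
  shows "truncated_cauchy t 0 \<epsilon> =
    - (\<integral>s. indicator {s. \<epsilon> < cmod (s - t)} s * chi 0 s \<partial>circle) / (2 * t)"
proof -
  let ?I = "\<lambda>s. indicator {s. \<epsilon> < cmod (s - t)} s :: complex"
  let ?f = "\<lambda>s. ?I s * (1 / (s - t))"
  have t0: "t \<noteq> 0" using assms by auto
  have "(\<integral>s. ?f (t\<^sup>2 * cnj s) \<partial>circle) = (\<integral>s. ?f s \<partial>circle)"
    by (rule integral_circle_reflect[OF assms(2)])
       (auto intro!: borel_measurable_times borel_measurable_divide borel_measurable_indicator)
  moreover have "(\<integral>s. ?f (t\<^sup>2 * cnj s) \<partial>circle) = (\<integral>s. - (1 / t) * ?I s - ?f s \<partial>circle)"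
  proof (intro Bochner_Integration.integral_cong refl)
    fix s assume "s \<in> space circle"
    then have s: "cmod s = 1" "s \<noteq> 0" "cnj s = 1 / s"
      using inverse_unique[of s "cnj s"] by (auto simp: complex_norm_square[symmetric] divide_inverse)
    have eq: "t\<^sup>2 * cnj s - t = (t - s) * (t / s)" using s by (simp add: field_simps power2_eq_square)
    have "cmod (t\<^sup>2 * cnj s - t) = cmod (s - t)"
      unfolding eq using s assms(2) by (simp add: norm_mult norm_divide norm_minus_commute)
    moreover have "1 / (t\<^sup>2 * cnj s - t) = - (1 / t) - 1 / (s - t)" if "s \<noteq> t"
      unfolding eq using that s t0 by (simp add: field_simps)
    ultimately show "?f (t\<^sup>2 * cnj s) = - (1 / t) * ?I s - ?f s"
      using assms(1) by (cases "s = t") (auto split: split_indicator)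
  qed
  moreover have "(\<integral>s. - (1 / t) * ?I s - ?f s \<partial>circle) = - (1 / t) * (\<integral>s. ?I s \<partial>circle) - (\<integral>s. ?f s \<partial>circle)"
  proof -
    have "integrable circle ?f"
      by (rule integrable_truncated[OF assms(1)]) auto
    moreover have "integrable circle ?I"
      by (rule integrable_circle_bounded[of _ 1]) (auto split: split_indicator intro!: indicator_measurable_circle)
    ultimately show ?thesis by simp
  qed
  ultimately have "2 * (\<integral>s. ?f s \<partial>circle) = - (1 / t) * (\<integral>s. ?I s \<partial>circle)" by simp
  then show ?thesis using t0 by (simp add: truncated_cauchy_def field_simps)
qed

text \<open>\<open>truncated_cauchy_0\<close> gives the limit at n = 0, and the recursion carries it
  in both directions. Upwards from 0 the jump turns - 1 / 2 into 1 / 2; all other steps merely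
  multiply or divide by t.\<close>

lemma truncated_cauchy_tendsto:
  assumes t: "t \<in> sphere 0 1"
  shows "(truncated_cauchy t n \<longlongrightarrow> (if n \<le> 0 then - chi (n - 1) t / 2 else chi (n - 1) t / 2)) (at_right 0)"
proof -
  have t0: "t \<noteq> 0" using t by auto
  have ev: "eventually (\<lambda>\<epsilon>::real. 0 < \<epsilon>) (at_right 0)" by (rule eventually_at_right_less)
  note D = truncated_integral_chi_tendsto[OF t]
  have chi1: "chi (m + 1) t = t * chi m t" for m
    using chi_mult[OF t, of 1 m] by (simp add: chi_def add.commute)
  show ?thesis
  proof (induction n rule: int_induct[where k = 0])
    case base
    have "((\<lambda>\<epsilon>. - (\<integral>s. indicator {s. \<epsilon> < cmod (s - t)} s * chi 0 s \<partial>circle) / (2 * t)) \<longlongrightarrow> - of_bool (0 = (0::int)) / (2 * t)) (at_right 0)"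
      by (intro tendsto_intros D) (use t0 in auto)
    moreover have "- of_bool (0 = (0::int)) / (2 * t) = - chi (0 - 1) t / 2"
      by (simp add: chi_def power_int_minus field_simps)
    moreover have "eventually (\<lambda>\<epsilon>. - (\<integral>s. indicator {s. \<epsilon> < cmod (s - t)} s * chi 0 s \<partial>circle) / (2 * t)
        = truncated_cauchy t 0 \<epsilon>) (at_right 0)"
      using ev by eventually_elim (rule truncated_cauchy_0[OF _ t, symmetric])
    ultimately show ?case
      by (simp only: order_refl if_True) (rule Lim_transform_eventually)
  next
    case (step1 i)
    have "((\<lambda>\<epsilon>. t * truncated_cauchy t i \<epsilon> + (\<integral>s. indicator {s. \<epsilon> < cmod (s - t)} s * chi i s \<partial>circle)) \<longlongrightarrow>
       t * (if i \<le> 0 then - chi (i - 1) t / 2 else chi (i - 1) t / 2) + of_bool (i = 0)) (at_right 0)"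
      by (intro tendsto_intros step1 D)
    moreover have "t * (if i \<le> 0 then - chi (i - 1) t / 2 else chi (i - 1) t / 2) + of_bool (i = 0) = chi (i + 1 - 1) t / 2"
      using step1 chi1[of "i - 1"] by auto
    moreover have "\<not> i + 1 \<le> 0" using step1 by simp
    moreover have "eventually (\<lambda>\<epsilon>. t * truncated_cauchy t i \<epsilon> + (\<integral>s. indicator {s. \<epsilon> < cmod (s - t)} s * chi i s \<partial>circle)
        = truncated_cauchy t (i + 1) \<epsilon>) (at_right 0)"
      using ev by eventually_elim (rule truncated_cauchy_step[OF _ t, symmetric])
    ultimately show ?case
      by (simp only: if_False) (rule Lim_transform_eventually)
  next
    case (step2 i)
    have "((\<lambda>\<epsilon>. (truncated_cauchy t i \<epsilon> - (\<integral>s. indicator {s. \<epsilon> < cmod (s - t)} s * chi (i - 1) s \<partial>circle)) / t) \<longlongrightarrow>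
       ((if i \<le> 0 then - chi (i - 1) t / 2 else chi (i - 1) t / 2) - of_bool (i - 1 = 0)) / t) (at_right 0)"
      by (intro tendsto_intros step2 D t0)
    moreover have "((if i \<le> 0 then - chi (i - 1) t / 2 else chi (i - 1) t / 2) - of_bool (i - 1 = 0)) / t = - chi (i - 1 - 1) t / 2"
      using step2 chi1[of "i - 1 - 1"] t0 by auto
    moreover have "i - 1 \<le> 0" using step2 by simp
    moreover have "eventually (\<lambda>\<epsilon>. (truncated_cauchy t i \<epsilon> - (\<integral>s. indicator {s. \<epsilon> < cmod (s - t)} s * chi (i - 1) s \<partial>circle)) / t
        = truncated_cauchy t (i - 1) \<epsilon>) (at_right 0)"
      using ev
    proof eventually_elim
      case (elim e)
      show ?case using truncated_cauchy_step[OF elim t, of "i - 1"] t0 by simp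
    qed
    ultimately show ?case
      by (simp only: if_True) (rule Lim_transform_eventually)
  qed
qed

lemma riesz_chi:
  assumes t: "t \<in> sphere 0 1"
  shows "riesz (chi n) t = (if 0 \<le> n then chi n t else 0)"
proof -
  \<comment> \<open>Index n + 1 comes from the factor tau in the line element, so the change of sign
    between indices 0 and 1 falls between the frequencies - 1 and 0.\<close>
  let ?L = "if n + 1 \<le> 0 then - chi n t / 2 else chi n t / 2"
  have "((\<lambda>\<epsilon>. 2 * of_real pi * \<i> * truncated_cauchy t (n + 1) \<epsilon>) \<longlongrightarrow> 2 * of_real pi * \<i> * ?L) (at_right 0)"
    using truncated_cauchy_tendsto[OF t, of "n + 1"] by (intro tendsto_mult tendsto_const) (simp only: add_diff_cancel_right')
  moreover have "2 * of_real pi * \<i> * truncated_cauchy t (n + 1) \<epsilon> =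
      (LINT \<tau>:{\<tau>. \<epsilon> < cmod (\<tau> - t)}|circle. chi n \<tau> / (\<tau> - t) * (2 * of_real pi * \<i> * \<tau>))" for \<epsilon>
  proof -
    have "2 * of_real pi * \<i> * truncated_cauchy t (n + 1) \<epsilon> =
       (\<integral>s. 2 * of_real pi * \<i> * (indicator {s. \<epsilon> < cmod (s - t)} s * (chi (n + 1) s / (s - t))) \<partial>circle)"
      by (simp only: truncated_cauchy_def integral_mult_right_zero)
    also have "\<dots> = (LINT \<tau>:{\<tau>. \<epsilon> < cmod (\<tau> - t)}|circle. chi n \<tau> / (\<tau> - t) * (2 * of_real pi * \<i> * \<tau>))"
      unfolding set_lebesgue_integral_def
    proof (intro Bochner_Integration.integral_cong refl)
      fix s assume s: "s \<in> space circle"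
      then have "chi (n + 1) s = s * chi n s"
        using chi_mult[of s 1 n] by (simp add: chi_def add.commute)
      then show "2 * of_real pi * \<i> * (indicator {s. \<epsilon> < cmod (s - t)} s * (chi (n + 1) s / (s - t))) =
          indicat_real {\<tau>. \<epsilon> < cmod (\<tau> - t)} s *\<^sub>R (chi n s / (s - t) * (2 * of_real pi * \<i> * s))"
        by (auto split: split_indicator)
    qed
    finally show ?thesis .
  qed
  ultimately have "pv_integral (\<lambda>\<tau>. chi n \<tau> / (\<tau> - t)) t = 2 * of_real pi * \<i> * ?L"
    unfolding pv_integral_def by (intro tendsto_Lim) simp_all
  then show ?thesis
    by (auto simp: riesz_def singular_integral_def)
qed

section \<open>Banach function spaces\<close>

locale bfn =
  fixes \<rho> :: "(complex \<Rightarrow> ennreal) \<Rightarrow> ennreal"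
  assumes bfn: "banach_function_norm \<rho>"
begin

abbreviation X where "X \<equiv> bfs \<rho>"
abbreviation N where "N \<equiv> bfs_norm \<rho>"

lemma rho_eq_0_iff: "f \<in> borel_measurable circle \<Longrightarrow> \<rho> f = 0 \<longleftrightarrow> (AE t in circle. f t = 0)"
  and rho_cmult: "f \<in> borel_measurable circle \<Longrightarrow> 0 \<le> c \<Longrightarrow> \<rho> (\<lambda>t. ennreal c * f t) = ennreal c * \<rho> f"
  and rho_add: "f \<in> borel_measurable circle \<Longrightarrow> g \<in> borel_measurable circle \<Longrightarrow> \<rho> (\<lambda>t. f t + g t) \<le> \<rho> f + \<rho> g"
  and rho_mono: "f \<in> borel_measurable circle \<Longrightarrow> g \<in> borel_measurable circle \<Longrightarrow>
        AE t in circle. g t \<le> f t \<Longrightarrow> \<rho> g \<le> \<rho> f"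
  and rho_incseq: "(\<And>n. F n \<in> borel_measurable circle) \<Longrightarrow> f \<in> borel_measurable circle \<Longrightarrow>
        AE t in circle. incseq (\<lambda>n::nat. F n t) \<and> (\<lambda>n. F n t) \<longlonglongrightarrow> f t \<Longrightarrow> (\<lambda>n. \<rho> (F n)) \<longlonglongrightarrow> \<rho> f"
  and rho_indicator: "E \<in> sets circle \<Longrightarrow> \<rho> (indicator E) < \<infinity>"
  and rho_integral: "E \<in> sets circle \<Longrightarrow> \<exists>C::real. 0 < C \<and>
        (\<forall>f \<in> borel_measurable circle. (\<integral>\<^sup>+t\<in>E. f t \<partial>circle) \<le> ennreal C * \<rho> f)"
  using bfn unfolding banach_function_norm_def by auto

lemma rho_cong:
  "f \<in> borel_measurable circle \<Longrightarrow> g \<in> borel_measurable circle \<Longrightarrow>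
        AE t in circle. g t = f t \<Longrightarrow> \<rho> g = \<rho> f"
  by (intro antisym rho_mono) auto

text \<open>The axiom on increasing sequences is applied to the infima \<open>G n\<close> over
  tails, which increase to the limit of the \<open>F n\<close>. The bounds may vary with n, since in
  one application they are norms that only converge to the desired value.\<close>

lemma rho_fatou:
  assumes F: "\<And>n::nat. F n \<in> borel_measurable circle" and f: "f \<in> borel_measurable circle"
    and lim: "AE t in circle. (\<lambda>n. F n t) \<longlonglongrightarrow> f t"
    and le: "\<And>n. \<rho> (F n) \<le> c n" and c: "c \<longlonglongrightarrow> d"
  shows "\<rho> f \<le> d"
proof -
  define G where "G n t = (INF m\<in>{n..}. F m t)" for n t
  have G: "G n \<in> borel_measurable circle" for n
    unfolding G_def using F by measurable
  have "(\<lambda>n. \<rho> (G n)) \<longlonglongrightarrow> \<rho> f"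
  proof (rule rho_incseq[OF G f])
    show "AE t in circle. incseq (\<lambda>n. G n t) \<and> (\<lambda>n. G n t) \<longlonglongrightarrow> f t"
      using lim
    proof eventually_elim
      case (elim t)
      have inc: "incseq (\<lambda>n. G n t)"
        unfolding G_def by (intro incseq_SucI INF_superset_mono) auto
      have "(SUP n. G n t) = liminf (\<lambda>n. F n t)"
        unfolding G_def liminf_SUP_INF by (simp add: atLeast_def)
      also have "\<dots> = f t" using elim by (intro lim_imp_Liminf) auto
      finally show ?case using inc LIMSEQ_SUP[OF inc] by simp
    qed
  qed
  moreover have "\<rho> (G n) \<le> c n" for n
  proof -
    have "\<rho> (G n) \<le> \<rho> (F n)" by (rule rho_mono[OF F G]) (auto simp: G_def intro!: INF_lower)
    with le[of n] show ?thesis by simp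
  qed
  ultimately show ?thesis using c by (intro LIMSEQ_le) auto
qed

lemma measurable_norm_ennreal:
  "f \<in> borel_measurable circle \<Longrightarrow> (\<lambda>t. ennreal (cmod (f t))) \<in> borel_measurable circle"
  by measurable

lemma bfs_measurable: "f \<in> X \<Longrightarrow> f \<in> borel_measurable circle"
  by (simp add: bfs_def)

lemma rho_eq_norm: "f \<in> X \<Longrightarrow> \<rho> (\<lambda>t. ennreal (cmod (f t))) = ennreal (N f)"
  by (simp add: bfs_def bfs_norm_def)

lemma bfs_normI:
  assumes "f \<in> borel_measurable circle" "\<rho> (\<lambda>t. ennreal (cmod (f t))) \<le> ennreal c" "0 \<le> c"
  shows "f \<in> X" "N f \<le> c"
  using assms unfolding bfs_def bfs_norm_def
  by (auto intro: le_less_trans enn2real_leI)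

lemma norm_nonneg [simp]: "0 \<le> N f"
  by (simp add: bfs_norm_def)

lemma bfs_dominated:
  assumes "g \<in> X" "f \<in> borel_measurable circle" "AE t in circle. cmod (f t) \<le> cmod (g t)"
  shows "f \<in> X" "N f \<le> N g"
proof -
  have "\<rho> (\<lambda>t. ennreal (cmod (f t))) \<le> \<rho> (\<lambda>t. ennreal (cmod (g t)))"
    using assms by (intro rho_mono measurable_norm_ennreal bfs_measurable[OF assms(1)]) auto
  also have "\<dots> = ennreal (N g)" by (rule rho_eq_norm[OF assms(1)])
  finally show "f \<in> X" "N f \<le> N g"
    using bfs_normI[OF assms(2) _ norm_nonneg] by blast+
qed

lemma bfs_cong:
  assumes "g \<in> X" "f \<in> borel_measurable circle" "AE t in circle. f t = g t"
  shows "f \<in> X" "N f = N g"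
proof -
  have "AE t in circle. cmod (f t) \<le> cmod (g t)" using assms(3) by eventually_elim simp
  then show f: "f \<in> X" by (rule bfs_dominated(1)[OF assms(1,2)])
  show "N f = N g"
    using assms(1,2,3) f by (intro antisym bfs_dominated(2) bfs_measurable) auto
qed

lemma bfs_add:
  assumes "f \<in> X" "g \<in> X"
  shows "(\<lambda>t. f t + g t) \<in> X" "N (\<lambda>t. f t + g t) \<le> N f + N g"
proof -
  have m: "f \<in> borel_measurable circle" "g \<in> borel_measurable circle"
    using assms by (auto intro: bfs_measurable)
  have "\<rho> (\<lambda>t. ennreal (cmod (f t + g t))) \<le> \<rho> (\<lambda>t. ennreal (cmod (f t)) + ennreal (cmod (g t)))"
    using m by (intro rho_mono) (auto simp: ennreal_plus[symmetric] norm_triangle_ineq simp del: ennreal_plus)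
  also have "\<dots> \<le> \<rho> (\<lambda>t. ennreal (cmod (f t))) + \<rho> (\<lambda>t. ennreal (cmod (g t)))"
    using m by (intro rho_add) auto
  also have "\<dots> = ennreal (N f + N g)"
    using assms by (simp add: rho_eq_norm)
  finally show "(\<lambda>t. f t + g t) \<in> X" "N (\<lambda>t. f t + g t) \<le> N f + N g"
    using bfs_normI[OF borel_measurable_add[OF m], of "N f + N g"] by auto
qed

lemma bfs_cmult:
  assumes "f \<in> X"
  shows "(\<lambda>t. c * f t) \<in> X" "N (\<lambda>t. c * f t) = cmod c * N f"
proof -
  have m: "f \<in> borel_measurable circle" using assms by (rule bfs_measurable)
  have *: "\<rho> (\<lambda>t. ennreal (cmod (c * f t))) = ennreal (cmod c * N f)"
    using rho_cmult[OF measurable_norm_ennreal[OF m], of "cmod c"] assms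
    by (simp add: norm_mult ennreal_mult rho_eq_norm)
  then show "(\<lambda>t. c * f t) \<in> X" using m by (simp add: bfs_def)
  show "N (\<lambda>t. c * f t) = cmod c * N f" by (simp only: bfs_norm_def[of \<rho> "\<lambda>t. c * f t"] *) simp
qed

lemma bfs_diff:
  assumes "f \<in> X" "g \<in> X"
  shows "(\<lambda>t. f t - g t) \<in> X" "N (\<lambda>t. f t - g t) \<le> N f + N g"
  using bfs_add[OF assms(1) bfs_cmult(1)[OF assms(2), of "-1"]] bfs_cmult(2)[OF assms(2), of "-1"] by auto

lemma norm_triangle_diff:
  assumes "f \<in> X" "g \<in> X" "h \<in> X"
  shows "N (\<lambda>t. f t - h t) \<le> N (\<lambda>t. f t - g t) + N (\<lambda>t. g t - h t)"
  using bfs_add(2)[OF bfs_diff(1)[OF assms(1,2)] bfs_diff(1)[OF assms(2,3)]] by simp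

lemma norm_minus_commute_bfs: "N (\<lambda>t. f t - g t) = N (\<lambda>t. g t - f t)"
  by (simp add: bfs_norm_def norm_minus_commute)

lemma norm_eq_0_iff: "f \<in> X \<Longrightarrow> N f = 0 \<longleftrightarrow> (AE t in circle. f t = 0)"
  using rho_eq_0_iff[OF measurable_norm_ennreal, of f] rho_eq_norm[of f] bfs_measurable[of f] by simp

lemma bfs_zero: "(\<lambda>t. 0) \<in> X" "N (\<lambda>t. 0) = 0"
proof -
  have "\<rho> (\<lambda>t. 0) = 0" by (subst rho_eq_0_iff) auto
  then show "(\<lambda>t. 0) \<in> X" "N (\<lambda>t. 0) = 0" by (auto simp: bfs_def bfs_norm_def)
qed

lemma bfs_bounded:
  assumes "f \<in> borel_measurable circle" "AE t in circle. cmod (f t) \<le> B"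
  shows "f \<in> X"
proof (rule bfs_dominated(1)[OF _ assms(1)])
  have "\<rho> (\<lambda>t. ennreal (cmod 1)) = \<rho> (indicator (space circle))"
    by (intro rho_cong borel_measurable_indicator) auto
  also have "\<dots> < \<infinity>" by (intro rho_indicator) auto
  finally have "(\<lambda>t. 1) \<in> X" by (simp add: bfs_def)
  from bfs_cmult(1)[OF this, of "of_real B"] show "(\<lambda>t. of_real B * 1) \<in> X" .
  show "AE t in circle. cmod (f t) \<le> cmod (of_real B * 1)"
    using assms(2) by eventually_elim auto
qed

lemma bfs_trig_poly: "trig_poly q \<Longrightarrow> q \<in> X"
proof -
  assume q: "trig_poly q"
  have "bounded (q ` sphere 0 1)"
    by (intro compact_imp_bounded compact_continuous_image trig_poly_continuous q) auto
  then obtain B where "\<forall>t\<in>sphere 0 1. cmod (q t) \<le> B" by (auto simp: bounded_iff)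
  then show ?thesis using measurable_trig_poly[OF q] by (intro bfs_bounded[of _ B] AE_I2) auto
qed

lemma bfs_sum: "(\<And>i. i \<in> I \<Longrightarrow> f i \<in> X) \<Longrightarrow> (\<lambda>t. \<Sum>i\<in>I. f i t) \<in> X"
  by (induction I rule: infinite_finite_induct) (auto simp: bfs_zero intro: bfs_add)

lemma bfs_L1: "\<exists>C>0. \<forall>f\<in>X. (\<integral>t. cmod (f t) \<partial>circle) \<le> C * N f"
proof -
  from rho_integral[OF sets.top] obtain C where C: "0 < C"
    "\<And>f. f \<in> borel_measurable circle \<Longrightarrow> (\<integral>\<^sup>+t\<in>space circle. f t \<partial>circle) \<le> ennreal C * \<rho> f"
    by blast
  show ?thesis
  proof (intro exI[of _ C] conjI ballI C(1))
    fix f assume f: "f \<in> X"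
    have m: "f \<in> borel_measurable circle" using f by (rule bfs_measurable)
    have "(\<integral>\<^sup>+t. ennreal (cmod (f t)) \<partial>circle) = (\<integral>\<^sup>+t\<in>space circle. ennreal (cmod (f t)) \<partial>circle)"
      by (intro nn_integral_cong) auto
    also have "\<dots> \<le> ennreal C * \<rho> (\<lambda>t. ennreal (cmod (f t)))"
      using m by (intro C) auto
    also have "\<dots> = ennreal (C * N f)" using C(1) by (simp add: rho_eq_norm[OF f] ennreal_mult)
    finally have *: "(\<integral>\<^sup>+t. ennreal (cmod (f t)) \<partial>circle) \<le> ennreal (C * N f)" .
    then show "(\<integral>t. cmod (f t) \<partial>circle) \<le> C * N f"
      using m C(1) by (subst integral_eq_nn_integral) (auto intro!: enn2real_leI)
  qed
qed

lemma bfs_integrable: "f \<in> X \<Longrightarrow> integrable circle f"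
proof -
  assume f: "f \<in> X"
  from rho_integral[OF sets.top] obtain C where C: "0 < C"
    "\<And>f. f \<in> borel_measurable circle \<Longrightarrow> (\<integral>\<^sup>+t\<in>space circle. f t \<partial>circle) \<le> ennreal C * \<rho> f"
    by blast
  have m: "f \<in> borel_measurable circle" using f by (rule bfs_measurable)
  have "(\<integral>\<^sup>+t. ennreal (cmod (f t)) \<partial>circle) = (\<integral>\<^sup>+t\<in>space circle. ennreal (cmod (f t)) \<partial>circle)"
    by (intro nn_integral_cong) auto
  also have "\<dots> \<le> ennreal C * ennreal (N f)"
    using m by (subst rho_eq_norm[OF f, symmetric], intro C) auto
  also have "\<dots> < \<infinity>" by (simp add: ennreal_mult_less_top)
  finally show ?thesis using m by (intro integrableI_bounded) auto
qed

lemma fourier_coeff_bfs_tendsto: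
  assumes "\<And>j. f j \<in> X" "g \<in> X" "(\<lambda>j::nat. N (\<lambda>t. f j t - g t)) \<longlonglongrightarrow> 0"
  shows "(\<lambda>j. fourier_coeff (f j) n) \<longlonglongrightarrow> fourier_coeff g n"
proof -
  obtain C where C: "0 < C" "\<And>f. f \<in> X \<Longrightarrow> (\<integral>t. cmod (f t) \<partial>circle) \<le> C * N f" using bfs_L1 by blast
  have "(\<lambda>j. fourier_coeff (f j) n - fourier_coeff g n) \<longlonglongrightarrow> 0"
  proof (rule Lim_null_comparison)
    show "\<forall>\<^sub>F j in sequentially. norm (fourier_coeff (f j) n - fourier_coeff g n) \<le> C * N (\<lambda>t. f j t - g t)"
    proof (intro always_eventually allI)
      fix j
      have "fourier_coeff (f j) n - fourier_coeff g n = fourier_coeff (\<lambda>t. f j t - g t) n"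
        using assms by (simp add: fourier_coeff_diff bfs_integrable)
      also have "norm \<dots> \<le> (\<integral>t. cmod (f j t - g t) \<partial>circle)"
        using assms by (intro norm_fourier_coeff_le bfs_integrable bfs_diff)
      also have "\<dots> \<le> C * N (\<lambda>t. f j t - g t)" using assms by (intro C bfs_diff)
      finally show "norm (fourier_coeff (f j) n - fourier_coeff g n) \<le> C * N (\<lambda>t. f j t - g t)" .
    qed
    show "(\<lambda>j. C * N (\<lambda>t. f j t - g t)) \<longlonglongrightarrow> 0" using assms(3) by (rule tendsto_mult_right_zero)
  qed
  then show ?thesis by (simp add: LIM_zero_iff)
qed

lemma bfs_tendsto_AE_subseq:
  assumes "\<And>j. f j \<in> X" "g \<in> X" "(\<lambda>j::nat. N (\<lambda>t. f j t - g t)) \<longlonglongrightarrow> 0"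
  obtains r where "strict_mono r" "AE t in circle. (\<lambda>j. f (r j) t) \<longlonglongrightarrow> g t"
proof -
  obtain C where C: "0 < C" "\<And>f. f \<in> X \<Longrightarrow> (\<integral>t. cmod (f t) \<partial>circle) \<le> C * N f" using bfs_L1 by blast
  have "(\<lambda>j. \<integral>t. norm (f j t - g t) \<partial>circle) \<longlonglongrightarrow> 0"
  proof (rule tendsto_sandwich[OF _ _ tendsto_const])
    show "\<forall>\<^sub>F j in sequentially. (\<integral>t. norm (f j t - g t) \<partial>circle) \<le> C * N (\<lambda>t. f j t - g t)"
      using assms by (intro always_eventually allI C bfs_diff)
    show "(\<lambda>j. C * N (\<lambda>t. f j t - g t)) \<longlonglongrightarrow> 0" using assms(3) by (rule tendsto_mult_right_zero)
  qed auto
  from tendsto_L1_AE_subseq[OF _ this] obtain r where r: "strict_mono r"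
    "AE t in circle. (\<lambda>j. f (r j) t - g t) \<longlonglongrightarrow> 0"
    using assms by (auto intro: bfs_integrable)
  show ?thesis by (rule that[OF r(1)]) (use r(2) in \<open>auto simp: LIM_zero_iff\<close>)
qed

text \<open>If the norms did not tend to zero, disjoint pieces of \<open>f\<close> of norm bounded below would exist, and
  the sums of subfamilies of these pieces would form an uncountable separated set.\<close>

lemma absolutely_continuous_norm:
  assumes sep: "bfs_separable \<rho>" and f: "f \<in> X"
    and F: "decseq F" "\<And>n. F n \<in> sets circle" "AE t in circle. \<exists>n. t \<notin> F n"
  shows "(\<lambda>n. N (\<lambda>t. indicator (F n) t * f t)) \<longlonglongrightarrow> 0"
proof (rule ccontr)
  have fm: "f \<in> borel_measurable circle" using f by (rule bfs_measurable)
  have ind: "(\<lambda>t. indicator E t * f t) \<in> X" if "E \<in> sets circle" for E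
    by (rule bfs_dominated(1)[OF f]) (use that fm in \<open>auto split: split_indicator intro!: borel_measurable_times\<close>)
  have ind_mono: "N (\<lambda>t. indicator E t * f t) \<le> N (\<lambda>t. indicator E' t * f t)"
    if "E \<in> sets circle" "E' \<in> sets circle" "E \<subseteq> E'" for E E'
    by (rule bfs_dominated(2)[OF ind[OF that(2)]])
       (use that fm in \<open>auto split: split_indicator intro!: borel_measurable_times\<close>)
  assume "\<not> (\<lambda>n. N (\<lambda>t. indicator (F n) t * f t)) \<longlonglongrightarrow> 0"
  then obtain e where e: "0 < e" "\<And>n. \<exists>m\<ge>n. e \<le> N (\<lambda>t. indicator (F m) t * f t)"
    unfolding LIMSEQ_def by (auto simp: not_less)
  have ge: "e \<le> N (\<lambda>t. indicator (F n) t * f t)" for n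
  proof -
    from e(2)[of n] obtain m where "m \<ge> n" "e \<le> N (\<lambda>t. indicator (F m) t * f t)" by blast
    then show ?thesis using ind_mono[OF F(2) F(2), of m n] decseqD[OF F(1)] by force
  qed
  \<comment> \<open>The rings \<open>F n - F m\<close> increase with m to \<open>F n\<close> up to a
    null set. If f had norm at most e / 2 on all of them, the Fatou property would give it norm at
    most e / 2 on \<open>F n\<close>, against \<open>ge\<close>.\<close>
  have "\<exists>m>n. e / 2 < N (\<lambda>t. indicator (F n - F m) t * f t)" for n
  proof (rule ccontr)
    assume "\<not> ?thesis"
    then have le: "N (\<lambda>t. indicator (F n - F m) t * f t) \<le> e / 2" if "m > n" for m
      using that not_less by blast
    have "\<rho> (\<lambda>t. ennreal (cmod (indicator (F n) t * f t))) \<le> ennreal (e / 2)"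
    proof (rule rho_fatou[where F = "\<lambda>k t. ennreal (cmod (indicator (F n - F (Suc n + k)) t * f t))"])
      show "AE t in circle. (\<lambda>k. ennreal (cmod (indicator (F n - F (Suc n + k)) t * f t))) \<longlonglongrightarrow>
          ennreal (cmod (indicator (F n) t * f t))"
        using F(3)
      proof eventually_elim
        case (elim t)
        then obtain m where m: "t \<notin> F m" by blast
        have "t \<notin> F (Suc n + k)" if "k \<ge> m" for k
          using m decseqD[OF F(1), of m "Suc n + k"] that by auto
        then have "eventually (\<lambda>k. ennreal (cmod (indicator (F n - F (Suc n + k)) t * f t)) =
            ennreal (cmod (indicator (F n) t * f t))) sequentially"
          by (auto simp: eventually_sequentially indicator_def)
        then show ?case by (rule tendsto_eventually)
      qed
      show "\<rho> (\<lambda>t. ennreal (cmod (indicator (F n - F (Suc n + k)) t * f t))) \<le> ennreal (e / 2)" for k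
        using le[of "Suc n + k"] rho_eq_norm[OF ind[of "F n - F (Suc n + k)"]] F(2) by (auto intro!: ennreal_leI)
    qed (use F fm in \<open>auto intro!: measurable_norm_ennreal borel_measurable_times\<close>)
    then have "N (\<lambda>t. indicator (F n) t * f t) \<le> e / 2"
      using e(1) F(2) fm by (intro bfs_normI(2)) (auto intro!: borel_measurable_times)
    with ge[of n] e(1) show False by simp
  qed
  then obtain nx where nx: "\<And>n. nx n > n" "\<And>n. e / 2 < N (\<lambda>t. indicator (F n - F (nx n)) t * f t)"
    by metis
  define r where "r j = (nx ^^ j) 0" for j
  have r_Suc: "r (Suc j) = nx (r j)" for j by (simp add: r_def)
  have "strict_mono r" by (intro strict_monoI_Suc) (simp add: r_Suc nx)
  define G where "G j = F (r j) - F (r (Suc j))" for j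
  have Gm: "G j \<in> sets circle" for j using F(2) by (auto simp: G_def)
  have disj: "G i \<inter> G j = {}" if "i < j" for i j
  proof -
    have "r (Suc i) \<le> r j" using \<open>strict_mono r\<close> that by (simp add: strict_mono_less_eq)
    then show ?thesis using decseqD[OF F(1)] by (auto simp: G_def)
  qed
  then have disj': "G i \<inter> G j = {}" if "i \<noteq> j" for i j
    using that by (metis Int_commute linorder_neqE_nat)
  define h where "h S = (\<lambda>t. indicator (\<Union>j\<in>S. G j) t * f t)" for S :: "nat set"
  have Um: "(\<Union>j\<in>S. G j) \<in> sets circle" for S :: "nat set"
    using Gm by (intro sets.countable_UN'[OF countableI_type]) auto
  have h: "h S \<in> X" for S unfolding h_def by (rule ind[OF Um])
  from sep obtain D where D: "countable D" "D \<subseteq> X"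
    "\<And>g \<epsilon>. g \<in> X \<Longrightarrow> 0 < \<epsilon> \<Longrightarrow> \<exists>d\<in>D. N (\<lambda>t. g t - d t) < \<epsilon>"
    unfolding bfs_separable_def by blast
  have "\<exists>d\<in>D. N (\<lambda>t. h S t - d t) < e / 4" for S using D(3)[OF h, of "e / 4"] e(1) by simp
  then obtain d where d: "\<And>S. d S \<in> D" "\<And>S. N (\<lambda>t. h S t - d S t) < e / 4" by metis
  have sep': "e / 2 < N (\<lambda>t. h S t - h T t)" if j: "j \<in> S" "j \<notin> T" for S T j
  proof -
    have "e / 2 < N (\<lambda>t. indicator (G j) t * f t)" using nx(2)[of "r j"] by (simp add: G_def r_Suc)
    also have "\<dots> \<le> N (\<lambda>t. h S t - h T t)"
    proof (rule bfs_dominated(2)[OF bfs_diff(1)[OF h h]])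
      show "AE t in circle. cmod (indicator (G j) t * f t) \<le> cmod (h S t - h T t)"
      proof (rule AE_I2)
        fix t
        have "t \<in> (\<Union>j\<in>S. G j)" "t \<notin> (\<Union>j\<in>T. G j)" if "t \<in> G j"
          using j that disj'[of j] by (blast, metis (no_types, lifting) UN_E disjoint_iff)
        then show "cmod (indicator (G j) t * f t) \<le> cmod (h S t - h T t)"
          by (cases "t \<in> G j") (auto simp: h_def indicator_def)
      qed
    qed (use Gm fm in \<open>auto intro!: borel_measurable_times\<close>)
    finally show ?thesis .
  qed
  have sep: "e / 2 < N (\<lambda>t. h S t - h T t)" if "S \<noteq> T" for S T
  proof -
    from that obtain j where "j \<in> S \<and> j \<notin> T \<or> j \<in> T \<and> j \<notin> S" by blast
    then show ?thesis using sep'[of j S T] sep'[of j T S] norm_minus_commute_bfs[of "h S" "h T"] by auto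
  qed
  \<comment> \<open>A common value of \<open>d\<close> would be within e / 4 of both
    \<open>h S\<close> and \<open>h T\<close>, which are more than e / 2 apart. Thus the power set
    of the naturals would embed into the countable set \<open>D\<close>.\<close>
  have "inj d"
  proof (rule injI, rule ccontr)
    fix S T assume eq: "d S = d T" and "S \<noteq> T"
    have "N (\<lambda>t. h S t - h T t) \<le> N (\<lambda>t. h S t - d S t) + N (\<lambda>t. d S t - h T t)"
      using d(1) D(2) by (intro norm_triangle_diff h) auto
    also have "\<dots> < e / 4 + e / 4"
      using d(2)[of S] d(2)[of T] norm_minus_commute_bfs[of "d T" "h T"] eq by simp
    finally show False using sep[OF \<open>S \<noteq> T\<close>] by simp
  qed
  moreover have "countable (range d)" using d(1) D(1) by (auto intro: countable_subset)
  ultimately have "countable (UNIV :: nat set set)"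
    using countable_image_inj_on by blast
  then have "range (from_nat_into (UNIV :: nat set set)) = UNIV"
    by (intro range_from_nat_into) auto
  then have "\<exists>g. g ` (UNIV :: nat set) = Pow (UNIV :: nat set)"
    by (intro exI[of _ "from_nat_into UNIV"]) simp
  then show False using Cantors_theorem[of "UNIV :: nat set"] by contradiction
qed

text \<open>On \<open>F n\<close> the function \<open>f n\<close> is bounded by |g|, off
  \<open>F n\<close> by d |g|. The sets \<open>F n\<close> decrease to a null set, so
  \<open>absolutely_continuous_norm\<close> makes the first part small, and d controls the second;
  the summand 1 in d guards against \<open>N g = 0\<close>. Almost everywhere on the zero set of g
  all \<open>f n\<close> vanish, so such points lie in no \<open>F n\<close>.\<close>

lemma dominated_convergence_bfs:
  assumes sep: "bfs_separable \<rho>" and g: "g \<in> X"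
    and f: "\<And>n::nat. f n \<in> borel_measurable circle" "\<And>n. AE t in circle. cmod (f n t) \<le> cmod (g t)"
    and lim: "AE t in circle. (\<lambda>n. f n t) \<longlonglongrightarrow> 0"
  shows "(\<lambda>n. N (f n)) \<longlonglongrightarrow> 0"
proof (rule LIMSEQ_I)
  fix e :: real assume e: "0 < e"
  define d where "d = e / (2 * (N g + 1))"
  have Ng: "0 < N g + 1" using norm_nonneg[of g] by linarith
  have d: "0 < d" using e Ng unfolding d_def by simp
  have "d * N g < d * (N g + 1)" using d by simp
  also have "\<dots> = e / 2" using Ng unfolding d_def by (simp add: field_simps)
  finally have d2: "d * N g < e / 2" .
  define F where "F n = {t \<in> space circle. \<exists>m\<ge>n. d * cmod (g t) < cmod (f m t)}" for n
  have gm: "g \<in> borel_measurable circle" using g by (rule bfs_measurable)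
  note [measurable] = f(1) gm
  have Fm: "F n \<in> sets circle" for n unfolding F_def by measurable
  have f': "AE t in circle. \<forall>n. cmod (f n t) \<le> cmod (g t)"
    using f(2) by (simp add: AE_all_countable)
  have "(\<lambda>n. N (\<lambda>t. indicator (F n) t * g t)) \<longlonglongrightarrow> 0"
  proof (rule absolutely_continuous_norm[OF sep g _ Fm])
    show "decseq F" unfolding F_def by (intro decseq_SucI) (auto intro: Suc_leD)
    show "AE t in circle. \<exists>n. t \<notin> F n"
      using f' lim
    proof eventually_elim
      case (elim t)
      show ?case
      proof (cases "g t = 0")
        case True
        then show ?thesis using elim(1) by (auto simp: F_def)
      next
        case False
        then have "0 < d * cmod (g t)" using d by simp
        from LIMSEQ_D[OF elim(2) this] obtain n where "\<forall>m\<ge>n. cmod (f m t) < d * cmod (g t)" by auto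
        then show ?thesis by (intro exI[of _ n]) (auto simp: F_def not_less less_imp_le)
      qed
    qed
  qed
  from LIMSEQ_D[OF this, of "e / 2"] e obtain n0 where n0: "\<And>n. n \<ge> n0 \<Longrightarrow> N (\<lambda>t. indicator (F n) t * g t) < e / 2"
    by auto
  have "N (f n) < e" if "n \<ge> n0" for n
  proof -
    have ig: "(\<lambda>t. indicator (F n) t * g t) \<in> X"
      by (rule bfs_dominated(1)[OF g]) (use Fm gm in \<open>auto split: split_indicator intro!: borel_measurable_times\<close>)
    let ?a = "\<lambda>t. of_real (cmod (indicator (F n) t * g t)) :: complex"
    let ?b = "\<lambda>t. of_real (d * cmod (g t)) :: complex"
    have a: "?a \<in> X" "N ?a \<le> N (\<lambda>t. indicator (F n) t * g t)"
      using Fm by (auto intro!: bfs_dominated[OF ig])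
    have b: "?b \<in> X" "N ?b \<le> N (\<lambda>t. of_real d * g t)"
      using d by (auto intro!: bfs_dominated[OF bfs_cmult(1)[OF g, of "of_real d"]] simp: norm_mult)
    have "N (f n) \<le> N (\<lambda>t. ?b t + ?a t)"
    proof (rule bfs_dominated(2)[OF bfs_add(1)[OF b(1) a(1)] f(1)])
      show "AE t in circle. cmod (f n t) \<le> cmod (?b t + ?a t)"
        using f(2)[of n] AE_space
      proof eventually_elim
        case (elim t)
        have "cmod (?b t + ?a t) = d * cmod (g t) + cmod (indicator (F n) t * g t)"
          using d(1) by (simp flip: of_real_add of_real_mult)
        moreover have "0 \<le> d * cmod (g t)" using d by simp
        ultimately show ?case using elim by (cases "t \<in> F n") (force simp: F_def)+
      qed
    qed
    also have "\<dots> \<le> d * N g + N (\<lambda>t. indicator (F n) t * g t)"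
      using bfs_add(2)[OF b(1) a(1)] a(2) b(2) bfs_cmult(2)[OF g, of "of_real d"] d(1) by auto
    also have "\<dots> < e" using d2 n0[OF that] by simp
    finally show ?thesis .
  qed
  then show "\<exists>n0. \<forall>n\<ge>n0. norm (N (f n) - 0) < e" by auto
qed

section \<open>Norm closure of the trigonometric polynomials\<close>

definition approx :: "(complex \<Rightarrow> complex) \<Rightarrow> bool" where
  "approx f \<longleftrightarrow> f \<in> X \<and> (\<forall>e>0. \<exists>q. trig_poly q \<and> N (\<lambda>t. f t - q t) < e)"

lemma approx_trig_poly: "trig_poly q \<Longrightarrow> approx q"
  unfolding approx_def using bfs_zero by (auto intro!: bfs_trig_poly exI[of _ q])

lemma approx_limit:
  assumes "\<And>n. approx (f n)" "g \<in> X" "(\<lambda>n::nat. N (\<lambda>t. f n t - g t)) \<longlonglongrightarrow> 0"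
  shows "approx g"
  unfolding approx_def
proof (intro conjI allI impI assms)
  fix e :: real assume "0 < e"
  with LIMSEQ_D[OF assms(3), of "e / 2"] obtain n where n: "N (\<lambda>t. f n t - g t) < e / 2" by auto
  from assms(1)[of n] \<open>0 < e\<close> obtain q where q: "f n \<in> X" "trig_poly q" "N (\<lambda>t. f n t - q t) < e / 2"
    unfolding approx_def by (meson half_gt_zero)
  have "N (\<lambda>t. g t - q t) \<le> N (\<lambda>t. g t - f n t) + N (\<lambda>t. f n t - q t)"
    by (rule norm_triangle_diff[OF assms(2) q(1) bfs_trig_poly[OF q(2)]])
  with n q norm_minus_commute_bfs[of g "f n"] have "N (\<lambda>t. g t - q t) < e" by simp
  with q show "\<exists>q. trig_poly q \<and> N (\<lambda>t. g t - q t) < e" by blast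
qed

lemma approx_cmult:
  assumes "approx f"
  shows "approx (\<lambda>t. c * f t)"
  unfolding approx_def
proof (intro conjI allI impI)
  have f: "f \<in> X" using assms by (simp add: approx_def)
  then show "(\<lambda>t. c * f t) \<in> X" by (rule bfs_cmult)
  fix e :: real assume "0 < e"
  then have "0 < e / (cmod c + 1)" by (simp add: add_nonneg_pos)
  with assms obtain q where q: "trig_poly q" "N (\<lambda>t. f t - q t) < e / (cmod c + 1)"
    unfolding approx_def by blast
  have pos: "0 < cmod c + 1" by (simp add: add_nonneg_pos)
  have "N (\<lambda>t. c * f t - c * q t) = cmod c * N (\<lambda>t. f t - q t)"
    using bfs_cmult(2)[OF bfs_diff(1)[OF f bfs_trig_poly[OF q(1)]], of c] by (simp add: right_diff_distrib)
  also have "\<dots> \<le> (cmod c + 1) * N (\<lambda>t. f t - q t)" by (intro mult_right_mono) auto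
  also have "\<dots> < e" using q(2) pos by (simp add: field_simps)
  finally show "\<exists>q. trig_poly q \<and> N (\<lambda>t. c * f t - q t) < e"
    using trig_poly_cmult[OF q(1)] by blast
qed

lemma approx_add:
  assumes "approx f" "approx g"
  shows "approx (\<lambda>t. f t + g t)"
  unfolding approx_def
proof (intro conjI allI impI)
  have fg: "f \<in> X" "g \<in> X" using assms by (auto simp: approx_def)
  then show "(\<lambda>t. f t + g t) \<in> X" by (rule bfs_add)
  fix e :: real assume "0 < e"
  then have "0 < e / 2" by simp
  with assms obtain p q where q: "trig_poly p" "N (\<lambda>t. f t - p t) < e / 2" "trig_poly q" "N (\<lambda>t. g t - q t) < e / 2"
    unfolding approx_def by blast
  have "N (\<lambda>t. (f t - p t) + (g t - q t)) \<le> N (\<lambda>t. f t - p t) + N (\<lambda>t. g t - q t)"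
    by (rule bfs_add(2)[OF bfs_diff(1)[OF fg(1) bfs_trig_poly[OF q(1)]] bfs_diff(1)[OF fg(2) bfs_trig_poly[OF q(3)]]])
  with q have "N (\<lambda>t. f t + g t - (p t + q t)) < e" by (simp add: algebra_simps)
  with trig_poly.add[OF q(1,3)] show "\<exists>q. trig_poly q \<and> N (\<lambda>t. f t + g t - q t) < e" by blast
qed

lemma approx_sum: "finite I \<Longrightarrow> (\<And>i. i \<in> I \<Longrightarrow> approx (f i)) \<Longrightarrow> approx (\<lambda>t. \<Sum>i\<in>I. f i t)"
  by (induction I rule: finite_induct) (auto intro: approx_add approx_trig_poly trig_poly_const)

lemma approx_cong:
  assumes "approx f" "g \<in> borel_measurable circle" "AE t in circle. g t = f t"
  shows "approx g"
proof -
  have fX: "f \<in> X" using assms by (simp add: approx_def)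
  have gX: "g \<in> X" by (rule bfs_cong(1)[OF fX assms(2,3)])
  have "N (\<lambda>t. f t - g t) = 0"
    using assms(3) by (subst norm_eq_0_iff[OF bfs_diff(1)[OF fX gX]]) auto
  with approx_limit[of "\<lambda>_. f" g] assms(1) gX show ?thesis by simp
qed

lemma approx_dominated:
  assumes "bfs_separable \<rho>" "\<And>n. approx (f n)" "g \<in> X" "h \<in> X"
    "\<And>n t. t \<in> sphere 0 1 \<Longrightarrow> cmod (f n t - g t) \<le> cmod (h t)"
    "\<And>t. t \<in> sphere 0 1 \<Longrightarrow> (\<lambda>n::nat. f n t) \<longlonglongrightarrow> g t"
  shows "approx g"
proof (rule approx_limit[OF assms(2,3)])
  have "(\<lambda>t. f n t - g t) \<in> borel_measurable circle" for n
    using assms(2)[of n] assms(3) by (intro borel_measurable_diff bfs_measurable) (auto simp: approx_def)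
  then show "(\<lambda>n. N (\<lambda>t. f n t - g t)) \<longlonglongrightarrow> 0"
    using assms by (intro dominated_convergence_bfs[OF assms(1,4)]) (auto simp: LIM_zero_iff)
qed

text \<open>The route is that of \<open>fourier_unique_zero\<close>, with convergence in
  \<open>X\<close> in place of convergence of integrals; separability enters through
  \<open>approx_dominated\<close>. For closed sets the dominating constant 3 is 2 for the
  polynomials plus 1 for the indicator.\<close>

lemma approx_indicator:
  assumes sep: "bfs_separable \<rho>" and "E \<in> sets circle"
  shows "approx (indicator E)"
  using assms(2)
proof (induction rule: sets_circle_induct)
  case (closed C)
  from trig_poly_approx_indicator[OF closed(1)] obtain q where
    q: "\<And>n. trig_poly (q n)" "\<And>n t. t \<in> sphere 0 1 \<Longrightarrow> cmod (q n t) \<le> 2"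
       "\<And>t. t \<in> sphere 0 1 \<Longrightarrow> (\<lambda>n. q n t) \<longlonglongrightarrow> indicator C t" by blast
  show ?case
  proof (rule approx_dominated[OF sep approx_trig_poly[OF q(1)], where h = "\<lambda>t. 3"])
    show "indicator C \<in> X"
      using closed(1) by (intro bfs_bounded[of _ 1] measurable_circle) (auto split: split_indicator)
    show "(\<lambda>t. 3) \<in> X" by (intro bfs_bounded[of _ 3]) auto
    show "cmod (q n t - indicator C t) \<le> cmod 3" if "t \<in> sphere 0 1" for n t
      using norm_triangle_ineq4[of "q n t" "indicator C t"] q(2)[OF that, of n] by (auto split: split_indicator_asm)
  qed (use q in auto)
next
  case (compl E)
  have "approx (\<lambda>t. 1 + (-1) * indicator E t)"
    by (intro approx_add approx_cmult compl approx_trig_poly trig_poly_const)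
  then show ?case
    by (rule approx_cong)
       (use compl sets.compl_sets[OF compl(1)] in \<open>auto split: split_indicator intro!: borel_measurable_indicator\<close>)
next
  case (union A)
  have U: "(\<Union>i<n. A i) \<in> sets circle" for n :: nat using union by auto
  have U': "(\<Union>i. A i) \<in> sets circle" using union by auto
  show ?case
  proof (rule approx_dominated[OF sep, where h = "\<lambda>t. 1" and f = "\<lambda>n. indicator (\<Union>i<n. A i)"])
    fix n :: nat
    have "approx (\<lambda>t. \<Sum>i<n. indicator (A i) t)" by (intro approx_sum union) auto
    then show "approx (indicator (\<Union>i<n. A i))"
    proof (rule approx_cong)
      have "indicator (\<Union>i<n. A i) t = (\<Sum>i<n. indicator (A i) t :: complex)" for t
        using union(1) by (intro indicator_UN_disjoint) (auto intro: disjoint_family_on_mono)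
      then show "AE t in circle. indicator (\<Union>i<n. A i) t = (\<Sum>i<n. indicator (A i) t :: complex)" by simp
    qed (use U in auto)
  next
    show "indicator (\<Union>i. A i) \<in> X"
      using U' by (intro bfs_bounded[of _ 1]) (auto split: split_indicator)
    show "(\<lambda>t. 1) \<in> X" by (intro bfs_bounded[of _ 1]) auto
    show "(\<lambda>n. indicator (\<Union>i<n. A i) t) \<longlonglongrightarrow> (indicator (\<Union>i. A i) t :: complex)" for t
      by (rule LIMSEQ_indicator_UN)
  qed (auto split: split_indicator)
next
  case (cong E F)
  have "AE t in circle. indicator F t = (indicator E t :: complex)"
    using cong(3) by eventually_elim (simp add: indicator_def)
  then show ?case
    by (rule approx_cong[OF cong.IH borel_measurable_indicator[OF cong.hyps(2)]])
qed

text \<open>Simple functions \<open>s i\<close> tend to f pointwise with |s i| <= 2 |f|, so 3 |f|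
  dominates the error.\<close>

lemma trig_poly_dense:
  assumes sep: "bfs_separable \<rho>" and f: "f \<in> X"
  shows "approx f"
proof -
  have fm: "f \<in> borel_measurable circle" using f by (rule bfs_measurable)
  from borel_measurable_implies_sequence_metric[OF fm, of 0] obtain s where
    s: "\<forall>i. simple_function circle (s i)"
       "\<forall>x\<in>space circle. (\<lambda>i. s i x) \<longlonglongrightarrow> f x"
       "\<forall>i. \<forall>x\<in>space circle. cmod (s i x) \<le> 2 * cmod (f x)"
    by auto
  show ?thesis
  proof (rule approx_dominated[OF sep _ f, where f = s and h = "\<lambda>t. 3 * f t"])
    fix i
    have fin: "finite (s i ` space circle)" and sm: "\<And>y. y \<in> s i ` space circle \<Longrightarrow> s i -` {y} \<inter> space circle \<in> sets circle"
      using s(1) by (auto simp: simple_function_def)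
    have "approx (\<lambda>t. \<Sum>y\<in>s i ` space circle. y * indicator (s i -` {y} \<inter> space circle) t)"
      by (intro approx_sum[OF fin] approx_cmult approx_indicator[OF sep] sm)
    then show "approx (s i)"
    proof (rule approx_cong)
      show "s i \<in> borel_measurable circle" using s(1) by (blast intro: borel_measurable_simple_function)
      show "AE t in circle. s i t = (\<Sum>y\<in>s i ` space circle. y * indicator (s i -` {y} \<inter> space circle) t)"
      proof (rule AE_I2)
        fix t assume t: "t \<in> space circle"
        have "(\<Sum>y\<in>s i ` space circle. y * indicator (s i -` {y} \<inter> space circle) t) =
              (\<Sum>y\<in>s i ` space circle. if y = s i t then s i t else 0)"
          using t by (intro sum.cong) (auto split: split_indicator)
        also have "\<dots> = s i t" using t fin by simp
        finally show "s i t = (\<Sum>y\<in>s i ` space circle. y * indicator (s i -` {y} \<inter> space circle) t)" by simp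
      qed
    qed
  next
    show "(\<lambda>t. 3 * f t) \<in> X" by (rule bfs_cmult[OF f])
    show "cmod (s n t - f t) \<le> cmod (3 * f t)" if "t \<in> sphere 0 1" for n t
    proof -
      have "cmod (s n t) \<le> 2 * cmod (f t)" using s(3) that by simp
      then show ?thesis using norm_triangle_ineq4[of "s n t" "f t"] by (simp add: norm_mult)
    qed
    show "(\<lambda>n. s n t) \<longlonglongrightarrow> f t" if "t \<in> sphere 0 1" for t
      using s(2) that by simp
  qed
qed

lemma trig_poly_sequence:
  assumes sep: "bfs_separable \<rho>" and f: "f \<in> X"
  obtains q where "\<And>j::nat. trig_poly (q j)" "(\<lambda>j. N (\<lambda>t. q j t - f t)) \<longlonglongrightarrow> 0"
proof -
  have "\<exists>q. trig_poly q \<and> N (\<lambda>t. f t - q t) < 1 / Suc j" for j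
    using trig_poly_dense[OF assms] unfolding approx_def by simp
  then obtain q where q: "\<And>j. trig_poly (q j)" "\<And>j. N (\<lambda>t. f t - q j t) < 1 / Suc j" by metis
  have "(\<lambda>j. N (\<lambda>t. q j t - f t)) \<longlonglongrightarrow> 0"
  proof (rule tendsto_sandwich[OF _ _ tendsto_const])
    show "\<forall>\<^sub>F j in sequentially. N (\<lambda>t. q j t - f t) \<le> 1 / Suc j"
      using q(2) norm_minus_commute_bfs[of f] by (auto intro!: always_eventually less_imp_le)
    show "(\<lambda>j. 1 / real (Suc j)) \<longlonglongrightarrow> 0" by (rule LIMSEQ_Suc, rule lim_const_over_n)
  qed auto
  with q(1) that show ?thesis by blast
qed

end

section \<open>Bounded operators and the Riesz projection\<close>

context bfn
begin

text \<open>Treats \<open>X\<close> and the Hardy space at once, so that facts about operators are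
  proved once for both.\<close>

definition lin_space :: "(complex \<Rightarrow> complex) set \<Rightarrow> bool" where
  "lin_space E \<longleftrightarrow> E \<subseteq> X \<and> (\<lambda>t. 0) \<in> E \<and> (\<forall>f\<in>E. \<forall>g\<in>E. (\<lambda>t. f t + g t) \<in> E) \<and>
     (\<forall>f\<in>E. \<forall>c. (\<lambda>t. c * f t) \<in> E)"

lemma lin_spaceD:
  assumes "lin_space E"
  shows "f \<in> E \<Longrightarrow> f \<in> X" "(\<lambda>t. 0) \<in> E" "f \<in> E \<Longrightarrow> g \<in> E \<Longrightarrow> (\<lambda>t. f t + g t) \<in> E"
    "f \<in> E \<Longrightarrow> (\<lambda>t. c * f t) \<in> E" "f \<in> E \<Longrightarrow> g \<in> E \<Longrightarrow> (\<lambda>t. f t - g t) \<in> E"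
proof -
  show *: "f \<in> E \<Longrightarrow> f \<in> X" "(\<lambda>t. 0) \<in> E" "f \<in> E \<Longrightarrow> g \<in> E \<Longrightarrow> (\<lambda>t. f t + g t) \<in> E"
    "f \<in> E \<Longrightarrow> (\<lambda>t. c * f t) \<in> E" for f g c
    using assms unfolding lin_space_def by auto
  show "f \<in> E \<Longrightarrow> g \<in> E \<Longrightarrow> (\<lambda>t. f t - g t) \<in> E"
    using *(3)[OF _ *(4)[of g "-1"], of f] by simp
qed

lemma lin_space_sum: "lin_space E \<Longrightarrow> (\<And>i. i \<in> I \<Longrightarrow> f i \<in> E) \<Longrightarrow> (\<lambda>t. \<Sum>i\<in>I. f i t) \<in> E"
  by (induction I rule: infinite_finite_induct) (auto simp: lin_spaceD(2) intro: lin_spaceD(3))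

lemma lin_space_bfs: "lin_space X"
  unfolding lin_space_def using bfs_zero bfs_add bfs_cmult by blast

lemma hardyD: "f \<in> hardy_space \<rho> \<Longrightarrow> f \<in> X" "f \<in> hardy_space \<rho> \<Longrightarrow> n < 0 \<Longrightarrow> fourier_coeff f n = 0"
  by (auto simp: hardy_space_def)

lemma lin_space_hardy: "lin_space (hardy_space \<rho>)"
  unfolding lin_space_def hardy_space_def
  by (auto simp: fourier_coeff_add fourier_coeff_cmult bfs_integrable bfs_zero fourier_coeff_zero
      intro: bfs_add bfs_cmult)

lemma bounded_operatorD:
  assumes "bounded_operator E N T"
  shows "f \<in> E \<Longrightarrow> T f \<in> E"
    "f \<in> E \<Longrightarrow> g \<in> E \<Longrightarrow> AE t in circle. T (\<lambda>s. f s + g s) t = T f t + T g t"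
    "f \<in> E \<Longrightarrow> AE t in circle. T (\<lambda>s. c * f s) t = c * T f t"
  using assms unfolding bounded_operator_def by auto

text \<open>A real supremum bounds its members only over a bounded set; the constant C of
  \<open>bounded_operator\<close> supplies boundedness, and it carries no sign, hence |C|. Functions
  with \<open>N f = 0\<close> cannot be normalized and are covered by C directly.\<close>

lemma operator_norm_nonneg_bound:
  assumes E: "lin_space E" and T: "bounded_operator E N T"
  shows "0 \<le> operator_norm E N T" "f \<in> E \<Longrightarrow> N (T f) \<le> operator_norm E N T * N f"
proof -
  from T obtain C where C: "\<And>f. f \<in> E \<Longrightarrow> N (T f) \<le> C * N f"
    unfolding bounded_operator_def by blast
  have bdd: "bdd_above ((\<lambda>f. N (T f)) ` {f \<in> E. N f \<le> 1})"
  proof (rule bdd_aboveI2)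
    fix f assume "f \<in> {f \<in> E. N f \<le> 1}"
    then have "N (T f) \<le> C * N f" "N f \<le> 1" using C by auto
    moreover have "C * N f \<le> \<bar>C\<bar> * 1" using \<open>N f \<le> 1\<close> by (intro mult_mono) auto
    ultimately show "N (T f) \<le> \<bar>C\<bar>" by simp
  qed
  have le: "N (T f) \<le> operator_norm E N T" if "f \<in> E" "N f \<le> 1" for f
    unfolding operator_norm_def using that by (intro cSUP_upper[OF _ bdd]) auto
  show "0 \<le> operator_norm E N T"
    using le[OF lin_spaceD(2)[OF E]] bfs_zero(2) norm_nonneg order_trans by (metis zero_le_one)
  show "N (T f) \<le> operator_norm E N T * N f" if f: "f \<in> E"
  proof (cases "N f = 0")
    case True
    with C[OF f] show ?thesis by simp
  next
    case False
    then have pos: "0 < N f" using norm_nonneg[of f] by linarith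
    let ?c = "complex_of_real (1 / N f)"
    have "N (\<lambda>t. ?c * f t) = 1"
      using bfs_cmult(2)[OF lin_spaceD(1)[OF E f], of ?c] pos by (simp add: norm_divide)
    then have "N (T (\<lambda>t. ?c * f t)) \<le> operator_norm E N T"
      by (intro le lin_spaceD(4)[OF E f]) simp
    moreover have "N (T (\<lambda>t. ?c * f t)) = N (\<lambda>t. ?c * T f t)"
    proof (rule bfs_cong(2))
      have Tf: "T f \<in> E" by (rule bounded_operatorD(1)[OF T f])
      show "(\<lambda>t. ?c * T f t) \<in> X" by (rule lin_spaceD(1)[OF E lin_spaceD(4)[OF E Tf]])
      show "T (\<lambda>t. ?c * f t) \<in> borel_measurable circle"
        by (rule bfs_measurable[OF lin_spaceD(1)[OF E bounded_operatorD(1)[OF T lin_spaceD(4)[OF E f]]]])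
      show "AE t in circle. T (\<lambda>t. ?c * f t) t = ?c * T f t" by (rule bounded_operatorD(3)[OF T f])
    qed
    moreover have "N (\<lambda>t. ?c * T f t) = N (T f) / N f"
      using bfs_cmult(2)[OF lin_spaceD(1)[OF E bounded_operatorD(1)[OF T f]], of ?c] pos
      by (simp add: norm_divide)
    ultimately have "N (T f) / N f \<le> operator_norm E N T" by simp
    then show ?thesis using pos by (simp add: pos_divide_le_eq)
  qed
qed

lemma operator_norm_le:
  assumes E: "lin_space E" and "\<And>f. f \<in> E \<Longrightarrow> N (T f) \<le> C * N f" "0 \<le> C"
  shows "operator_norm E N T \<le> C"
  unfolding operator_norm_def
proof (rule cSUP_least)
  show "{f \<in> E. N f \<le> 1} \<noteq> {}" using lin_spaceD(2)[OF E] bfs_zero(2) by force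
  fix f assume f: "f \<in> {f \<in> E. N f \<le> 1}"
  then have "C * N f \<le> C * 1" using assms(3) by (intro mult_left_mono) auto
  with assms(2)[of f] f show "N (T f) \<le> C" by simp
qed

lemma bounded_operator_diff:
  assumes E: "lin_space E" and T: "bounded_operator E N T" and fg: "f \<in> E" "g \<in> E"
  shows "AE t in circle. T (\<lambda>s. f s - g s) t = T f t - T g t"
    "N (\<lambda>t. T f t - T g t) \<le> operator_norm E N T * N (\<lambda>t. f t - g t)"
proof -
  have g': "(\<lambda>s. (-1) * g s) \<in> E" by (rule lin_spaceD(4)[OF E fg(2)])
  show *: "AE t in circle. T (\<lambda>s. f s - g s) t = T f t - T g t"
    using bounded_operatorD(2)[OF T fg(1) g'] bounded_operatorD(3)[OF T fg(2), of "-1"]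
    by eventually_elim simp
  have d: "(\<lambda>s. f s - g s) \<in> E" by (rule lin_spaceD(5)[OF E fg])
  have d': "(\<lambda>s. T f s - T g s) \<in> E" by (rule lin_spaceD(5)[OF E]) (rule bounded_operatorD(1)[OF T] fg)+
  have "N (T (\<lambda>s. f s - g s)) = N (\<lambda>t. T f t - T g t)"
    using * by (intro bfs_cong(2) bfs_measurable)
      (use lin_spaceD(1)[OF E] d' bounded_operatorD(1)[OF T d] in auto)
  with operator_norm_nonneg_bound(2)[OF E T d]
  show "N (\<lambda>t. T f t - T g t) \<le> operator_norm E N T * N (\<lambda>t. f t - g t)" by simp
qed

text \<open>Operators act on functions, not on classes; that they respect equality almost everywhere
  follows from boundedness, since the difference of f and g has norm 0.\<close>

lemma bounded_operator_cong:
  assumes E: "lin_space E" and T: "bounded_operator E N T" and fg: "f \<in> E" "g \<in> E"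
    and eq: "AE t in circle. f t = g t"
  shows "AE t in circle. T f t = T g t"
proof -
  have "N (\<lambda>t. f t - g t) = 0"
    using eq by (subst norm_eq_0_iff[OF lin_spaceD(1)[OF E lin_spaceD(5)[OF E fg]]]) auto
  then have "N (\<lambda>t. T f t - T g t) = 0"
    using bounded_operator_diff(2)[OF E T fg] norm_nonneg[of "\<lambda>t. T f t - T g t"] by simp
  moreover have "(\<lambda>s. T f s - T g s) \<in> X"
    by (rule lin_spaceD(1)[OF E lin_spaceD(5)[OF E]]) (rule bounded_operatorD(1)[OF T] fg)+
  ultimately show ?thesis by (simp add: norm_eq_0_iff)
qed

lemma bounded_operator_sum:
  assumes E: "lin_space E" and T: "bounded_operator E N T" and "finite I" "\<And>i. i \<in> I \<Longrightarrow> f i \<in> E"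
  shows "AE t in circle. T (\<lambda>s. \<Sum>i\<in>I. c i * f i s) t = (\<Sum>i\<in>I. c i * T (f i) t)"
  using assms(3,4)
proof (induction I rule: finite_induct)
  case empty
  show ?case using bounded_operatorD(3)[OF T lin_spaceD(2)[OF E], of 0] by simp
next
  case (insert i I)
  have "(\<lambda>s. \<Sum>i\<in>I. c i * f i s) \<in> E"
    using insert by (intro lin_space_sum[OF E] lin_spaceD(4)[OF E]) auto
  moreover have "(\<lambda>s. c i * f i s) \<in> E" using insert by (intro lin_spaceD(4)[OF E]) auto
  ultimately have "AE t in circle. T (\<lambda>s. c i * f i s + (\<Sum>i\<in>I. c i * f i s)) t = T (\<lambda>s. c i * f i s) t + T (\<lambda>s. \<Sum>i\<in>I. c i * f i s) t"
    by (intro bounded_operatorD(2)[OF T])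
  moreover have "AE t in circle. T (\<lambda>s. c i * f i s) t = c i * T (f i) t"
    using insert by (intro bounded_operatorD(3)[OF T]) auto
  moreover have "AE t in circle. T (\<lambda>s. \<Sum>i\<in>I. c i * f i s) t = (\<Sum>i\<in>I. c i * T (f i) t)"
    using insert by auto
  ultimately show ?case
    by eventually_elim (use insert in simp)
qed

lemma chi_hardy: "0 \<le> n \<Longrightarrow> chi n \<in> hardy_space \<rho>"
  by (auto simp: hardy_space_def fourier_coeff_chi intro!: bfs_trig_poly trig_poly_chi)

lemma chi_mult_bfs:
  assumes "f \<in> X"
  shows "(\<lambda>t. chi n t * f t) \<in> X" "N (\<lambda>t. chi n t * f t) = N f"
proof -
  have m: "(\<lambda>t. chi n t * f t) \<in> borel_measurable circle"
    using bfs_measurable[OF assms] by (intro borel_measurable_times) auto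
  show *: "(\<lambda>t. chi n t * f t) \<in> X"
    using m by (intro bfs_dominated(1)[OF assms]) (auto simp: norm_mult)
  show "N (\<lambda>t. chi n t * f t) = N f"
    using m bfs_measurable[OF assms]
    by (intro antisym bfs_dominated(2)[OF assms] bfs_dominated(2)[OF *]) (auto simp: norm_mult)
qed

end

section \<open>The Riesz projection as truncation of Fourier series\<close>

locale bfn_riesz = bfn +
  assumes sep: "bfs_separable \<rho>" and riesz_bounded: "bounded_operator (bfs \<rho>) (bfs_norm \<rho>) riesz"
begin

abbreviation H where "H \<equiv> hardy_space \<rho>"

lemma riesz_bfs: "f \<in> X \<Longrightarrow> riesz f \<in> X"
  using bounded_operatorD(1)[OF riesz_bounded] .

text \<open>Linearity almost everywhere reduces the claim to characters. The expansion of p holds on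
  the circle only, so \<open>bounded_operator_cong\<close> is applied before the sum is taken
  apart.\<close>

lemma fourier_coeff_riesz_trig_poly:
  assumes p: "trig_poly p"
  shows "fourier_coeff (riesz p) n = (if 0 \<le> n then fourier_coeff p n else 0)"
proof -
  from trig_poly_expand[OF p] obtain M :: nat where M:
    "\<And>t. t \<in> sphere 0 1 \<Longrightarrow> p t = (\<Sum>k\<in>{-int M..int M}. fourier_coeff p k * chi k t)"
    "\<And>k. \<bar>k\<bar> > int M \<Longrightarrow> fourier_coeff p k = 0" by blast
  let ?s = "\<lambda>t. \<Sum>k\<in>{-int M..int M}. fourier_coeff p k * chi k t"
  have c: "chi k \<in> X" for k by (intro bfs_trig_poly trig_poly_chi)
  have s: "?s \<in> X" by (intro bfs_trig_poly trig_poly_sum trig_poly_cmult trig_poly_chi)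
  have "AE t in circle. riesz p t = riesz ?s t"
    using M(1) by (intro bounded_operator_cong[OF lin_space_bfs riesz_bounded bfs_trig_poly[OF p] s] AE_I2) simp
  moreover have "AE t in circle. riesz ?s t = (\<Sum>k\<in>{-int M..int M}. fourier_coeff p k * riesz (chi k) t)"
    by (intro bounded_operator_sum[OF lin_space_bfs riesz_bounded] c) auto
  ultimately have "AE t in circle. riesz p t =
      (\<Sum>k\<in>{-int M..int M}. (if 0 \<le> k then fourier_coeff p k else 0) * chi k t)"
    using AE_space
  proof eventually_elim
    case (elim t)
    then show ?case by (auto simp: riesz_chi intro!: sum.cong)
  qed
  then have "fourier_coeff (riesz p) n = fourier_coeff (\<lambda>t. \<Sum>k\<in>{-int M..int M}. (if 0 \<le> k then fourier_coeff p k else 0) * chi k t) n"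
    by (rule fourier_coeff_cong_AE)
       (intro bfs_measurable riesz_bfs bfs_trig_poly p trig_poly_sum trig_poly_cmult trig_poly_chi)+
  also have "\<dots> = (\<Sum>k\<in>{-int M..int M}. if k = n then (if 0 \<le> k then fourier_coeff p k else 0) else 0)"
    by (subst fourier_coeff_sum) (auto simp: fourier_coeff_cmult fourier_coeff_chi intro!: sum.cong)
  also have "\<dots> = (if 0 \<le> n then fourier_coeff p n else 0)" using M(2)[of n] by (auto simp: abs_le_iff)
  finally show ?thesis .
qed

lemma riesz_tendsto:
  assumes "\<And>j::nat. f j \<in> X" "g \<in> X" "(\<lambda>j. N (\<lambda>t. f j t - g t)) \<longlonglongrightarrow> 0"
  shows "(\<lambda>j. N (\<lambda>t. riesz (f j) t - riesz g t)) \<longlonglongrightarrow> 0"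
proof (rule tendsto_sandwich[OF _ _ tendsto_const])
  show "\<forall>\<^sub>F j in sequentially. N (\<lambda>t. riesz (f j) t - riesz g t) \<le> operator_norm X N riesz * N (\<lambda>t. f j t - g t)"
    using assms by (intro always_eventually allI bounded_operator_diff[OF lin_space_bfs riesz_bounded])
  show "(\<lambda>j. operator_norm X N riesz * N (\<lambda>t. f j t - g t)) \<longlonglongrightarrow> 0"
    using assms(3) by (rule tendsto_mult_right_zero)
qed auto

text \<open>Both sides depend continuously on f in the norm of \<open>X\<close>, and trigonometric
  polynomials are dense.\<close>

lemma fourier_coeff_riesz:
  assumes f: "f \<in> X"
  shows "fourier_coeff (riesz f) n = (if 0 \<le> n then fourier_coeff f n else 0)"
proof -
  from trig_poly_sequence[OF sep f] obtain q where q: "\<And>j::nat. trig_poly (q j)" "(\<lambda>j. N (\<lambda>t. q j t - f t)) \<longlonglongrightarrow> 0"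
    by blast
  have qX: "q j \<in> X" for j by (intro bfs_trig_poly q)
  have "(\<lambda>j. fourier_coeff (riesz (q j)) n) \<longlonglongrightarrow> fourier_coeff (riesz f) n"
    by (rule fourier_coeff_bfs_tendsto[OF _ _ riesz_tendsto]) (intro riesz_bfs qX f q)+
  moreover have "(\<lambda>j. fourier_coeff (riesz (q j)) n) \<longlonglongrightarrow> (if 0 \<le> n then fourier_coeff f n else 0)"
    using fourier_coeff_bfs_tendsto[OF qX f q(2), of n] by (simp add: fourier_coeff_riesz_trig_poly[OF q(1)])
  ultimately show ?thesis by (rule LIMSEQ_unique)
qed

lemma riesz_hardy: "f \<in> X \<Longrightarrow> riesz f \<in> H"
  by (simp add: hardy_space_def riesz_bfs fourier_coeff_riesz)

lemma riesz_hardy_eq: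
  assumes "f \<in> H"
  shows "AE t in circle. riesz f t = f t"
  using hardyD[OF assms]
  by (intro fourier_unique bfs_integrable riesz_bfs) (auto simp: fourier_coeff_riesz)

end

section \<open>Minimizing the entropy\<close>

text \<open>Completeness of L^1 with both modes of convergence along one subsequence: convergence in
  mean determines Fourier coefficients, convergence almost everywhere feeds the Fatou property of
  \<open>\<rho>\<close>. Increments along r are below (1/2)^k in mean, hence summable almost
  everywhere.\<close>

lemma L1_Cauchy_limit:
  fixes f :: "nat \<Rightarrow> 'a \<Rightarrow> complex"
  assumes int: "\<And>n. integrable M (f n)"
    and cauchy: "\<And>e. 0 < e \<Longrightarrow> \<exists>n0. \<forall>m\<ge>n0. \<forall>n\<ge>n0. (\<integral>t. cmod (f m t - f n t) \<partial>M) < e"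
  obtains g r where "integrable M g" "strict_mono r" "AE t in M. (\<lambda>k. f (r k) t) \<longlonglongrightarrow> g t"
    "(\<lambda>k. \<integral>t. cmod (f (r k) t - g t) \<partial>M) \<longlonglongrightarrow> 0"
proof -
  have "\<exists>r. \<forall>k. (\<forall>m\<ge>r k. \<forall>n\<ge>r k. (\<integral>t. cmod (f m t - f n t) \<partial>M) < (1/2)^k) \<and> r k < r (Suc k)"
  proof (rule dependent_nat_choice)
    show "\<exists>x. \<forall>m\<ge>x. \<forall>n\<ge>x. (\<integral>t. cmod (f m t - f n t) \<partial>M) < (1/2)^0"
      using cauchy[of "(1/2)^0"] by simp
    fix x k
    from cauchy[of "(1/2)^Suc k"] obtain n0 where
      "\<forall>m\<ge>n0. \<forall>n\<ge>n0. (\<integral>t. cmod (f m t - f n t) \<partial>M) < (1/2)^Suc k" by auto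
    then show "\<exists>y. (\<forall>m\<ge>y. \<forall>n\<ge>y. (\<integral>t. cmod (f m t - f n t) \<partial>M) < (1/2)^Suc k) \<and> x < y"
      by (intro exI[of _ "max n0 (Suc x)"]) auto
  qed
  then obtain r where r: "\<And>k m n. m \<ge> r k \<Longrightarrow> n \<ge> r k \<Longrightarrow> (\<integral>t. cmod (f m t - f n t) \<partial>M) < (1/2)^k"
    "\<And>k. r k < r (Suc k)" by blast
  have mono: "strict_mono r" by (rule strict_monoI_Suc) (rule r)
  have meas [measurable]: "f n \<in> borel_measurable M" for n using int by auto
  define d where "d k t = cmod (f (r (Suc k)) t - f (r k) t)" for k t
  have dm [measurable]: "d k \<in> borel_measurable M" for k unfolding d_def by measurable
  have nn: "(\<integral>\<^sup>+t. ennreal (cmod (f m t - f n t)) \<partial>M) = ennreal (\<integral>t. cmod (f m t - f n t) \<partial>M)" for m n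
    using int by (intro nn_integral_eq_integral) auto
  have "(\<integral>\<^sup>+t. (\<Sum>k. ennreal (d k t)) \<partial>M) = (\<Sum>k. \<integral>\<^sup>+t. ennreal (d k t) \<partial>M)"
    by (rule nn_integral_suminf) measurable
  also have "\<dots> \<le> (\<Sum>k. ennreal ((1/2)^k))"
  proof (rule suminf_le)
    fix k
    have "(\<integral>t. cmod (f (r (Suc k)) t - f (r k) t) \<partial>M) \<le> (1/2)^k"
      using r(1)[of k "r (Suc k)" "r k"] r(2)[of k] by simp
    then show "(\<integral>\<^sup>+t. ennreal (d k t) \<partial>M) \<le> ennreal ((1/2)^k)"
      unfolding d_def nn by (rule ennreal_leI)
  qed auto
  also have "\<dots> = ennreal (\<Sum>k. (1/2)^k)" by (rule suminf_ennreal2) (auto intro: summable_geometric)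
  also have "\<dots> < \<infinity>" by simp
  finally have "(\<integral>\<^sup>+t. (\<Sum>k. ennreal (d k t)) \<partial>M) \<noteq> \<infinity>" by simp
  then have "AE t in M. (\<Sum>k. ennreal (d k t)) \<noteq> \<infinity>"
    by (intro nn_integral_PInf_AE) measurable
  then have conv: "AE t in M. convergent (\<lambda>k. f (r k) t)"
  proof eventually_elim
    case (elim t)
    have "summable (\<lambda>k. d k t)" by (rule summable_suminf_not_top) (use elim in \<open>auto simp: d_def\<close>)
    then have "summable (\<lambda>k. f (r (Suc k)) t - f (r k) t)"
      unfolding d_def by (rule summable_norm_cancel)
    then have "(\<lambda>n. \<Sum>k<n. f (r (Suc k)) t - f (r k) t) \<longlonglongrightarrow> (\<Sum>k. f (r (Suc k)) t - f (r k) t)"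
      by (rule summable_LIMSEQ)
    then have "(\<lambda>n. f (r n) t - f (r 0) t) \<longlonglongrightarrow> (\<Sum>k. f (r (Suc k)) t - f (r k) t)"
      unfolding sum_lessThan_telescope[of "\<lambda>k. f (r k) t"] .
    from tendsto_add[OF this tendsto_const[of "f (r 0) t"]] show ?case
      by (auto simp: convergent_def)
  qed
  define g where "g t = lim (\<lambda>k. f (r k) t)" for t
  have gm [measurable]: "g \<in> borel_measurable M" unfolding g_def by measurable
  have lim: "AE t in M. (\<lambda>k. f (r k) t) \<longlonglongrightarrow> g t"
    using conv by eventually_elim (simp add: g_def convergent_LIMSEQ_iff)
  have le: "(\<integral>\<^sup>+t. ennreal (cmod (f (r k) t - g t)) \<partial>M) \<le> ennreal ((1/2)^k)" for k
  proof -
    have "(\<integral>\<^sup>+t. ennreal (cmod (f (r k) t - g t)) \<partial>M) =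
        (\<integral>\<^sup>+t. liminf (\<lambda>j. ennreal (cmod (f (r k) t - f (r j) t))) \<partial>M)"
    proof (rule nn_integral_cong_AE)
      show "AE t in M. ennreal (cmod (f (r k) t - g t)) = liminf (\<lambda>j. ennreal (cmod (f (r k) t - f (r j) t)))"
        using lim
      proof eventually_elim
        case (elim t)
        have "(\<lambda>j. ennreal (cmod (f (r k) t - f (r j) t))) \<longlonglongrightarrow> ennreal (cmod (f (r k) t - g t))"
          by (intro tendsto_intros elim)
        then show ?case by (intro lim_imp_Liminf[symmetric]) auto
      qed
    qed
    also have "\<dots> \<le> liminf (\<lambda>j. \<integral>\<^sup>+t. ennreal (cmod (f (r k) t - f (r j) t)) \<partial>M)"
      by (rule nn_integral_liminf) measurable
    also have "\<dots> \<le> ennreal ((1/2)^k)"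
    proof (rule Liminf_le)
      show "\<forall>\<^sub>F j in sequentially. (\<integral>\<^sup>+t. ennreal (cmod (f (r k) t - f (r j) t)) \<partial>M) \<le> ennreal ((1/2)^k)"
        using eventually_ge_at_top[of k]
      proof eventually_elim
        case (elim j)
        have "(\<integral>t. cmod (f (r k) t - f (r j) t) \<partial>M) < (1/2)^k"
          using elim mono by (intro r) (auto simp: strict_mono_less_eq)
        then show ?case unfolding nn by (intro ennreal_leI) simp
      qed
    qed simp
    finally show ?thesis .
  qed
  have int': "integrable M (\<lambda>t. f (r k) t - g t)" for k
    using le[of k] by (intro integrableI_bounded) (auto intro: le_less_trans)
  have "integrable M (\<lambda>t. f (r 0) t - (f (r 0) t - g t))"
    by (intro Bochner_Integration.integrable_diff int int')
  then have g: "integrable M g" by simp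
  have "(\<lambda>k. \<integral>t. cmod (f (r k) t - g t) \<partial>M) \<longlonglongrightarrow> 0"
  proof (rule tendsto_sandwich[OF _ _ tendsto_const])
    show "\<forall>\<^sub>F k in sequentially. (\<integral>t. cmod (f (r k) t - g t) \<partial>M) \<le> (1/2)^k"
    proof (intro always_eventually allI)
      fix k
      have "ennreal (\<integral>t. cmod (f (r k) t - g t) \<partial>M) \<le> ennreal ((1/2)^k)"
        using le[of k] int'[of k] by (subst nn_integral_eq_integral[symmetric]) auto
      then show "(\<integral>t. cmod (f (r k) t - g t) \<partial>M) \<le> (1/2)^k" by (subst (asm) ennreal_le_iff) auto
    qed
    show "(\<lambda>k. (1/2::real)^k) \<longlonglongrightarrow> 0" by (intro LIMSEQ_power_zero) simp
  qed (auto intro!: always_eventually)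
  with that[OF g mono lim] show ?thesis .
qed

text \<open>The primitive of \<open>arsinh\<close> that vanishes at 0: an even, smooth substitute
  for |x| ln |x| with second derivative 1 / sqrt(x^2 + 1), hence strictly convex and of L log L
  growth.\<close>

definition entropy_fun :: "real \<Rightarrow> real" where
  "entropy_fun x = x * arsinh x - sqrt (x\<^sup>2 + 1) + 1"

lemma entropy_fun_deriv: "(entropy_fun has_real_derivative arsinh x) (at x)"
proof -
  have "0 < x\<^sup>2 + 1" by (simp add: add_nonneg_pos)
  then show ?thesis
    unfolding entropy_fun_def by (auto intro!: derivative_eq_intros simp: divide_simps)
qed

text \<open>On [-R, R] the second derivative is at least 1 / sqrt(R^2 + 1) >= 1 / (1 + R) = k, so
  subtracting k z^2 / 2 leaves a convex function. Its midpoint inequality and the parallelogram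
  identity give the surplus k (x - y)^2 / 4.\<close>

lemma entropy_fun_gap:
  "(x - y)\<^sup>2 / (4 * (1 + \<bar>x\<bar> + \<bar>y\<bar>)) \<le> entropy_fun x + entropy_fun y - 2 * entropy_fun ((x + y) / 2)"
proof -
  define R where "R = \<bar>x\<bar> + \<bar>y\<bar>"
  have R: "0 \<le> R" by (simp add: R_def)
  define k where "k = 1 / (1 + R)"
  define h where "h z = entropy_fun z - k / 2 * z\<^sup>2" for z
  have "convex_on {-R..R} h"
  proof (rule f''_ge0_imp_convex)
    show "(h has_real_derivative arsinh z - k * z) (at z)" for z
      unfolding h_def by (auto intro!: derivative_eq_intros entropy_fun_deriv)
    show "((\<lambda>z. arsinh z - k * z) has_real_derivative 1 / sqrt (z\<^sup>2 + 1) - k) (at z)" for z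
      by (auto intro!: derivative_eq_intros)
    show "0 \<le> 1 / sqrt (z\<^sup>2 + 1) - k" if "z \<in> {-R..R}" for z
    proof -
      have "z\<^sup>2 \<le> R\<^sup>2" using that by (intro abs_le_square_iff[THEN iffD1]) auto
      then have "sqrt (z\<^sup>2 + 1) \<le> 1 + R"
        using R by (intro real_le_lsqrt) (auto simp: power2_eq_square algebra_simps)
      then show ?thesis using R unfolding k_def by (simp add: frac_le add_nonneg_pos)
    qed
  qed auto
  moreover have "x \<in> {-R..R}" "y \<in> {-R..R}" unfolding R_def atLeastAtMost_iff by linarith+
  ultimately have "h ((1 - 1/2) *\<^sub>R x + (1/2) *\<^sub>R y) \<le> (1 - 1/2) * h x + 1/2 * h y"
    by (intro convex_onD) auto
  then have "2 * h ((x + y) / 2) \<le> h x + h y" by (simp add: add_divide_distrib)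
  moreover have "k / 2 * x\<^sup>2 + k / 2 * y\<^sup>2 - 2 * (k / 2 * ((x + y) / 2)\<^sup>2) = k * (x - y)\<^sup>2 / 4"
    by (simp add: power2_eq_square field_simps)
  moreover have "(x - y)\<^sup>2 / (4 * (1 + \<bar>x\<bar> + \<bar>y\<bar>)) = k * (x - y)\<^sup>2 / 4"
    by (simp add: k_def R_def add.assoc)
  \<comment> \<open>The nonlinear terms become variables, which leaves linear arithmetic.\<close>
  moreover have "r \<le> a + b - 2 * e" if "2 * (e - m) \<le> (a - p) + (b - q)" "p + q - 2 * m = s" "r = s"
    for a b e m p q r s :: real
    using that by (simp add: algebra_simps)
  ultimately show ?thesis unfolding h_def by blast
qed

text \<open>The gap inequality for x and - x, whose midpoint is 0.\<close>

lemma entropy_fun_nonneg: "0 \<le> entropy_fun x"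
proof -
  have "entropy_fun (- x) = entropy_fun x" "entropy_fun 0 = 0"
    by (simp_all add: entropy_fun_def arsinh_minus_real)
  moreover have "0 \<le> (x - (-x))\<^sup>2 / (4 * (1 + \<bar>x\<bar> + \<bar>-x\<bar>))" by simp
  then have "0 \<le> entropy_fun x + entropy_fun (-x) - 2 * entropy_fun ((x + -x) / 2)"
    using entropy_fun_gap order_trans by blast
  ultimately show ?thesis by simp
qed

text \<open>The estimate |x| + sqrt(x^2 + 1) <= (1 + |x|)^2 bounds \<open>arsinh\<close>, and the
  remaining summand 1 - sqrt(x^2 + 1) is not positive.\<close>

lemma entropy_fun_le:
  assumes "\<bar>x\<bar> \<le> y"
  shows "entropy_fun x \<le> 2 * ((1 + y) * ln (1 + y))"
proof -
  have y: "0 \<le> y" using assms by simp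
  have even: "entropy_fun x = entropy_fun \<bar>x\<bar>" by (simp add: entropy_fun_def abs_if arsinh_minus_real)
  have "sqrt (\<bar>x\<bar>\<^sup>2 + 1) \<le> 1 + \<bar>x\<bar>" by (intro real_le_lsqrt) (auto simp: power2_eq_square algebra_simps)
  then have "arsinh \<bar>x\<bar> \<le> ln ((1 + \<bar>x\<bar>)\<^sup>2)"
    unfolding arsinh_real_def using arsinh_real_aux[of "\<bar>x\<bar>"]
    by (intro ln_mono) (auto simp: power2_eq_square algebra_simps intro: order_trans)
  also have "\<dots> = 2 * ln (1 + \<bar>x\<bar>)" by (simp add: ln_realpow)
  finally have ars: "arsinh \<bar>x\<bar> \<le> 2 * ln (1 + \<bar>x\<bar>)" .
  have "1 \<le> sqrt (\<bar>x\<bar>\<^sup>2 + 1)" by simp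
  then have "entropy_fun \<bar>x\<bar> \<le> \<bar>x\<bar> * arsinh \<bar>x\<bar>" by (simp add: entropy_fun_def)
  also have "\<dots> \<le> \<bar>x\<bar> * (2 * ln (1 + \<bar>x\<bar>))" using ars by (intro mult_left_mono) auto
  also have "\<dots> \<le> (1 + y) * (2 * ln (1 + y))" using assms y by (intro mult_mono) auto
  finally show ?thesis using even by simp
qed

lemma continuous_on_entropy_fun [continuous_intros]:
  "continuous_on A f \<Longrightarrow> continuous_on A (\<lambda>x. entropy_fun (f x))"
proof -
  have "continuous_on UNIV entropy_fun"
    by (rule DERIV_continuous_on[where D = arsinh]) (rule has_field_derivative_at_within[OF entropy_fun_deriv])
  then show "continuous_on A f \<Longrightarrow> ?thesis" by (rule continuous_on_compose2) auto
qed

text \<open>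
  The strictly convex functional below has second derivative at least \<open>1 / (1 + \<bar>x\<bar>)\<close>, so the
  inequality \<open>\<bar>d\<bar> \<le> d\<^sup>2 / (4 l w) + l w\<close> turns near-minimality of two functions into closeness in \<open>L\<^sup>1\<close>.
\<close>

definition entropy :: "(complex \<Rightarrow> complex) \<Rightarrow> real" where
  "entropy f = (\<integral>t. entropy_fun (Re (f t)) + entropy_fun (Im (f t)) \<partial>circle)"

lemma integrable_entropy:
  assumes "continuous_on (sphere 0 1) f"
  shows "integrable circle (\<lambda>t. entropy_fun (Re (f t)) + entropy_fun (Im (f t)))"
  by (intro integrable_circle_continuous continuous_intros assms)

lemma abs_le_gap:
  assumes "0 < l"
  shows "\<bar>x - y\<bar> \<le> (entropy_fun x + entropy_fun y - 2 * entropy_fun ((x + y) / 2)) / l + l * (1 + \<bar>x\<bar> + \<bar>y\<bar>)"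
proof -
  define w where "w = 1 + \<bar>x\<bar> + \<bar>y\<bar>"
  have w: "0 < w" by (simp add: w_def add_pos_nonneg)
  have "0 \<le> (\<bar>x - y\<bar> - 2 * l * w)\<^sup>2" by simp
  then have "\<bar>x - y\<bar> * (4 * l * w) \<le> (x - y)\<^sup>2 + l * w * (4 * l * w)"
    by (simp add: power2_diff power_mult_distrib) (simp add: power2_eq_square algebra_simps)
  then have "\<bar>x - y\<bar> \<le> ((x - y)\<^sup>2 + l * w * (4 * l * w)) / (4 * l * w)"
    using assms w by (simp add: pos_le_divide_eq)
  also have "\<dots> = (x - y)\<^sup>2 / (4 * w) / l + l * w" using assms w by (simp add: field_simps)
  also have "(x - y)\<^sup>2 / (4 * w) / l \<le> (entropy_fun x + entropy_fun y - 2 * entropy_fun ((x + y) / 2)) / l"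
    using entropy_fun_gap[of x y] assms unfolding w_def by (intro divide_right_mono) auto
  finally show ?thesis by (simp add: w_def)
qed

text \<open>\<open>abs_le_gap\<close> for real and imaginary parts, integrated. The parameter l is
  free: it is chosen small first, after which the gap has to be small compared with l.\<close>

lemma L1_le_entropy_gap:
  assumes c: "continuous_on (sphere 0 1) f" "continuous_on (sphere 0 1) g" and l: "0 < l"
  shows "(\<integral>t. cmod (f t - g t) \<partial>circle) \<le>
     (entropy f + entropy g - 2 * entropy (\<lambda>t. (f t + g t) / 2)) / l +
     l * (2 + 2 * (\<integral>t. cmod (f t) \<partial>circle) + 2 * (\<integral>t. cmod (g t) \<partial>circle))"
proof -
  let ?e = "\<lambda>f t. entropy_fun (Re (f t)) + entropy_fun (Im (f t))"
  let ?m = "\<lambda>t. (f t + g t) / 2"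
  have cm: "continuous_on (sphere 0 1) ?m" by (intro continuous_intros c) auto
  note ie = integrable_entropy[OF c(1)] integrable_entropy[OF c(2)] integrable_entropy[OF cm]
  have i: "integrable circle (\<lambda>t. cmod (f t))" "integrable circle (\<lambda>t. cmod (g t))"
    by (intro integrable_circle_continuous continuous_intros c)+
  have "(\<integral>t. cmod (f t - g t) \<partial>circle) \<le>
     (\<integral>t. (?e f t + ?e g t - 2 * ?e ?m t) / l + l * (2 + 2 * cmod (f t) + 2 * cmod (g t)) \<partial>circle)"
  proof (rule integral_mono)
    show "integrable circle (\<lambda>t. cmod (f t - g t))"
      by (intro integrable_circle_continuous continuous_intros c)
    show "integrable circle (\<lambda>t. (?e f t + ?e g t - 2 * ?e ?m t) / l + l * (2 + 2 * cmod (f t) + 2 * cmod (g t)))"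
      by (intro integrable_circle_continuous continuous_intros c) (use l in auto)
    fix t
    have "cmod (f t - g t) \<le> \<bar>Re (f t) - Re (g t)\<bar> + \<bar>Im (f t) - Im (g t)\<bar>"
      using cmod_le[of "f t - g t"] by simp
    also have "\<bar>Re (f t) - Re (g t)\<bar> \<le> (entropy_fun (Re (f t)) + entropy_fun (Re (g t)) - 2 * entropy_fun (Re (?m t))) / l
        + l * (1 + cmod (f t) + cmod (g t))"
    proof -
      have "l * (1 + \<bar>Re (f t)\<bar> + \<bar>Re (g t)\<bar>) \<le> l * (1 + cmod (f t) + cmod (g t))"
        using l by (intro mult_left_mono add_mono abs_Re_le_cmod) auto
      then show ?thesis using abs_le_gap[OF l, of "Re (f t)" "Re (g t)"] by simp
    qed
    also have "\<bar>Im (f t) - Im (g t)\<bar> \<le> (entropy_fun (Im (f t)) + entropy_fun (Im (g t)) - 2 * entropy_fun (Im (?m t))) / l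
        + l * (1 + cmod (f t) + cmod (g t))"
    proof -
      have "l * (1 + \<bar>Im (f t)\<bar> + \<bar>Im (g t)\<bar>) \<le> l * (1 + cmod (f t) + cmod (g t))"
        using l by (intro mult_left_mono add_mono abs_Im_le_cmod) auto
      then show ?thesis using abs_le_gap[OF l, of "Im (f t)" "Im (g t)"] by simp
    qed
    finally show "cmod (f t - g t) \<le> (?e f t + ?e g t - 2 * ?e ?m t) / l + l * (2 + 2 * cmod (f t) + 2 * cmod (g t))"
      using l by (simp add: add_divide_distrib diff_divide_distrib algebra_simps)
  qed
  also have "\<dots> = (entropy f + entropy g - 2 * entropy ?m) / l +
     l * (2 + 2 * (\<integral>t. cmod (f t) \<partial>circle) + 2 * (\<integral>t. cmod (g t) \<partial>circle))"
  proof -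
    have 1: "integrable circle (\<lambda>t. (?e f t + ?e g t - 2 * ?e ?m t) / l)"
      by (intro integrable_circle_continuous continuous_intros c) (use l in auto)
    have 2: "integrable circle (\<lambda>t. l * (2 + 2 * cmod (f t) + 2 * cmod (g t)))"
      by (intro integrable_circle_continuous continuous_intros c)
    have "(\<integral>t. ?e f t + ?e g t - 2 * ?e ?m t \<partial>circle) = entropy f + entropy g - 2 * entropy ?m"
      using Bochner_Integration.integral_diff[OF Bochner_Integration.integrable_add[OF ie(1,2)] integrable_mult_right[OF ie(3), of 2]]
        Bochner_Integration.integral_add[OF ie(1,2)]
      by (simp only: integral_mult_right_zero entropy_def)
    moreover have "(\<integral>t. 2 + 2 * cmod (f t) + 2 * cmod (g t) \<partial>circle) = 2 + 2 * (\<integral>t. cmod (f t) \<partial>circle) + 2 * (\<integral>t. cmod (g t) \<partial>circle)"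
      using i circle.prob_space by simp
    ultimately show ?thesis
      by (subst Bochner_Integration.integral_add[OF 1 2])
         (simp only: integral_divide_zero integral_mult_right_zero)
  qed
  finally show ?thesis .
qed

text \<open>The infima over the decreasing sets increase and are bounded, hence converge. For n <= m
  both minimizers and their midpoint lie in \<open>K n\<close>, so the midpoint has entropy at least
  \<open>I n\<close>, and the convexity gap is at most \<open>L - I n + 2 / Suc n\<close>, which
  tends to 0. The bound B controls the entropies as well as the L^1 norms in the weight.\<close>

lemma entropy_minimizers_Cauchy:
  fixes K :: "nat \<Rightarrow> (complex \<Rightarrow> complex) set"
  assumes cont: "\<And>n f. f \<in> K n \<Longrightarrow> continuous_on (sphere 0 1) f"
    and ne: "\<And>n. K n \<noteq> {}" and dec: "\<And>n. K (Suc n) \<subseteq> K n"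
    and mid: "\<And>n f g. f \<in> K n \<Longrightarrow> g \<in> K n \<Longrightarrow> (\<lambda>t. (f t + g t) / 2) \<in> K n"
    and bound: "\<And>f. f \<in> K 0 \<Longrightarrow> (\<integral>t. (1 + cmod (f t)) * ln (1 + cmod (f t)) \<partial>circle) \<le> B"
  obtains f where "\<And>n. f n \<in> K n"
    "\<And>e. 0 < e \<Longrightarrow> \<exists>n0. \<forall>m\<ge>n0. \<forall>n\<ge>n0. (\<integral>t. cmod (f m t - f n t) \<partial>circle) < e"
proof -
  have sub: "K m \<subseteq> K n" if "n \<le> m" for m n
    using lift_Suc_antimono_le[of K, OF dec that] .
  have pos: "0 \<le> entropy f" for f
    unfolding entropy_def by (intro integral_nonneg_AE AE_I2 add_nonneg_nonneg entropy_fun_nonneg)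
  have cl: "continuous_on (sphere 0 1) (\<lambda>t. (1 + cmod (f t)) * ln (1 + cmod (f t)))"
    if "continuous_on (sphere 0 1) f" for f :: "complex \<Rightarrow> complex"
    by (intro continuous_intros that) (smt (verit) norm_ge_zero)
  have ent: "entropy f \<le> 4 * B" if "f \<in> K n" for f n
  proof -
    have c: "continuous_on (sphere 0 1) f" by (rule cont[OF that])
    have "entropy f \<le> (\<integral>t. 4 * ((1 + cmod (f t)) * ln (1 + cmod (f t))) \<partial>circle)"
      unfolding entropy_def
    proof (rule integral_mono[OF integrable_entropy[OF c]])
      show "integrable circle (\<lambda>t. 4 * ((1 + cmod (f t)) * ln (1 + cmod (f t))))"
        by (intro integrable_mult_right integrable_circle_continuous cl c)
      fix t
      show "entropy_fun (Re (f t)) + entropy_fun (Im (f t)) \<le> 4 * ((1 + cmod (f t)) * ln (1 + cmod (f t)))"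
        using entropy_fun_le[OF abs_Re_le_cmod, of "f t"] entropy_fun_le[OF abs_Im_le_cmod, of "f t"] by linarith
    qed
    also have "\<dots> = 4 * (\<integral>t. (1 + cmod (f t)) * ln (1 + cmod (f t)) \<partial>circle)" by (rule integral_mult_right_zero)
    also have "\<dots> \<le> 4 * B" using bound[of f] sub[of 0 n] that by auto
    finally show ?thesis .
  qed
  have L1: "(\<integral>t. cmod (f t) \<partial>circle) \<le> B" if "f \<in> K n" for f n
  proof -
    have c: "continuous_on (sphere 0 1) f" by (rule cont[OF that])
    have "(\<integral>t. cmod (f t) \<partial>circle) \<le> (\<integral>t. (1 + cmod (f t)) * ln (1 + cmod (f t)) \<partial>circle)"
    proof (rule integral_mono)
      show "integrable circle (\<lambda>t. cmod (f t))" by (intro integrable_circle_continuous continuous_intros c)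
      show "integrable circle (\<lambda>t. (1 + cmod (f t)) * ln (1 + cmod (f t)))" by (intro integrable_circle_continuous cl c)
      fix t
      have p: "0 < 1 + cmod (f t)" by (simp add: add_pos_nonneg)
      \<comment> \<open>From 1 - 1 / u <= ln u for u = 1 + |f|; multiplied by u this reads |f| <= u
        ln u.\<close>
      have "1 - 1 / (1 + cmod (f t)) \<le> ln (1 + cmod (f t))"
        using ln_le_minus_one[of "1 / (1 + cmod (f t))"] p by (simp add: ln_div)
      then have "(1 + cmod (f t)) * (1 - 1 / (1 + cmod (f t))) \<le> (1 + cmod (f t)) * ln (1 + cmod (f t))"
        using p by (intro mult_left_mono) auto
      then show "cmod (f t) \<le> (1 + cmod (f t)) * ln (1 + cmod (f t))"
        using p by (simp add: right_diff_distrib)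
    qed
    also have "\<dots> \<le> B" using bound[of f] sub[of 0 n] that by auto
    finally show ?thesis .
  qed
  define k where "k n = (SOME f. f \<in> K n)" for n
  have k: "k n \<in> K n" for n unfolding k_def using ne[of n] by (rule some_in_eq[THEN iffD2])
  have "0 \<le> (\<integral>t. cmod (k 0 t) \<partial>circle)" by simp
  also have "\<dots> \<le> B" by (rule L1[OF k])
  finally have B: "0 \<le> B" .
  define I where "I n = (INF f\<in>K n. entropy f)" for n
  have bdd: "bdd_below (entropy ` K n)" for n using pos by (intro bdd_belowI2[of _ 0])
  have I_le: "I n \<le> entropy f" if "f \<in> K n" for f n unfolding I_def by (intro cINF_lower bdd that)
  have I_mono: "incseq I"
    unfolding I_def by (intro incseq_SucI cINF_superset_mono bdd ne dec) auto
  have I_bd: "I n \<le> 4 * B" for n by (rule order_trans[OF I_le[OF k] ent[OF k]])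
  obtain L where L: "I \<longlonglongrightarrow> L" "\<And>n. I n \<le> L"
    using incseq_convergent[OF I_mono, of "4 * B"] I_bd by blast
  have "\<exists>f\<in>K n. entropy f < I n + 1 / Suc n" for n
    unfolding I_def using cINF_less_iff[OF ne[of n] bdd, of "I n + 1 / Suc n"] by (simp add: I_def)
  then obtain f where f: "\<And>n. f n \<in> K n" "\<And>n. entropy (f n) < I n + 1 / Suc n" by metis
  \<comment> \<open>Bounds the weight in \<open>L1_le_entropy_gap\<close>, each mean modulus being
    at most B.\<close>
  define w where "w = 2 + 2 * B + 2 * B"
  have w: "0 < w" using B by (simp add: w_def)
  have key: "(\<integral>t. cmod (f m t - f n t) \<partial>circle) \<le> (L - I n + 2 / Suc n) / l + l * w" if "n \<le> m" "0 < l" for m n l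
  proof -
    have fm: "f m \<in> K n" using sub[OF that(1)] f(1) by blast
    have "2 * I n \<le> 2 * entropy (\<lambda>t. (f m t + f n t) / 2)" using I_le[OF mid[OF fm f(1)]] by simp
    moreover have "entropy (f m) \<le> L + 1 / Suc n"
    proof -
      have "1 / real (Suc m) \<le> 1 / real (Suc n)" using that by (intro divide_left_mono) auto
      then show ?thesis using f(2)[of m] L(2)[of m] by linarith
    qed
    ultimately have "entropy (f m) + entropy (f n) - 2 * entropy (\<lambda>t. (f m t + f n t) / 2) \<le> L - I n + 2 / Suc n"
      using f(2)[of n] by simp
    then have 1: "(entropy (f m) + entropy (f n) - 2 * entropy (\<lambda>t. (f m t + f n t) / 2)) / l \<le> (L - I n + 2 / Suc n) / l"
      using that by (intro divide_right_mono) auto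
    have "l * (2 + 2 * (\<integral>t. cmod (f m t) \<partial>circle) + 2 * (\<integral>t. cmod (f n t) \<partial>circle)) \<le> l * w"
      unfolding w_def using that L1[OF f(1), of m] L1[OF f(1), of n] by (intro mult_left_mono) auto
    with 1 L1_le_entropy_gap[OF cont[OF f(1)] cont[OF f(1)] that(2), of m n] show ?thesis by linarith
  qed
  show ?thesis
  proof (rule that[OF f(1)])
    fix e :: real assume e: "0 < e"
    \<comment> \<open>This splits e evenly: l w is e / 2, and n0 then makes the gap term smaller
      than e / 2.\<close>
    define l where "l = e / (2 * w)"
    have l: "0 < l" "l * w = e / 2" using e w by (auto simp: l_def)
    have "(\<lambda>n. (L - I n + 2 / real (Suc n)) / l) \<longlonglongrightarrow> (L - L + 0) / l"
      using l by (intro tendsto_intros L(1) LIMSEQ_Suc[OF lim_const_over_n]) auto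
    then have "(\<lambda>n. (L - I n + 2 / real (Suc n)) / l) \<longlonglongrightarrow> 0" by simp
    from order_tendstoD(2)[OF this, of "e / 2"] e obtain n0 where
      n0: "\<And>n. n \<ge> n0 \<Longrightarrow> (L - I n + 2 / real (Suc n)) / l < e / 2"
      by (auto simp: eventually_sequentially)
    have *: "(\<integral>t. cmod (f m t - f n t) \<partial>circle) < e" if "n0 \<le> n" "n \<le> m" for m n
      using key[OF that(2) l(1)] n0[OF that(1)] l(2) by linarith
    have "(\<integral>t. cmod (f m t - f n t) \<partial>circle) < e" if "n0 \<le> n" "n0 \<le> m" for m n
      using *[of n m] *[of m n] that by (cases "n \<le> m") (auto simp: norm_minus_commute)
    then show "\<exists>n0. \<forall>m\<ge>n0. \<forall>n\<ge>n0. (\<integral>t. cmod (f m t - f n t) \<partial>circle) < e" by blast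
  qed
qed

section \<open>L log L bounds and limits of shifted functions\<close>

lemma fourier_coeff_cnj: "fourier_coeff (\<lambda>t. cnj (f t)) n = cnj (fourier_coeff f (- n))"
proof -
  have "fourier_coeff (\<lambda>t. cnj (f t)) n = (\<integral>t. cnj (f t * chi n t) \<partial>circle)"
    unfolding fourier_coeff_eq by (intro Bochner_Integration.integral_cong) (simp_all add: cnj_chi)
  also have "\<dots> = cnj (\<integral>t. f t * chi n t \<partial>circle)"
    by (rule Bochner_Integration.integral_cnj)
  finally show ?thesis unfolding fourier_coeff_eq minus_minus .
qed

lemma trig_poly_zero:
  assumes "trig_poly p" "\<And>n. fourier_coeff p n = 0" "t \<in> sphere 0 1"
  shows "p t = 0"
proof -
  obtain M :: nat where
    M: "\<And>t. t \<in> sphere 0 1 \<Longrightarrow> p t = (\<Sum>k\<in>{-int M..int M}. fourier_coeff p k * chi k t)"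
    and "\<And>k. \<bar>k\<bar> > int M \<Longrightarrow> fourier_coeff p k = 0"
    using trig_poly_expand[OF assms(1)] by metis
  from M[OF assms(3)] assms(2) show ?thesis by simp
qed

text \<open>F is g plus i times its conjugate function, that is, twice the analytic part of g minus
  the mean, which the doubling counts once too often. The real part is identified through F +
  \<open>cnj\<close> F, whose coefficients are twice those of g. The formula for the coefficients of
  F is what links it to \<open>riesz\<close> later.\<close>

lemma analytic_completion:
  assumes g: "trig_poly (\<lambda>t. complex_of_real (g t))"
  obtains F where "F holomorphic_on UNIV" "trig_poly F" "F 0 = of_real (\<integral>t. g t \<partial>circle)"
    "\<And>t. t \<in> sphere 0 1 \<Longrightarrow> Re (F t) = g t"
    "\<And>n. fourier_coeff F n = 2 * (if 0 \<le> n then fourier_coeff (\<lambda>t. of_real (g t)) n else 0)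
        - of_real (\<integral>t. g t \<partial>circle) * of_bool (n = 0)"
proof -
  define c where "c = fourier_coeff (\<lambda>t. complex_of_real (g t))"
  define m where "m = (\<integral>t. g t \<partial>circle)"
  have c0: "c 0 = of_real m" by (simp add: c_def fourier_coeff_eq m_def)
  have cc: "cnj (c n) = c (- n)" for n
    using fourier_coeff_cnj[of "\<lambda>t. complex_of_real (g t)" "-n"] by (simp add: c_def)
  obtain M :: nat where
    "\<And>t. t \<in> sphere 0 1 \<Longrightarrow> of_real (g t) = (\<Sum>k\<in>{-int M..int M}. c k * chi k t)"
    and M: "\<And>k. \<bar>k\<bar> > int M \<Longrightarrow> c k = 0"
    unfolding c_def using trig_poly_expand[OF g] by metis
  define F where "F z = 2 * (\<Sum>k\<le>M. c (int k) * z ^ k) - of_real m" for z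
  have hol: "F holomorphic_on UNIV" unfolding F_def by (intro holomorphic_intros)
  have Fchi: "F = (\<lambda>t. 2 * (\<Sum>k\<le>M. c (int k) * chi (int k) t) - of_real m * chi 0 t)"
    by (rule ext) (simp add: F_def chi_def)
  have tF: "trig_poly F"
    unfolding Fchi by (intro trig_poly_diff trig_poly_cmult trig_poly_sum trig_poly_chi)
  have F0: "F 0 = of_real m"
  proof -
    have "(\<Sum>k\<le>M. c (int k) * 0 ^ k) = (\<Sum>k\<in>{0}. c (int k) * 0 ^ k)"
      by (rule sum.mono_neutral_right) auto
    then show ?thesis by (simp add: F_def c0)
  qed
  have coF: "fourier_coeff F n = 2 * (if 0 \<le> n then c n else 0) - of_real m * of_bool (n = 0)" for n
  proof -
    have "fourier_coeff F n = 2 * (\<Sum>k\<le>M. c (int k) * of_bool (n = int k)) - of_real m * of_bool (n = 0)"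
      unfolding Fchi
      by (subst fourier_coeff_diff)
         (auto simp: fourier_coeff_cmult fourier_coeff_sum fourier_coeff_chi simp del: chi_0
            intro!: integrable_trig_poly trig_poly_cmult trig_poly_sum trig_poly_chi)
    also have "(\<Sum>k\<le>M. c (int k) * of_bool (n = int k)) = (if 0 \<le> n then c n else 0)"
    proof (cases "0 \<le> n")
      case True
      have "(\<Sum>k\<le>M. c (int k) * of_bool (n = int k)) = (\<Sum>k\<le>M. if k = nat n then c n else 0)"
        using True by (intro sum.cong) auto
      also have "\<dots> = c n" using M[of n] True by (auto simp: nat_le_iff)
      finally show ?thesis using True by simp
    qed auto
    finally show ?thesis .
  qed
  have Re: "Re (F t) = g t" if t: "t \<in> sphere 0 1" for t
  proof -
    have tq: "trig_poly (\<lambda>t. F t + cnj (F t) - 2 * of_real (g t))"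
      by (intro trig_poly_diff trig_poly.add trig_poly_cmult trig_poly_cnj tF g)
    have "F t + cnj (F t) - 2 * of_real (g t) = 0"
    proof (rule trig_poly_zero[OF tq _ t])
      fix n
      have "fourier_coeff (\<lambda>t. F t + cnj (F t) - 2 * of_real (g t)) n =
          fourier_coeff F n + cnj (fourier_coeff F (- n)) - 2 * c n"
        unfolding c_def
        by (subst fourier_coeff_diff fourier_coeff_add;
            (intro integrable_trig_poly trig_poly.add trig_poly_cmult trig_poly_cnj tF g)?)+
           (simp add: fourier_coeff_cnj fourier_coeff_cmult)
      also have "\<dots> = 0"
        using c0 by (cases n "0::int" rule: linorder_cases) (simp_all add: coF cc)
      finally show "fourier_coeff (\<lambda>t. F t + cnj (F t) - 2 * of_real (g t)) n = 0" .
    qed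
    then have "of_real (2 * Re (F t) - 2 * g t) = (0 :: complex)"
      by (simp add: complex_add_cnj)
    then show ?thesis by (simp only: of_real_eq_0_iff)
  qed
  show ?thesis
    by (rule that[OF hol tF F0[unfolded m_def] Re coF[unfolded c_def m_def]])
qed

text \<open>The modulus of \<open>exp (- F)\<close> is \<open>exp (- Re F)\<close>, so the maximum
  principle for it is a minimum principle for Re F.\<close>

lemma Re_ge_on_disc:
  assumes F: "F holomorphic_on UNIV" and ge: "\<And>t. t \<in> sphere 0 1 \<Longrightarrow> 1 \<le> Re (F t)" and z: "z \<in> cball 0 1"
  shows "1 \<le> Re (F z)"
proof -
  have "(\<lambda>z. exp (- F z)) holomorphic_on UNIV" using F by (intro holomorphic_intros)
  then have hol: "(\<lambda>z. exp (- F z)) holomorphic_on S" for S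
    by (rule holomorphic_on_subset) simp
  have "cmod (exp (- F z)) \<le> exp (- 1)"
  proof (rule maximum_modulus_frontier[OF hol _ _ _ z])
    show "continuous_on (closure (cball 0 1)) (\<lambda>z. exp (- F z))"
      by (rule holomorphic_on_imp_continuous_on[OF hol])
    show "cmod (exp (- F t)) \<le> exp (- 1)" if "t \<in> frontier (cball 0 1)" for t
      using ge[of t] that by simp
  qed simp
  then show ?thesis by simp
qed

text \<open>
  M. Riesz's converse to Zygmund's theorem: integrating \<open>F Ln F\<close> over the circle for the analytic completion \<open>F\<close>
  of \<open>g\<close> bounds the integral of \<open>g ln g\<close>.
\<close>

lemma integral_times_ln_le:
  assumes F: "F holomorphic_on UNIV" "F 0 = of_real m"
    and Re: "\<And>t. t \<in> sphere 0 1 \<Longrightarrow> Re (F t) = g t"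
    and g: "\<And>t. t \<in> sphere 0 1 \<Longrightarrow> 1 \<le> g t" "continuous_on (sphere 0 1) g"
  shows "(\<integral>t. g t * ln (g t) \<partial>circle) \<le> m * ln m + pi * (\<integral>t. cmod (F t) \<partial>circle)"
proof -
  have ge: "1 \<le> Re (F z)" if "z \<in> cball 0 1" for z
    using Re_ge_on_disc[OF F(1) _ that] Re g by auto
  \<comment> \<open>Real part at least 1 keeps F off the branch cut, so \<open>F Ln F\<close> is
    holomorphic in the disc and continuous up to the circle.\<close>
  have nz: "F z \<noteq> 0" "F z \<notin> \<real>\<^sub>\<le>\<^sub>0" if "z \<in> cball 0 1" for z
    using ge[OF that] by (auto simp: complex_nonpos_Reals_iff)
  have m: "1 \<le> m" using ge[of 0] F(2) by simp
  have cF: "continuous_on (cball 0 1) F"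
    by (rule holomorphic_on_imp_continuous_on[OF holomorphic_on_subset[OF F(1)]]) auto
  let ?G = "\<lambda>z. F z * Ln (F z)"
  have cG: "continuous_on (cball 0 1) ?G"
    using nz by (intro continuous_intros cF continuous_on_Ln) auto
  have hG: "?G holomorphic_on ball 0 1"
    using nz by (intro holomorphic_intros holomorphic_on_subset[OF F(1)]) auto
  have sub: "sphere 0 1 \<subseteq> cball (0::complex) 1" by auto
  have iG: "integrable circle ?G"
    by (intro integrable_circle_continuous continuous_on_subset[OF cG sub])
  have "(\<integral>t. ?G t \<partial>circle) = of_real m * Ln (of_real m)"
    using mean_value_circle[OF cG hG] F(2) by simp
  also have "\<dots> = of_real (m * ln m)" using m by (simp add: Ln_of_real)
  finally have "Re (\<integral>t. ?G t \<partial>circle) = m * ln m" by simp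
  then have val: "(\<integral>t. Re (?G t) \<partial>circle) = m * ln m" by (subst integral_Re[OF iG])
  have iF: "integrable circle (\<lambda>t. cmod (F t))"
    by (intro integrable_circle_continuous continuous_intros continuous_on_subset[OF cF sub])
  have "(\<integral>t. g t * ln (g t) \<partial>circle) \<le> (\<integral>t. Re (?G t) + pi * cmod (F t) \<partial>circle)"
  proof (rule integral_mono_AE)
    show "integrable circle (\<lambda>t. g t * ln (g t))"
      by (intro integrable_circle_continuous continuous_intros g(2)) (use g(1) in force)
    show "integrable circle (\<lambda>t. Re (?G t) + pi * cmod (F t))"
      by (intro Bochner_Integration.integrable_add integrable_Re iG integrable_mult_right iF)
    show "AE t in circle. g t * ln (g t) \<le> Re (?G t) + pi * cmod (F t)"
    proof (rule AE_I2)
      fix t assume "t \<in> space circle"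
      then have t: "t \<in> sphere 0 1" "t \<in> cball 0 1" by auto
      have "g t \<le> cmod (F t)" using complex_Re_le_cmod[of "F t"] Re[OF t(1)] by simp
      then have "ln (g t) \<le> Re (Ln (F t))" using g(1)[OF t(1)] nz[OF t(2)] by simp
      then have "g t * ln (g t) \<le> g t * Re (Ln (F t))" using g(1)[OF t(1)] by (intro mult_left_mono) auto
      \<comment> \<open>Re (F Ln F) = Re F Re (Ln F) - Im F Im (Ln F). The first product is at least
        g ln g because |F| >= g, and the second is at most pi |F| because the argument is at most pi
        in modulus.\<close>
      moreover have "Im (F t) * Im (Ln (F t)) \<le> cmod (F t) * pi"
      proof -
        have "\<bar>Im (F t) * Im (Ln (F t))\<bar> \<le> cmod (F t) * pi"
          unfolding abs_mult using abs_Im_le_cmod[of "F t"] mpi_less_Im_Ln[OF nz(1)[OF t(2)]] Im_Ln_le_pi[OF nz(1)[OF t(2)]]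
          by (intro mult_mono) auto
        then show ?thesis by simp
      qed
      ultimately show "g t * ln (g t) \<le> Re (?G t) + pi * cmod (F t)"
        using Re[OF t(1)] by (simp add: mult.commute)
    qed
  qed
  also have "\<dots> = m * ln m + pi * (\<integral>t. cmod (F t) \<partial>circle)"
    unfolding val[symmetric] using iF
    by (subst Bochner_Integration.integral_add[OF integrable_Re[OF iG] integrable_mult_right[OF iF]])
       (simp only: integral_mult_right_zero)
  finally show ?thesis .
qed

section \<open>Uniform integrability and limits of the shifted functions\<close>

context bfn_riesz
begin

text \<open>The modulus of c need not be a trigonometric polynomial. Approximating |c| + 2 within 1
  gives a real polynomial g with 1 + |c| <= g <= |c| + 3: it majorizes 1 + |c|, stays at least 1 as
  the logarithm requires, and its norm exceeds that of c by at most three times the norm of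
  1.\<close>

lemma L_log_L_bound:
  "\<exists>B. \<forall>c. trig_poly c \<and> N c \<le> K \<longrightarrow> (\<integral>t. (1 + cmod (c t)) * ln (1 + cmod (c t)) \<partial>circle) \<le> B"
proof -
  obtain C where C: "0 < C" "\<And>f. f \<in> X \<Longrightarrow> (\<integral>t. cmod (f t) \<partial>circle) \<le> C * N f" using bfs_L1 by blast
  define P where "P = operator_norm X N riesz"
  have P: "0 \<le> P" "\<And>f. f \<in> X \<Longrightarrow> N (riesz f) \<le> P * N f"
    unfolding P_def using operator_norm_nonneg_bound[OF lin_space_bfs riesz_bounded] by auto
  define n1 where "n1 = N (\<lambda>t. 1)"
  have one: "(\<lambda>t. 1) \<in> X" by (intro bfs_trig_poly trig_poly_const)
  \<comment> \<open>\<open>K1\<close> bounds the norm of g, \<open>K2\<close> the mean of g through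
    the embedding into L^1. In \<open>B\<close> the square of \<open>K2\<close> bounds m ln m, and
    the rest bounds pi times the mean of |F|. The modulus of K keeps \<open>K1\<close> nonnegative
    for every K.\<close>
  define K1 where "K1 = \<bar>K\<bar> + 3 * n1"
  have n1: "0 \<le> n1" by (simp add: n1_def)
  have K1: "0 \<le> K1" using n1 by (simp add: K1_def)
  define K2 where "K2 = C * K1"
  define B where "B = K2 * K2 + pi * (C * (2 * P * K1 + K2 * n1))"
  have "(\<integral>t. (1 + cmod (c t)) * ln (1 + cmod (c t)) \<partial>circle) \<le> B" if c: "trig_poly c" "N c \<le> K" for c
  proof -
    have cc: "continuous_on (sphere 0 1) c" by (rule trig_poly_continuous[OF c(1)])
    have "continuous_on (sphere 0 1) (\<lambda>t. cmod (c t) + 2)" by (intro continuous_intros cc)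
    then obtain g where g: "trig_poly (\<lambda>t. complex_of_real (g t))"
      "\<And>t. t \<in> sphere 0 1 \<Longrightarrow> \<bar>cmod (c t) + 2 - g t\<bar> < 1"
      by (rule trig_poly_approx_real[of _ 1]) auto
    have g1: "1 + cmod (c t) \<le> g t" "g t \<le> cmod (c t) + 3" if "t \<in> sphere 0 1" for t
      using g(2)[OF that] by linarith+
    have gX: "(\<lambda>t. complex_of_real (g t)) \<in> X" by (rule bfs_trig_poly[OF g(1)])
    have cg: "continuous_on (sphere 0 1) g"
      using continuous_on_Re[OF trig_poly_continuous[OF g(1)]] by simp
    let ?a = "\<lambda>t. complex_of_real (cmod (c t))"
    have a: "?a \<in> X" "N ?a \<le> N c"
      using measurable_trig_poly[OF c(1)] by (auto intro!: bfs_dominated[OF bfs_trig_poly[OF c(1)]])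
    have "N (\<lambda>t. complex_of_real (g t)) \<le> N (\<lambda>t. ?a t + 3 * 1)"
    proof (rule bfs_dominated(2)[OF bfs_add(1)[OF a(1) bfs_cmult(1)[OF one]] bfs_measurable[OF gX]])
      show "AE t in circle. cmod (of_real (g t)) \<le> cmod (?a t + 3 * 1)"
      proof (rule AE_I2)
        fix t assume "t \<in> space circle"
        then have "0 \<le> g t" "g t \<le> cmod (c t) + 3"
          using g1[of t] norm_ge_zero[of "c t"] by (auto simp del: norm_ge_zero intro: order_trans)
        moreover have "cmod (?a t + 3 * 1) = cmod (c t) + 3"
          using norm_of_real[of "cmod (c t) + 3", where 'a = complex] by simp
        ultimately show "cmod (of_real (g t)) \<le> cmod (?a t + 3 * 1)" by simp
      qed
    qed
    also have "\<dots> \<le> N ?a + N (\<lambda>t. 3 * 1)" by (rule bfs_add(2)[OF a(1) bfs_cmult(1)[OF one]])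
    also have "\<dots> \<le> K1" using a(2) c(2) bfs_cmult(2)[OF one, of 3] by (simp add: K1_def n1_def)
    finally have Ng: "N (\<lambda>t. complex_of_real (g t)) \<le> K1" .
    define m where "m = (\<integral>t. g t \<partial>circle)"
    obtain F where F: "F holomorphic_on UNIV" "trig_poly F" "F 0 = of_real m"
      "\<And>t. t \<in> sphere 0 1 \<Longrightarrow> Re (F t) = g t"
      "\<And>n. fourier_coeff F n = 2 * (if 0 \<le> n then fourier_coeff (\<lambda>t. of_real (g t)) n else 0)
        - of_real m * of_bool (n = 0)"
      using analytic_completion[OF g(1)] unfolding m_def by blast
    have ig: "integrable circle g" by (rule integrable_circle_continuous[OF cg])
    have m1: "1 \<le> m"
    proof -
      have "(\<integral>t. 1 \<partial>circle) \<le> m"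
        unfolding m_def
      proof (intro integral_mono_AE AE_I2 ig)
        fix t assume "t \<in> space circle"
        then have "1 + cmod (c t) \<le> g t" using g1(1) by simp
        then show "1 \<le> g t" using norm_ge_zero[of "c t"] by linarith
      qed simp
      then show ?thesis using circle.prob_space by simp
    qed
    have mK: "m \<le> K2"
    proof -
      have "m \<le> (\<integral>t. cmod (of_real (g t)) \<partial>circle)"
        unfolding m_def using ig by (intro integral_mono_AE AE_I2) auto
      also have "\<dots> \<le> C * N (\<lambda>t. complex_of_real (g t))" by (rule C(2)[OF gX])
      also have "\<dots> \<le> K2" unfolding K2_def using Ng C(1) by (intro mult_left_mono) auto
      finally show ?thesis .
    qed
    \<comment> \<open>F and 2 \<open>riesz\<close> g - m have the same Fourier coefficients, so the
      boundedness of \<open>riesz\<close> passes to F.\<close>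
    have NF: "N F \<le> 2 * P * K1 + K2 * n1"
    proof -
      let ?r = "\<lambda>t. 2 * riesz (\<lambda>t. of_real (g t)) t"
      have r: "?r \<in> X" by (rule bfs_cmult(1)[OF riesz_bfs[OF gX]])
      have k: "(\<lambda>t. of_real m * 1) \<in> X" by (rule bfs_cmult(1)[OF one])
      have "AE t in circle. F t = ?r t - of_real m * 1"
      proof (rule fourier_unique)
        show "integrable circle F" by (rule integrable_trig_poly[OF F(2)])
        show "integrable circle (\<lambda>t. ?r t - of_real m * 1)" by (rule bfs_integrable[OF bfs_diff(1)[OF r k]])
        fix n
        have "fourier_coeff (\<lambda>t. ?r t - of_real m * 1) n = fourier_coeff ?r n - fourier_coeff (\<lambda>t. of_real m * chi 0 t) n"
          using bfs_integrable[OF r] by (simp add: fourier_coeff_diff)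
        also have "\<dots> = fourier_coeff F n"
          unfolding fourier_coeff_cmult fourier_coeff_chi F(5) fourier_coeff_riesz[OF gX] ..
        finally show "fourier_coeff F n = fourier_coeff (\<lambda>t. ?r t - of_real m * 1) n" ..
      qed
      then have "N F = N (\<lambda>t. ?r t - of_real m * 1)"
        by (rule bfs_cong(2)[OF bfs_diff(1)[OF r k] measurable_trig_poly[OF F(2)]])
      also have "\<dots> \<le> N ?r + N (\<lambda>t. of_real m * 1)" by (rule bfs_diff(2)[OF r k])
      also have "N ?r \<le> 2 * P * K1"
      proof -
        have "N ?r \<le> 2 * (P * N (\<lambda>t. of_real (g t)))"
          using bfs_cmult(2)[OF riesz_bfs[OF gX], of 2] P(2)[OF gX] by simp
        also have "\<dots> \<le> 2 * (P * K1)" using Ng P(1) by (intro mult_left_mono) auto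
        finally show ?thesis by simp
      qed
      also have "N (\<lambda>t. of_real m * 1) \<le> K2 * n1"
        using bfs_cmult(2)[OF one, of "of_real m"] mK m1 n1 by (auto simp: n1_def intro!: mult_right_mono)
      finally show ?thesis by simp
    qed
    have "(\<integral>t. (1 + cmod (c t)) * ln (1 + cmod (c t)) \<partial>circle) \<le> (\<integral>t. g t * ln (g t) \<partial>circle)"
    proof (rule integral_mono_AE)
      have pos: "1 + cmod (c t) \<noteq> 0" for t using norm_ge_zero[of "c t"] by linarith
      show "integrable circle (\<lambda>t. (1 + cmod (c t)) * ln (1 + cmod (c t)))"
        by (intro integrable_circle_continuous continuous_intros cc ballI pos)
      have "g t \<noteq> 0" if "t \<in> sphere 0 1" for t using g1(1)[OF that] norm_ge_zero[of "c t"] by linarith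
      then show "integrable circle (\<lambda>t. g t * ln (g t))"
        by (intro integrable_circle_continuous continuous_intros cg ballI)
      show "AE t in circle. (1 + cmod (c t)) * ln (1 + cmod (c t)) \<le> g t * ln (g t)"
      proof (rule AE_I2)
        fix t assume "t \<in> space circle"
        then have "1 + cmod (c t) \<le> g t" using g1(1) by simp
        moreover have "0 < 1 + cmod (c t)" by (simp add: add_pos_nonneg)
        ultimately show "(1 + cmod (c t)) * ln (1 + cmod (c t)) \<le> g t * ln (g t)"
          by (intro mult_mono ln_mono) auto
      qed
    qed
    also have "\<dots> \<le> m * ln m + pi * (\<integral>t. cmod (F t) \<partial>circle)"
    proof (rule integral_times_ln_le[OF F(1,3,4) _ cg])
      fix t :: complex assume "t \<in> sphere 0 1"
      then show "1 \<le> g t" using g1(1)[of t] norm_ge_zero[of "c t"] by linarith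
    qed
    also have "m * ln m \<le> K2 * K2"
    proof -
      have "ln m \<le> m" using ln_le_minus_one[of m] m1 by linarith
      then show ?thesis using m1 mK by (intro mult_mono) auto
    qed
    also have "pi * (\<integral>t. cmod (F t) \<partial>circle) \<le> pi * (C * (2 * P * K1 + K2 * n1))"
    proof -
      have "(\<integral>t. cmod (F t) \<partial>circle) \<le> C * N F" by (rule C(2)[OF bfs_trig_poly[OF F(2)]])
      also have "\<dots> \<le> C * (2 * P * K1 + K2 * n1)" using NF C(1) by (intro mult_left_mono) auto
      finally show ?thesis by (intro mult_left_mono) auto
    qed
    finally show ?thesis by (simp add: B_def)
  qed
  then show ?thesis by blast
qed

text \<open>
  The differences of the functions \<open>h n\<close> are trigonometric polynomials. The weak limit of the \<open>h n\<close> is found as the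
  \<open>L\<^sup>1\<close>-limit of near-minimizers of the entropy over a decreasing sequence of convex sets.
\<close>

lemma limit_of_shifted:
  assumes h: "\<And>n::nat. n0 \<le> n \<Longrightarrow> h n \<in> X" "\<And>n. n0 \<le> n \<Longrightarrow> N (h n) \<le> C"
    and hc: "\<And>n k. n0 \<le> n \<Longrightarrow> fourier_coeff (h n) k = (if - int n \<le> k then \<beta> k else 0)"
  obtains g where "g \<in> X" "N g \<le> C" "\<And>k. fourier_coeff g k = \<beta> k"
proof -
  \<comment> \<open>A fixed base point: for n >= n0 the coefficients of \<open>h n - D\<close>
    vanish except possibly at indices from - n to below - n0.\<close>
  define D where "D = h n0"
  have D: "D \<in> X" "N D \<le> C" unfolding D_def using h by auto
  have C0: "0 \<le> C" using D(2) norm_nonneg order_trans by blast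
  have Dc: "fourier_coeff D k = (if - int n0 \<le> k then \<beta> k else 0)" for k
    unfolding D_def by (rule hc) simp
  \<comment> \<open>Corrections c for which D + c stays in the ball of radius C and has the
    prescribed coefficients from index - (n0 + n) on. Growing n adds conditions, so the sets
    decrease, and the conditions are convex.\<close>
  define K where "K n = {c. trig_poly c \<and> N (\<lambda>t. D t + c t) \<le> C \<and>
      (\<forall>k\<ge>- int (n0 + n). fourier_coeff c k = \<beta> k - fourier_coeff D k)}" for n
  have mid: "(\<lambda>t. (c t + d t) / 2) \<in> K n" if cd: "c \<in> K n" "d \<in> K n" for c d n
  proof -
    have tp: "trig_poly c" "trig_poly d" using cd by (auto simp: K_def)
    have tm: "trig_poly (\<lambda>t. (c t + d t) / 2)"
      using trig_poly_cmult[OF trig_poly.add[OF tp], of "1/2"] by simp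
    have X': "(\<lambda>t. D t + c t) \<in> X" "(\<lambda>t. D t + d t) \<in> X"
      by (intro bfs_add D bfs_trig_poly tp)+
    have "N (\<lambda>t. D t + (c t + d t) / 2) = N (\<lambda>t. (1/2) * ((D t + c t) + (D t + d t)))"
      by (rule arg_cong[of _ _ N]) (auto simp: field_simps)
    also have "\<dots> \<le> (1/2) * (N (\<lambda>t. D t + c t) + N (\<lambda>t. D t + d t))"
      using bfs_cmult(2)[OF bfs_add(1)[OF X'], of "1/2"] bfs_add(2)[OF X'] by simp
    also have "\<dots> \<le> C" using cd by (simp add: K_def)
    finally have "N (\<lambda>t. D t + (c t + d t) / 2) \<le> C" .
    moreover have "fourier_coeff (\<lambda>t. (c t + d t) / 2) k = \<beta> k - fourier_coeff D k" if "k \<ge> - int (n0 + n)" for k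
    proof -
      have "fourier_coeff (\<lambda>t. (c t + d t) / 2) k = (1/2) * (fourier_coeff c k + fourier_coeff d k)"
        using fourier_coeff_cmult[of "1/2" "\<lambda>t. c t + d t" k] fourier_coeff_add[OF integrable_trig_poly[OF tp(1)] integrable_trig_poly[OF tp(2)]]
        by simp
      also have "\<dots> = \<beta> k - fourier_coeff D k" using cd that by (simp add: K_def)
      finally show ?thesis .
    qed
    ultimately show ?thesis using tm by (simp add: K_def)
  qed
  have ne: "K n \<noteq> {}" for n
  proof -
    let ?n = "n0 + n"
    \<comment> \<open>The missing block of coefficients: D + c equals \<open>h (n0 + n)\<close>
      almost everywhere, so its norm is at most C.\<close>
    define c where "c t = (\<Sum>k\<in>{- int ?n..<- int n0}. \<beta> k * chi k t)" for t
    have tc: "trig_poly c"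
      unfolding c_def by (intro trig_poly_sum trig_poly_cmult trig_poly_chi)
    have cc: "fourier_coeff c k = (if - int ?n \<le> k \<and> k < - int n0 then \<beta> k else 0)" for k
    proof -
      have "fourier_coeff c k = (\<Sum>j\<in>{- int ?n..<- int n0}. if j = k then \<beta> j else 0)"
        unfolding c_def
        by (subst fourier_coeff_sum) (auto simp: fourier_coeff_cmult fourier_coeff_chi intro!: sum.cong)
      then show ?thesis by auto
    qed
    have "AE t in circle. D t + c t = h ?n t"
    proof (rule fourier_unique)
      show "integrable circle (\<lambda>t. D t + c t)" by (intro bfs_integrable bfs_add D bfs_trig_poly tc)
      show "integrable circle (h ?n)" by (intro bfs_integrable h) simp
      show "fourier_coeff (\<lambda>t. D t + c t) k = fourier_coeff (h ?n) k" for k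
        using bfs_integrable[OF D(1)] integrable_trig_poly[OF tc]
        by (auto simp: fourier_coeff_add hc Dc cc)
    qed
    then have "N (\<lambda>t. D t + c t) = N (h ?n)"
      by (rule bfs_cong(2)[OF h(1) bfs_measurable[OF bfs_add(1)[OF D(1) bfs_trig_poly[OF tc]]], rotated]) simp
    then have "c \<in> K n" using tc h(2)[of ?n] by (auto simp: K_def cc Dc)
    then show ?thesis by blast
  qed
  \<comment> \<open>Radius 2 C because c is the difference of D + c and D, both of norm at most
    C.\<close>
  obtain B where B: "\<And>c. trig_poly c \<Longrightarrow> N c \<le> 2 * C \<Longrightarrow> (\<integral>t. (1 + cmod (c t)) * ln (1 + cmod (c t)) \<partial>circle) \<le> B"
    using L_log_L_bound[of "2 * C"] by blast
  obtain f where f: "\<And>n. f n \<in> K n"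
    "\<And>e. 0 < e \<Longrightarrow> \<exists>n0. \<forall>m\<ge>n0. \<forall>n\<ge>n0. (\<integral>t. cmod (f m t - f n t) \<partial>circle) < e"
  proof (rule entropy_minimizers_Cauchy[of K B])
    show "continuous_on (sphere 0 1) f" if "f \<in> K n" for f n
      using that by (intro trig_poly_continuous) (simp add: K_def)
    show "K (Suc n) \<subseteq> K n" for n by (auto simp: K_def)
    fix c assume "c \<in> K 0"
    then have c: "trig_poly c" "N (\<lambda>t. D t + c t) \<le> C" by (auto simp: K_def)
    have "N c = N (\<lambda>t. (D t + c t) - D t)" by simp
    also have "\<dots> \<le> N (\<lambda>t. D t + c t) + N D"
      by (intro bfs_diff bfs_add D bfs_trig_poly c)
    also have "\<dots> \<le> 2 * C" using c D by simp
    finally show "(\<integral>t. (1 + cmod (c t)) * ln (1 + cmod (c t)) \<partial>circle) \<le> B" using B c by blast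
  qed (use ne mid in auto)
  have tf: "trig_poly (f n)" for n using f(1)[of n] by (simp add: K_def)
  obtain g r where g: "integrable circle g" "strict_mono r" "AE t in circle. (\<lambda>k. f (r k) t) \<longlonglongrightarrow> g t"
    "(\<lambda>k. \<integral>t. cmod (f (r k) t - g t) \<partial>circle) \<longlonglongrightarrow> 0"
    using L1_Cauchy_limit[of circle f, OF integrable_trig_poly[OF tf] f(2)] by blast
  have gc: "fourier_coeff g k = \<beta> k - fourier_coeff D k" for k
  proof -
    have "(\<lambda>j. fourier_coeff (f (r j)) k - fourier_coeff g k) \<longlonglongrightarrow> 0"
    proof (rule Lim_null_comparison[OF always_eventually g(4)], intro allI)
      fix j
      have i: "integrable circle (f (r j))" by (rule integrable_trig_poly[OF tf])
      show "norm (fourier_coeff (f (r j)) k - fourier_coeff g k) \<le> (\<integral>t. cmod (f (r j) t - g t) \<partial>circle)"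
        using norm_fourier_coeff_le[OF Bochner_Integration.integrable_diff[OF i g(1)], of k]
        by (simp add: fourier_coeff_diff[OF i g(1)])
    qed
    \<comment> \<open>From j >= |k| on, the index k lies in the range prescribed by
      \<open>K (r j)\<close>, as r j >= j; the coefficients are then constant in j.\<close>
    moreover have "\<forall>\<^sub>F j in sequentially. fourier_coeff (f (r j)) k - fourier_coeff g k = (\<beta> k - fourier_coeff D k) - fourier_coeff g k"
      using eventually_ge_at_top[of "nat \<bar>k\<bar>"]
    proof eventually_elim
      case (elim j)
      have "j \<le> r j" using g(2) by (rule seq_suble)
      then have "k \<ge> - int (n0 + r j)" using elim by auto
      then show ?case using f(1)[of "r j"] by (simp add: K_def)
    qed
    ultimately have "(\<lambda>j. (\<beta> k - fourier_coeff D k) - fourier_coeff g k) \<longlonglongrightarrow> 0"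
      by (rule Lim_transform_eventually)
    then show ?thesis by (simp add: LIMSEQ_const_iff)
  qed
  have m: "(\<lambda>t. D t + g t) \<in> borel_measurable circle"
    using bfs_measurable[OF D(1)] borel_measurable_integrable[OF g(1)] by simp
  have "\<rho> (\<lambda>t. ennreal (cmod (D t + g t))) \<le> ennreal C"
  proof (rule rho_fatou[where F = "\<lambda>j t. ennreal (cmod (D t + f (r j) t))"])
    have mj: "(\<lambda>t. D t + f (r j) t) \<in> X" for j by (intro bfs_add D bfs_trig_poly tf)
    show "(\<lambda>t. ennreal (cmod (D t + f (r j) t))) \<in> borel_measurable circle" for j
      by (rule measurable_norm_ennreal[OF bfs_measurable[OF mj]])
    show "AE t in circle. (\<lambda>j. ennreal (cmod (D t + f (r j) t))) \<longlonglongrightarrow> ennreal (cmod (D t + g t))"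
      using g(3) by eventually_elim (intro tendsto_intros)
    show "\<rho> (\<lambda>t. ennreal (cmod (D t + f (r j) t))) \<le> ennreal C" for j
      unfolding rho_eq_norm[OF mj] using f(1)[of "r j"] by (intro ennreal_leI) (simp add: K_def)
  qed (use measurable_norm_ennreal[OF m] in auto)
  from bfs_normI[OF m this C0] have "(\<lambda>t. D t + g t) \<in> X" "N (\<lambda>t. D t + g t) \<le> C" .
  moreover have "fourier_coeff (\<lambda>t. D t + g t) k = \<beta> k" for k
    by (simp add: fourier_coeff_add[OF bfs_integrable[OF D(1)] g(1)] gc)
  ultimately show ?thesis by (rule that)
qed

end

section \<open>Toeplitz operators\<close>

context bfn_riesz
begin

lemma bfs_mult_bounded:
  assumes f: "f \<in> X" and a: "a \<in> borel_measurable circle" "AE t in circle. cmod (a t) \<le> B" and B: "0 \<le> B"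
  shows "(\<lambda>t. a t * f t) \<in> X" "N (\<lambda>t. a t * f t) \<le> B * N f"
proof -
  have m: "(\<lambda>t. a t * f t) \<in> borel_measurable circle"
    using a(1) bfs_measurable[OF f] by simp
  have le: "AE t in circle. cmod (a t * f t) \<le> cmod (of_real B * f t)"
    using a(2) by eventually_elim (use B in \<open>simp add: norm_mult mult_right_mono\<close>)
  show "(\<lambda>t. a t * f t) \<in> X" by (rule bfs_dominated(1)[OF bfs_cmult(1)[OF f] m le])
  show "N (\<lambda>t. a t * f t) \<le> B * N f"
    using bfs_dominated(2)[OF bfs_cmult(1)[OF f] m le] bfs_cmult(2)[OF f, of "of_real B"] B by simp
qed

text \<open>Testing on the indicator of the set E where |a| > B + d gives (B + d) N(1_E) <= B
  N(1_E), which forces E to be null. The hypothesis speaks of \<open>\<rho>\<close> because the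
  product of a and f is not yet known to belong to \<open>X\<close> where the lemma is
  applied.\<close>

lemma AE_le_of_multiplier:
  assumes a: "a \<in> borel_measurable circle" and B: "0 \<le> B"
    and mult: "\<And>f. f \<in> X \<Longrightarrow> \<rho> (\<lambda>t. ennreal (cmod (a t * f t))) \<le> ennreal (B * N f)"
  shows "AE t in circle. cmod (a t) \<le> B"
proof -
  have "AE t in circle. cmod (a t) \<le> B + 1 / Suc n" for n :: nat
  proof -
    define d where "d = 1 / real (Suc n)"
    have d: "0 < d" by (simp add: d_def)
    define E where "E = {t \<in> space circle. B + d < cmod (a t)}"
    have E: "E \<in> sets circle" unfolding E_def using a by measurable
    define f where "f = (indicator E :: complex \<Rightarrow> complex)"
    have f: "f \<in> X" unfolding f_def using E by (intro bfs_bounded[of _ 1]) (auto split: split_indicator)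
    have fm: "f \<in> borel_measurable circle" by (rule bfs_measurable[OF f])
    have "ennreal ((B + d) * N f) = ennreal (N (\<lambda>t. of_real (B + d) * f t))"
      using bfs_cmult(2)[OF f, of "of_real (B + d)"] B d by (simp del: of_real_add)
    also have "\<dots> = \<rho> (\<lambda>t. ennreal (cmod (of_real (B + d) * f t)))"
      by (rule rho_eq_norm[OF bfs_cmult(1)[OF f], symmetric])
    also have "\<dots> \<le> \<rho> (\<lambda>t. ennreal (cmod (a t * f t)))"
    proof (rule rho_mono)
      show "AE t in circle. ennreal (cmod (of_real (B + d) * f t)) \<le> ennreal (cmod (a t * f t))"
        using B d by (intro AE_I2 ennreal_leI)
          (auto simp: f_def E_def norm_mult simp del: of_real_add split: split_indicator)
    qed (use a fm in \<open>auto intro!: measurable_norm_ennreal borel_measurable_times\<close>)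
    also have "\<dots> \<le> ennreal (B * N f)" by (rule mult[OF f])
    finally have "(B + d) * N f \<le> B * N f" using B by (subst (asm) ennreal_le_iff) auto
    then have "d * N f \<le> 0" by (simp add: distrib_right)
    then have "N f = 0" using d norm_nonneg[of f] by (simp add: mult_le_0_iff)
    then have "AE t in circle. f t = 0" using norm_eq_0_iff[OF f] by simp
    then show ?thesis
      using AE_space by eventually_elim (auto simp: f_def E_def d_def indicator_def split: if_splits)
  qed
  then have "AE t in circle. \<forall>n::nat. cmod (a t) \<le> B + 1 / Suc n"
    unfolding AE_all_countable by blast
  then show ?thesis
  proof eventually_elim
    case (elim t)
    have "(\<lambda>n. B + 1 / real (Suc n)) \<longlonglongrightarrow> B + 0"
      by (intro tendsto_intros LIMSEQ_Suc[OF lim_const_over_n])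
    then have "cmod (a t) \<le> B + 0" by (rule LIMSEQ_le_const) (use elim in blast)
    then show ?case by simp
  qed
qed

lemma esssup_cmod_le:
  assumes a: "a \<in> borel_measurable circle" and "AE t in circle. cmod (a t) \<le> B" and B: "0 \<le> B"
  shows "a \<in> Linf" "Linf_norm a \<le> B"
proof -
  have "esssup circle (\<lambda>t. ennreal (cmod (a t))) \<le> ennreal B"
    using assms by (intro esssup_I) (auto intro: ennreal_leI)
  then show "a \<in> Linf" "Linf_norm a \<le> B"
    using a B by (auto simp: Linf_def Linf_norm_def intro: le_less_trans enn2real_leI)
qed

lemma AE_cmod_le_Linf_norm:
  assumes "a \<in> Linf"
  shows "AE t in circle. cmod (a t) \<le> Linf_norm a"
proof -
  have "(\<lambda>t. ennreal (cmod (a t))) \<in> borel_measurable circle"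
    using assms by (auto simp: Linf_def)
  from esssup_AE[of "\<lambda>t. ennreal (cmod (a t))" circle] show ?thesis
  proof eventually_elim
    case (elim t)
    have "esssup circle (\<lambda>t. ennreal (cmod (a t))) = ennreal (Linf_norm a)"
      using assms by (simp add: Linf_def Linf_norm_def)
    with elim have "ennreal (cmod (a t)) \<le> ennreal (Linf_norm a)" by simp
    moreover have "0 \<le> Linf_norm a" unfolding Linf_norm_def by (rule enn2real_nonneg)
    ultimately show ?case by (simp only: ennreal_le_iff)
  qed
qed

end

section \<open>Operators with a Toeplitz matrix\<close>

locale toeplitz_matrix = bfn_riesz +
  fixes A :: "(complex \<Rightarrow> complex) \<Rightarrow> (complex \<Rightarrow> complex)" and \<alpha> :: "int \<Rightarrow> complex"
  assumes A: "bounded_operator (hardy_space \<rho>) (bfs_norm \<rho>) A"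
    and matrix: "\<And>j k :: int. 0 \<le> j \<Longrightarrow> 0 \<le> k \<Longrightarrow> pairing (A (chi j)) (chi k) = \<alpha> (k - j)"
begin

abbreviation A_norm where "A_norm \<equiv> operator_norm H N A"

lemmas A_norm = operator_norm_nonneg_bound[OF lin_space_hardy A]

lemma A_hardy: "f \<in> H \<Longrightarrow> A f \<in> H"
  by (rule bounded_operatorD(1)[OF A])

text \<open>The pairing with \<open>chi k\<close> is the coefficient at k; negative indices vanish
  because A maps into the Hardy space.\<close>

lemma fourier_coeff_A_chi:
  assumes "0 \<le> j"
  shows "fourier_coeff (A (chi j)) k = (if 0 \<le> k then \<alpha> (k - j) else 0)"
proof (cases "0 \<le> k")
  case True
  have "fourier_coeff (A (chi j)) k = pairing (A (chi j)) (chi k)"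
    unfolding fourier_coeff_eq pairing_def
    by (intro Bochner_Integration.integral_cong) (simp_all add: cnj_chi)
  then show ?thesis using matrix[OF assms True] True by simp
next
  case False
  then show ?thesis using hardyD(2)[OF A_hardy[OF chi_hardy[OF assms]]] by simp
qed

lemma fourier_coeff_A_sum:
  assumes "finite I" "\<And>j. j \<in> I \<Longrightarrow> 0 \<le> j"
  shows "fourier_coeff (A (\<lambda>t. \<Sum>j\<in>I. c j * chi j t)) k = (if 0 \<le> k then \<Sum>j\<in>I. c j * \<alpha> (k - j) else 0)"
proof -
  have s: "(\<lambda>t. \<Sum>j\<in>I. c j * chi j t) \<in> H"
    using assms by (intro lin_space_sum[OF lin_space_hardy] lin_spaceD(4)[OF lin_space_hardy] chi_hardy)
  have Ac: "A (chi j) \<in> X" if "j \<in> I" for j using assms that by (intro hardyD(1) A_hardy chi_hardy)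
  have "AE t in circle. A (\<lambda>t. \<Sum>j\<in>I. c j * chi j t) t = (\<Sum>j\<in>I. c j * A (chi j) t)"
    using assms by (intro bounded_operator_sum[OF lin_space_hardy A] chi_hardy)
  then have "fourier_coeff (A (\<lambda>t. \<Sum>j\<in>I. c j * chi j t)) k = fourier_coeff (\<lambda>t. \<Sum>j\<in>I. c j * A (chi j) t) k"
    by (rule fourier_coeff_cong_AE)
       (use Ac in \<open>auto intro!: bfs_measurable bfs_sum bfs_cmult hardyD(1)[OF A_hardy[OF s]]\<close>)
  also have "\<dots> = (\<Sum>j\<in>I. c j * fourier_coeff (A (chi j)) k)"
    using Ac by (subst fourier_coeff_sum) (auto simp: fourier_coeff_cmult intro!: bfs_integrable bfs_cmult)
  also have "\<dots> = (if 0 \<le> k then \<Sum>j\<in>I. c j * \<alpha> (k - j) else 0)"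
    using assms by (auto simp: fourier_coeff_A_chi)
  finally show ?thesis .
qed

text \<open>Here g stands for the product of the symbol with p before the symbol is known: it has
  the coefficients of the formal product, and the norm bound that multiplication by the symbol
  should satisfy.\<close>

lemma symbol_times_trig_poly:
  assumes p: "finite I" "p = (\<lambda>t. \<Sum>j\<in>I. c j * chi j t)"
  obtains g where "g \<in> X" "N g \<le> A_norm * N p" "\<And>k. fourier_coeff g k = (\<Sum>j\<in>I. c j * \<alpha> (k - j))"
proof -
  \<comment> \<open>From n0 on, the shift by n makes all frequencies of p nonnegative, so that A may
    be applied; the sum of all |j| is a crude choice.\<close>
  obtain n0 :: nat where n0: "\<And>j. j \<in> I \<Longrightarrow> - int n0 \<le> j"
  proof
    fix j assume "j \<in> I"
    then have "\<bar>j\<bar> \<le> (\<Sum>j\<in>I. \<bar>j\<bar>)" using p(1) by (intro member_le_sum) auto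
    then show "- int (nat (\<Sum>j\<in>I. \<bar>j\<bar>)) \<le> j" by linarith
  qed
  \<comment> \<open>\<open>chi n\<close> times p, written with the frequencies j + n so that
    \<open>fourier_coeff_A_sum\<close> applies; the two agree on the circle.\<close>
  define q where "q n t = (\<Sum>j\<in>(\<lambda>j. j + int n) ` I. c (j - int n) * chi j t)" for n :: nat and t
  define h where "h n = (\<lambda>t. chi (- int n) t * A (q n) t)" for n :: nat
  have inj: "inj_on (\<lambda>j. j + int n) I" for n by (auto simp: inj_on_def)
  have pX: "p \<in> X" unfolding p(2) by (intro bfs_trig_poly trig_poly_sum trig_poly_cmult trig_poly_chi)
  have qH: "q n \<in> H" if "n0 \<le> n" for n
    unfolding q_def using n0 that
    by (intro lin_space_sum[OF lin_space_hardy] lin_spaceD(4)[OF lin_space_hardy] chi_hardy) force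
  have q_eq: "q n t = chi (int n) t * p t" if "t \<in> sphere 0 1" for n t
    unfolding q_def p(2) using that
    by (subst sum.reindex[OF inj]) (simp add: sum_distrib_left mult.left_commute chi_mult add.commute)
  have Nq: "N (q n) = N p" if "n0 \<le> n" for n
  proof -
    have "N (q n) = N (\<lambda>t. chi (int n) t * p t)"
      using q_eq by (intro bfs_cong(2) chi_mult_bfs pX bfs_measurable hardyD(1) qH that AE_I2) simp
    then show ?thesis using chi_mult_bfs(2)[OF pX] by simp
  qed
  have hX: "h n \<in> X" if "n0 \<le> n" for n
    unfolding h_def by (intro chi_mult_bfs hardyD(1) A_hardy qH that)
  have hN: "N (h n) \<le> A_norm * N p" if "n0 \<le> n" for n
    unfolding h_def using A_norm(2)[OF qH[OF that]] chi_mult_bfs(2)[OF hardyD(1)[OF A_hardy[OF qH[OF that]]]] Nq[OF that]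
    by simp
  \<comment> \<open>The shift by n before A and by - n after it cancel in the argument of
    \<open>\<alpha>\<close>; what remains of n is the cut-off at - n, which recedes as n
    grows.\<close>
  have hc: "fourier_coeff (h n) k = (if - int n \<le> k then \<Sum>j\<in>I. c j * \<alpha> (k - j) else 0)" if "n0 \<le> n" for n k
  proof -
    have "fourier_coeff (h n) k = fourier_coeff (A (q n)) (k + int n)"
      unfolding h_def fourier_coeff_shift by simp
    also have "\<dots> = (if 0 \<le> k + int n then \<Sum>j\<in>(\<lambda>j. j + int n) ` I. c (j - int n) * \<alpha> (k + int n - j) else 0)"
      unfolding q_def by (rule fourier_coeff_A_sum) (use p(1) n0 that in force)+
    also have "\<dots> = (if - int n \<le> k then \<Sum>j\<in>I. c j * \<alpha> (k - j) else 0)"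
      by (subst sum.reindex[OF inj]) (simp add: algebra_simps)
    finally show ?thesis .
  qed
  show ?thesis
    by (rule limit_of_shifted[OF hX hN hc]) (use that in blast)+
qed

lemma symbol_exists:
  obtains a where "a \<in> X" "\<And>n. fourier_coeff a n = \<alpha> n" "AE t in circle. cmod (a t) \<le> A_norm"
proof -
  \<comment> \<open>The sum over the single frequency 0 is the constant 1, whose formal product with
    the symbol is the symbol itself.\<close>
  obtain a where a: "a \<in> X" "N a \<le> A_norm * N (\<lambda>t. \<Sum>j\<in>{0}. 1 * chi j t)"
    "\<And>k. fourier_coeff a k = (\<Sum>j\<in>{0::int}. 1 * \<alpha> (k - j))"
    using symbol_times_trig_poly[of "{0}" _ "\<lambda>_. 1", OF _ refl] by blast
  have am: "a \<in> borel_measurable circle" by (rule bfs_measurable[OF a(1)])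
  have ac: "fourier_coeff a k = \<alpha> k" for k using a(3) by simp
  \<comment> \<open>The product of a and p is integrable, and its coefficients are those of the g
    supplied for p; uniqueness identifies the two, which transfers the norm bound.\<close>
  have poly: "\<rho> (\<lambda>t. ennreal (cmod (a t * p t))) \<le> ennreal (A_norm * N p)" if p: "trig_poly p" for p
  proof -
    obtain M :: nat where
      M: "\<And>t. t \<in> sphere 0 1 \<Longrightarrow> p t = (\<Sum>k\<in>{-int M..int M}. fourier_coeff p k * chi k t)"
      using trig_poly_expand[OF p] by metis
    \<comment> \<open>\<open>symbol_times_trig_poly\<close> asks for equality of functions, whereas
      p is known to equal its expansion only on the circle.\<close>
    define p' where "p' = (\<lambda>t. \<Sum>k\<in>{-int M..int M}. fourier_coeff p k * chi k t)"
    have tp': "trig_poly p'" unfolding p'_def by (intro trig_poly_sum trig_poly_cmult trig_poly_chi)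
    obtain g where g: "g \<in> X" "N g \<le> A_norm * N p'"
      "\<And>k. fourier_coeff g k = (\<Sum>j\<in>{-int M..int M}. fourier_coeff p j * \<alpha> (k - j))"
      using symbol_times_trig_poly[of "{-int M..int M}" p', OF _ p'_def] by blast
    have eq: "a t * p t = (\<Sum>j\<in>{-int M..int M}. fourier_coeff p j * (chi j t * a t))" if "t \<in> sphere 0 1" for t
      by (simp add: M[OF that] sum_distrib_left mult_ac)
    have i: "integrable circle (\<lambda>t. \<Sum>j\<in>{-int M..int M}. fourier_coeff p j * (chi j t * a t))"
      using bfs_integrable[OF a(1)] by auto
    have iap: "integrable circle (\<lambda>t. a t * p t)"
      using i by (subst Bochner_Integration.integrable_cong[OF refl eq]) auto
    have "AE t in circle. a t * p t = g t"
    proof (rule fourier_unique[OF iap bfs_integrable[OF g(1)]])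
      fix k
      have "fourier_coeff (\<lambda>t. a t * p t) k = fourier_coeff (\<lambda>t. \<Sum>j\<in>{-int M..int M}. fourier_coeff p j * (chi j t * a t)) k"
        by (rule fourier_coeff_cong[OF eq])
      also have "\<dots> = (\<Sum>j\<in>{-int M..int M}. fourier_coeff p j * fourier_coeff a (k - j))"
        using bfs_integrable[OF a(1)]
        by (subst fourier_coeff_sum) (auto simp: fourier_coeff_cmult fourier_coeff_shift)
      finally show "fourier_coeff (\<lambda>t. a t * p t) k = fourier_coeff g k" by (simp add: g(3) ac)
    qed
    then have *: "(\<lambda>t. a t * p t) \<in> X" "N (\<lambda>t. a t * p t) = N g"
      using bfs_cong[OF g(1) borel_measurable_integrable[OF iap]] by auto
    have "N p' = N p"
      using M by (intro bfs_cong(2) bfs_trig_poly p measurable_trig_poly tp' AE_I2) (simp add: p'_def)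
    then show ?thesis using rho_eq_norm[OF *(1)] * g(2) by (simp add: ennreal_leI)
  qed
  have "AE t in circle. cmod (a t) \<le> A_norm"
  proof (rule AE_le_of_multiplier[OF am A_norm(1)])
    fix f assume f: "f \<in> X"
    from trig_poly_sequence[OF sep f] obtain q where
      q: "\<And>j::nat. trig_poly (q j)" "(\<lambda>j. N (\<lambda>t. q j t - f t)) \<longlonglongrightarrow> 0" by blast
    have qX: "q j \<in> X" for j by (intro bfs_trig_poly q)
    from bfs_tendsto_AE_subseq[OF qX f q(2)] obtain r where
      r: "strict_mono r" "AE t in circle. (\<lambda>j. q (r j) t) \<longlonglongrightarrow> f t" by blast
    have Nq: "N (q j) \<le> N f + N (\<lambda>t. q j t - f t)" for j
      using bfs_add(2)[OF f bfs_diff(1)[OF qX f], of j] by simp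
    \<comment> \<open>The Fatou property extends the bound from polynomials to f along a subsequence
      converging almost everywhere; the norm of \<open>q (r j)\<close> exceeds that of f by at most
      a term tending to 0.\<close>
    show "\<rho> (\<lambda>t. ennreal (cmod (a t * f t))) \<le> ennreal (A_norm * N f)"
    proof (rule rho_fatou[where F = "\<lambda>j t. ennreal (cmod (a t * q (r j) t))"
          and c = "\<lambda>j. ennreal (A_norm * (N f + N (\<lambda>t. q (r j) t - f t)))"])
      show "AE t in circle. (\<lambda>j. ennreal (cmod (a t * q (r j) t))) \<longlonglongrightarrow> ennreal (cmod (a t * f t))"
        using r(2) by eventually_elim (intro tendsto_intros)
      show "\<rho> (\<lambda>t. ennreal (cmod (a t * q (r j) t))) \<le> ennreal (A_norm * (N f + N (\<lambda>t. q (r j) t - f t)))" for j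
        using poly[OF q(1), of "r j"] Nq[of "r j"] A_norm(1)
        by (elim order_trans) (intro ennreal_leI mult_left_mono)
      have "(\<lambda>j. A_norm * (N f + N (\<lambda>t. q (r j) t - f t))) \<longlonglongrightarrow> A_norm * (N f + 0)"
        using LIMSEQ_subseq_LIMSEQ[OF q(2) r(1)] by (intro tendsto_intros) (simp add: o_def)
      then show "(\<lambda>j. ennreal (A_norm * (N f + N (\<lambda>t. q (r j) t - f t)))) \<longlonglongrightarrow> ennreal (A_norm * N f)"
        by (intro tendsto_ennrealI) simp
    qed (use am bfs_measurable[OF qX] bfs_measurable[OF f] in \<open>auto intro!: measurable_norm_ennreal borel_measurable_times\<close>)
  qed
  with that[OF a(1) ac] show ?thesis by blast
qed

text \<open>The upper estimate holds because T_a is multiplication by a followed by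
  \<open>riesz\<close>. For the lower one, |a| is at most \<open>A_norm\<close>, which does not
  exceed the norm of T_a once A and T_a agree.\<close>

lemma toeplitz_representation:
  "\<exists>a \<in> Linf. bounded_operator H N (toeplitz a) \<and>
     (\<forall>f \<in> H. AE t in circle. A f t = toeplitz a f t) \<and>
     (\<forall>n. fourier_coeff a n = \<alpha> n) \<and>
     Linf_norm a \<le> operator_norm H N (toeplitz a) \<and>
     operator_norm H N (toeplitz a) \<le> operator_norm X N riesz * Linf_norm a"
proof -
  obtain a where a: "a \<in> X" "\<And>n. fourier_coeff a n = \<alpha> n" "AE t in circle. cmod (a t) \<le> A_norm"
    using symbol_exists by blast
  have am: "a \<in> borel_measurable circle" by (rule bfs_measurable[OF a(1)])
  note aLinf = esssup_cmod_le[OF am a(3) A_norm(1)]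
  note a_le = AE_cmod_le_Linf_norm[OF aLinf(1)]
  have L0: "0 \<le> Linf_norm a" by (simp add: Linf_norm_def)
  note af = bfs_mult_bounded[OF _ am a_le L0]
  note P = operator_norm_nonneg_bound[OF lin_space_bfs riesz_bounded]
  define C where "C = operator_norm X N riesz * Linf_norm a"
  have C0: "0 \<le> C" unfolding C_def using P(1) L0 by simp
  have TX: "N (toeplitz a f) \<le> C * N f" if "f \<in> X" for f
  proof -
    have "N (toeplitz a f) \<le> operator_norm X N riesz * N (\<lambda>t. a t * f t)"
      unfolding toeplitz_def by (rule P(2)[OF af(1)[OF that]])
    also have "\<dots> \<le> operator_norm X N riesz * (Linf_norm a * N f)"
      using af(2)[OF that] P(1) by (intro mult_left_mono)
    finally show ?thesis by (simp add: C_def mult_ac)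
  qed
  have TH: "toeplitz a f \<in> H" if "f \<in> H" for f
    unfolding toeplitz_def by (intro riesz_hardy af hardyD(1)[OF that])
  have T: "bounded_operator H N (toeplitz a)"
    unfolding bounded_operator_def
  proof (intro conjI ballI allI exI[of _ C])
    fix f g assume fg: "f \<in> H" "g \<in> H"
    have "AE t in circle. riesz (\<lambda>t. a t * f t + a t * g t) t = riesz (\<lambda>t. a t * f t) t + riesz (\<lambda>t. a t * g t) t"
      by (intro bounded_operatorD(2)[OF riesz_bounded] af hardyD(1) fg)
    then show "AE t in circle. toeplitz a (\<lambda>s. f s + g s) t = toeplitz a f t + toeplitz a g t"
      by (simp add: toeplitz_def distrib_left)
  next
    fix f c assume f: "f \<in> H"
    have "AE t in circle. riesz (\<lambda>t. c * (a t * f t)) t = c * riesz (\<lambda>t. a t * f t) t"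
      by (intro bounded_operatorD(3)[OF riesz_bounded] af hardyD(1) f)
    then show "AE t in circle. toeplitz a (\<lambda>s. c * f s) t = c * toeplitz a f t"
      by (simp add: toeplitz_def mult.left_commute)
  qed (use TH TX hardyD(1) in auto)
  \<comment> \<open>On analytic polynomials both sides have the convolution of c with
    \<open>\<alpha>\<close> as coefficients at k >= 0, and vanishing coefficients at negative
    k.\<close>
  have eq_poly: "AE t in circle. A s t = toeplitz a s t"
    if "finite I" "\<And>j. j \<in> I \<Longrightarrow> 0 \<le> j" and s: "s = (\<lambda>t. \<Sum>j\<in>I. c j * chi j t)" for I c s
  proof (rule fourier_unique)
    have sH: "s \<in> H"
      unfolding s using that by (intro lin_space_sum[OF lin_space_hardy] lin_spaceD(4)[OF lin_space_hardy] chi_hardy)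
    show "integrable circle (A s)" "integrable circle (toeplitz a s)"
      by (intro bfs_integrable hardyD(1) A_hardy TH sH)+
    fix k
    have "fourier_coeff (\<lambda>t. a t * s t) k = fourier_coeff (\<lambda>t. \<Sum>j\<in>I. c j * (chi j t * a t)) k"
      by (rule fourier_coeff_cong) (simp add: s sum_distrib_left mult_ac)
    also have "\<dots> = (\<Sum>j\<in>I. c j * \<alpha> (k - j))"
      using bfs_integrable[OF a(1)]
      by (subst fourier_coeff_sum) (auto simp: fourier_coeff_cmult fourier_coeff_shift a(2))
    finally show "fourier_coeff (A s) k = fourier_coeff (toeplitz a s) k"
      unfolding toeplitz_def fourier_coeff_riesz[OF af(1)[OF hardyD(1)[OF sH]]]
      unfolding s by (simp add: fourier_coeff_A_sum[OF that(1,2)])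
  qed
  have eq: "AE t in circle. A f t = toeplitz a f t" if f: "f \<in> H" for f
  proof -
    have fX: "f \<in> X" by (rule hardyD(1)[OF f])
    from trig_poly_sequence[OF sep fX] obtain q where
      q: "\<And>j::nat. trig_poly (q j)" "(\<lambda>j. N (\<lambda>t. q j t - f t)) \<longlonglongrightarrow> 0" by blast
    have qX: "q j \<in> X" for j by (intro bfs_trig_poly q)
    have "\<exists>M::nat. \<forall>t\<in>sphere 0 1. q j t = (\<Sum>k\<in>{-int M..int M}. fourier_coeff (q j) k * chi k t)" for j
      using trig_poly_expand[OF q(1)] by metis
    then obtain M :: "nat \<Rightarrow> nat" where
      M: "\<And>j t. t\<in>sphere 0 1 \<Longrightarrow> q j t = (\<Sum>k\<in>{-int (M j)..int (M j)}. fourier_coeff (q j) k * chi k t)" by metis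
    \<comment> \<open>The analytic part of \<open>q j\<close>, equal to \<open>riesz (q j)\<close>
      almost everywhere. The approximants \<open>q j\<close> need not lie in the Hardy space; their
      projections do, and they still tend to f because \<open>riesz\<close> fixes f almost
      everywhere.\<close>
    define s where "s j = (\<lambda>t. \<Sum>k\<in>{0..int (M j)}. fourier_coeff (q j) k * chi k t)" for j
    have sH: "s j \<in> H" for j
      unfolding s_def by (intro lin_space_sum[OF lin_space_hardy] lin_spaceD(4)[OF lin_space_hardy] chi_hardy) auto
    have s_riesz: "AE t in circle. s j t = riesz (q j) t" for j
    proof (rule fourier_unique)
      show "integrable circle (s j)" "integrable circle (riesz (q j))"
        by (intro bfs_integrable hardyD(1)[OF sH] riesz_bfs qX)+
      fix k
      \<comment> \<open>Shows that the coefficients of \<open>q j\<close> beyond \<open>M j\<close>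
        vanish, so that the sum from 0 to \<open>M j\<close> captures all those of nonnegative
        index.\<close>
      have qk: "fourier_coeff (q j) k = (\<Sum>i\<in>{-int (M j)..int (M j)}. if i = k then fourier_coeff (q j) i else 0)"
        by (subst fourier_coeff_cong[OF M], assumption, subst fourier_coeff_sum)
           (auto simp: fourier_coeff_cmult fourier_coeff_chi intro!: sum.cong)
      have "fourier_coeff (s j) k = (\<Sum>i\<in>{0..int (M j)}. if i = k then fourier_coeff (q j) i else 0)"
        unfolding s_def
        by (subst fourier_coeff_sum) (auto simp: fourier_coeff_cmult fourier_coeff_chi intro!: sum.cong)
      then show "fourier_coeff (s j) k = fourier_coeff (riesz (q j)) k"
        unfolding fourier_coeff_riesz[OF qX] using qk by (auto split: if_splits)
    qed
    have "N (\<lambda>t. s j t - f t) \<le> operator_norm X N riesz * N (\<lambda>t. q j t - f t)" for j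
    proof -
      have "N (\<lambda>t. s j t - f t) = N (\<lambda>t. riesz (q j) t - riesz f t)"
      proof (rule bfs_cong(2))
        show "(\<lambda>t. riesz (q j) t - riesz f t) \<in> X" by (intro bfs_diff riesz_bfs qX fX)
        show "(\<lambda>t. s j t - f t) \<in> borel_measurable circle" by (intro bfs_measurable bfs_diff hardyD(1)[OF sH] fX)
        show "AE t in circle. s j t - f t = riesz (q j) t - riesz f t"
          using s_riesz[of j] riesz_hardy_eq[OF f] by eventually_elim simp
      qed
      then show ?thesis using bounded_operator_diff(2)[OF lin_space_bfs riesz_bounded qX fX] by simp
    qed
    then have s_lim: "(\<lambda>j. N (\<lambda>t. s j t - f t)) \<longlonglongrightarrow> 0"
      by (intro tendsto_sandwich[OF _ _ tendsto_const tendsto_mult_right_zero[OF q(2)]])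
         (auto intro!: always_eventually)
    \<comment> \<open>A f and T_a f are compared through \<open>s j\<close>, on which both operators
      agree; D collects the two operator norms. The left-hand side of the estimate is independent of
      j, so it is 0.\<close>
    define D where "D = A_norm + operator_norm H N (toeplitz a)"
    have "N (\<lambda>t. A f t - toeplitz a f t) \<le> D * N (\<lambda>t. s j t - f t)" for j
    proof -
      have X': "A f \<in> X" "A (s j) \<in> X" "toeplitz a f \<in> X" "toeplitz a (s j) \<in> X"
        by (intro hardyD(1) A_hardy TH f sH)+
      have "N (\<lambda>t. A (s j) t - toeplitz a f t) = N (\<lambda>t. toeplitz a (s j) t - toeplitz a f t)"
      proof (rule bfs_cong(2)[OF bfs_diff(1)[OF X'(4,3)] bfs_measurable[OF bfs_diff(1)[OF X'(2,3)]]])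
        have "AE t in circle. A (s j) t = toeplitz a (s j) t"
          by (rule eq_poly[OF _ _ s_def]) auto
        then show "AE t in circle. A (s j) t - toeplitz a f t = toeplitz a (s j) t - toeplitz a f t"
          by eventually_elim simp
      qed
      also have "\<dots> \<le> operator_norm H N (toeplitz a) * N (\<lambda>t. s j t - f t)"
        by (rule bounded_operator_diff(2)[OF lin_space_hardy T sH f])
      finally have 1: "N (\<lambda>t. A (s j) t - toeplitz a f t) \<le> operator_norm H N (toeplitz a) * N (\<lambda>t. s j t - f t)" .
      have "N (\<lambda>t. A (s j) t - A f t) \<le> A_norm * N (\<lambda>t. s j t - f t)"
        by (rule bounded_operator_diff(2)[OF lin_space_hardy A sH f])
      with 1 norm_triangle_diff[OF X'(1,2,3)] norm_minus_commute_bfs[of "A f" "A (s j)"]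
      show ?thesis by (simp add: D_def distrib_right)
    qed
    then have "N (\<lambda>t. A f t - toeplitz a f t) \<le> 0"
      by (intro LIMSEQ_le_const[OF tendsto_mult_right_zero[OF s_lim, of D]]) blast
    then have "N (\<lambda>t. A f t - toeplitz a f t) = 0" using norm_nonneg[of "\<lambda>t. A f t - toeplitz a f t"] by linarith
    moreover have "(\<lambda>t. A f t - toeplitz a f t) \<in> X"
      by (intro bfs_diff hardyD(1) A_hardy TH f)
    ultimately show ?thesis by (simp add: norm_eq_0_iff)
  qed
  have "A_norm \<le> operator_norm H N (toeplitz a)"
  proof (rule operator_norm_le[OF lin_space_hardy])
    fix f assume f: "f \<in> H"
    have "N (A f) = N (toeplitz a f)"
      by (rule bfs_cong(2)[OF _ _ eq[OF f]]) (intro bfs_measurable hardyD(1) A_hardy TH f)+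
    then show "N (A f) \<le> operator_norm H N (toeplitz a) * N f"
      using operator_norm_nonneg_bound(2)[OF lin_space_hardy T f] by simp
  qed (rule operator_norm_nonneg_bound(1)[OF lin_space_hardy T])
  then have "Linf_norm a \<le> operator_norm H N (toeplitz a)" using aLinf(2) by linarith
  moreover have "operator_norm H N (toeplitz a) \<le> C"
    by (rule operator_norm_le[OF lin_space_hardy _ C0]) (rule TX[OF hardyD(1)])
  ultimately show ?thesis
    using aLinf(1) T eq a(2) unfolding C_def by blast
qed

end

theorem corollary1p3:
  fixes \<rho> :: "(complex \<Rightarrow> ennreal) \<Rightarrow> ennreal"
    and A :: "(complex \<Rightarrow> complex) \<Rightarrow> (complex \<Rightarrow> complex)"
    and \<alpha> :: "int \<Rightarrow> complex"
  assumes "banach_function_norm \<rho>"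
    and "bfs_separable \<rho>"
    and "bounded_operator (bfs \<rho>) (bfs_norm \<rho>) riesz"
    and "bounded_operator (hardy_space \<rho>) (bfs_norm \<rho>) A"
    and "\<And>j k :: int. 0 \<le> j \<Longrightarrow> 0 \<le> k \<Longrightarrow> pairing (A (chi j)) (chi k) = \<alpha> (k - j)"
  shows "\<exists>a \<in> Linf.
           bounded_operator (hardy_space \<rho>) (bfs_norm \<rho>) (toeplitz a) \<and>
           (\<forall>f \<in> hardy_space \<rho>. AE t in circle. A f t = toeplitz a f t) \<and>
           (\<forall>n. fourier_coeff a n = \<alpha> n) \<and>
           Linf_norm a \<le> operator_norm (hardy_space \<rho>) (bfs_norm \<rho>) (toeplitz a) \<and>
           operator_norm (hardy_space \<rho>) (bfs_norm \<rho>) (toeplitz a)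
             \<le> operator_norm (bfs \<rho>) (bfs_norm \<rho>) riesz * Linf_norm a"
proof -
  interpret toeplitz_matrix \<rho> A \<alpha>
    using assms by unfold_locales
  show ?thesis by (rule toeplitz_representation)
qed

end
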